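(* Let $V,\gamma,\beta,\lambda,\theta,\bar\theta$ be as in the context. There exist $h_0>0$ and an integer $m\ge 0$ such that $0<(G_h\psi)(y,w)<\infty$ for all $0<h\le h_0$ and all $(y,w)\in\mathbb R^{2d}$ (so that $\mathcal K_h$ is defined for $0<h\le h_0$), and such that, with $W_{+,2m}(x,v):=(1+|x|+|v|)^{2m}W(x,v)^2W_+(x,v)$, the following holds. Let $\rho_0$ be a probability density on $\mathbb R^{2d}$ with $m_{W_{+,2m}}(\rho_0)<\infty$ and fix $T>0$. For each $0<h\le h_0$ set $\rho_0^h:=\rho_0$ and $\rho_{k+1}^h:=\mathcal K_h\rho_k^h$ for $k\ge 0$. Suppose there exists a solution $\rho(t,\cdot)$, $0\le t\le T$ (a probability density for each $t$), of the kinetic Fokker-Planck equation $$\partial_t\rho+v\cdot\nabla_x\rho-\nabla_v\cdot(\nabla_xV(x)\rho)=\nabla_v\cdot(\gamma v\rho+\gamma\beta^{-1}\nabla_v\rho)$$ with initial data $\rho_0$. Assume: (i) there is a constant $C_T^{(1)}>0$ such that for every $f\in C_W^4(\mathbb R^{2d})$ the backward equation $\partial_tu=\mathcal Lu$, $u(0,\cdot)=f$, admits a classical solution $u$ on $[0,T]\times\mathbb R^{2d}$ (for which $\partial_{tt}u$ exists) satisfying $$\sup_{0\le t\le T}\|u(t,\cdot)\|_{C_W^4}+\sup_{0\le t\le T}\|\partial_{tt}u(t,\cdot)\|_{L^\infty_{W_{+,2m}}}\le C_T^{(1)}\|f\|_{C_W^4};$$ (ii) the forward and backward solutions satisfy $$\int_{\mathbb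 R^{2d}}f(z)\rho(t,z)\,dz=\int_{\mathbb R^{2d}}u(t,z)\rho_0(z)\,dz,\qquad 0\le t\le T$$ (these integrals are absolutely convergent by (i) and (iii)); (iii) there exist $h_T\in(0,\min\{h_0,1\}]$ and $M_T>0$ such that $$\sup_{0\le t\le T}m_{W_{+,2m}}(\rho(t,\cdot))+\sup_{h\in(0,h_T]}\ \sup_{k:\,kh\le T}m_{W_{+,2m}}(\rho_k^h)\le M_T.$$ Then there exists a constant $C_T>0$ such that for every $f\in C_W^4(\mathbb R^{2d})$, every $h\in(0,h_T]$, and every integer $n\ge0$ with $nh\le T$, $$\left|\int_{\mathbb R^{2d}}f(z)\rho_n^h(z)\,dz-\int_{\mathbb R^{2d}}f(z)\rho(nh,z)\,dz\right|\le C_Th\|f\|_{C_W^4}.$$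
   Context: Phase space: $z=(x,v)\in\mathbb R^d\times\mathbb R^d=\mathbb R^{2d}$. Constants $\gamma>0$, $\beta>0$, $\lambda>0$, $0<\theta<\bar\theta$ are fixed. The potential $V\in C^3(\mathbb R^d)$ is bounded from below, $\|D^2V\|_{L^\infty(\mathbb R^d)}<\infty$, and for every multi-index $\mu$ with $|\mu|=3$ there are $C_\mu,m_\mu\ge0$ with $|D^\mu V(x)|\le C_\mu(1+|x|)^{m_\mu}$. Weights: $W(x,v):=\exp(\theta(1+|x|^2+|v|^2))$, $W_+(x,v):=\exp(\bar\theta(1+|x|^2+|v|^2))$. For a weight $\omega:\mathbb R^{2d}\to[1,\infty)$: $\|g\|_{L^\infty_\omega}:=\sup_{z}|g(z)|/\omega(z)$; $C_\omega^k(\mathbb R^{2d}):=\{f\in C^k(\mathbb R^{2d}):\|f\|_{C_\omega^k}:=\sum_{|\alpha|\le k}\|\partial^\alpha f\|_{L^\infty_\omega}<\infty\}$; $m_\omega(\rho):=\int_{\mathbb R^{2d}}\omega\rho\,dx\,dv$ for a density $\rho$. Functions: $\phi^\lambda_{\mathrm{ki}}(x,v):=\lambda V(x)+\frac{\beta}{\gamma}v\cdot\nabla_xV(x)+\frac{\beta}{2}|v|^2$, $\psi:=e^{-\phi^\lambda_{\mathrm{ki}}/2}$, $U(x,v):=\nabla_xV(x)+\gamma v$. Operators: $D_0f:=v\cdot\nabla_xf+\gamma\beta^{-1}\Delta_vf$ and $\mathcal Lf:=D_0f-U\cdot\nabla_vf$. Kernel: for $h>0$, $$G_h(x,v\mid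 y,w)=\frac{3^{d/2}(\beta/\gamma)^d}{(2\pi h^2)^d}\exp\!\left(-\frac{3\beta}{\gamma h^3}\left\|x-y-\tfrac h2(v+w)\right\|^2-\frac{\beta}{4\gamma h}\|v-w\|^2\right),$$ and $(G_hg)(y,w):=\int_{\mathbb R^{2d}}G_h(x,v\mid y,w)g(x,v)\,dx\,dv$. One-step kinetic kernel operator (for $\rho\in L^1(\mathbb R^{2d})$, $\rho\ge0$, and $h$ with $0<G_h\psi<\infty$ everywhere): $$(\mathcal K_h\rho)(x,v):=\psi(x,v)\int_{\mathbb R^{2d}}G_h(x,v\mid y,w)\frac{\rho(y,w)}{(G_h\psi)(y,w)}\,dy\,dw.$$ It preserves nonnegativity and total mass. *)

theory Defs
  imports "HOL-Analysis.Analysis" "HOL-Library.Multiset"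
begin

section \<open>Partial derivatives, multi-indices and weighted spaces\<close>

definition pd :: "'a::euclidean_space \<Rightarrow> ('a \<Rightarrow> real) \<Rightarrow> 'a \<Rightarrow> real"
  where "pd b f z = frechet_derivative f (at z) b"

definition grad :: "('a::euclidean_space \<Rightarrow> real) \<Rightarrow> 'a \<Rightarrow> 'a"
  where "grad f z = (\<Sum>b\<in>Basis. pd b f z *\<^sub>R b)"

definition laplacian :: "('a::euclidean_space \<Rightarrow> real) \<Rightarrow> 'a \<Rightarrow> real"
  where "laplacian f z = (\<Sum>b\<in>Basis. pd b (pd b f) z)"

primrec Ck :: "nat \<Rightarrow> ('a::euclidean_space \<Rightarrow> real) \<Rightarrow> bool"
  where
    "Ck 0 f \<longleftrightarrow> continuous_on UNIV f"
  | "Ck (Suc k) f \<longleftrightarrow> (\<forall>z. f differentiable (at z)) \<and> (\<forall>b\<in>Basis. Ck k (pd b f))"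

text \<open>A multi-index \<open>\<alpha>\<close> is a finite multiset of coordinate directions: \<open>\<alpha>\<^sub>b\<close> is
  \<open>count \<alpha> b\<close> and \<open>|\<alpha>|\<close> is \<open>size \<alpha>\<close>. The order in which the partial derivatives are taken
  is an arbitrary one; it is irrelevant for the \<open>C\<^sup>k\<close> functions, \<open>k \<ge> |\<alpha>|\<close>, considered here.\<close>

definition multi_index :: "'a::euclidean_space multiset set"
  where "multi_index = {\<alpha>. set_mset \<alpha> \<subseteq> Basis}"

definition mderiv :: "'a::euclidean_space multiset \<Rightarrow> ('a \<Rightarrow> real) \<Rightarrow> 'a \<Rightarrow> real"
  where "mderiv \<alpha> f = foldr pd (SOME bs. mset bs = \<alpha>) f"

lemma finite_multi_index_le: "finite {\<alpha> \<in> multi_index. size \<alpha> \<le> k}"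
proof -
  have "{\<alpha> \<in> multi_index. size \<alpha> \<le> k}
      \<subseteq> mset ` {bs :: 'a list. set bs \<subseteq> Basis \<and> length bs \<le> k}"
  proof
    fix \<alpha> :: "'a multiset"
    assume "\<alpha> \<in> {\<alpha> \<in> multi_index. size \<alpha> \<le> k}"
    moreover obtain bs where "mset bs = \<alpha>"
      using ex_mset by blast
    ultimately show "\<alpha> \<in> mset ` {bs. set bs \<subseteq> Basis \<and> length bs \<le> k}"
      by (auto simp: multi_index_def)
  qed
  then show ?thesis
    by (rule finite_subset) (intro finite_imageI finite_lists_length_le finite_Basis)
qed

text \<open>Norms and moments take values in \<open>[0, \<infinity>]\<close>, so that no supremum or integral
  defaults to a meaningless real number.\<close>

definition wnorm :: "('a \<Rightarrow> real) \<Rightarrow> ('a \<Rightarrow> real) \<Rightarrow> ennreal"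
  where "wnorm \<omega> g = (SUP z. ennreal (\<bar>g z\<bar> / \<omega> z))"

definition Ck_wnorm :: "nat \<Rightarrow> ('a::euclidean_space \<Rightarrow> real) \<Rightarrow> ('a \<Rightarrow> real) \<Rightarrow> ennreal"
  where "Ck_wnorm k \<omega> f = (\<Sum>\<alpha> | \<alpha> \<in> multi_index \<and> size \<alpha> \<le> k. wnorm \<omega> (mderiv \<alpha> f))"

definition Ck_weighted :: "nat \<Rightarrow> ('a::euclidean_space \<Rightarrow> real) \<Rightarrow> ('a \<Rightarrow> real) set"
  where "Ck_weighted k \<omega> = {f. Ck k f \<and> Ck_wnorm k \<omega> f < \<infinity>}"

definition moment :: "('a::euclidean_space \<Rightarrow> real) \<Rightarrow> ('a \<Rightarrow> real) \<Rightarrow> ennreal"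
  where "moment \<omega> \<rho> = (\<integral>\<^sup>+ z. ennreal (\<omega> z * \<rho> z) \<partial>lborel)"

definition prob_density :: "('a::euclidean_space \<Rightarrow> real) \<Rightarrow> bool"
  where "prob_density \<rho> \<longleftrightarrow>
    (\<forall>z. 0 \<le> \<rho> z) \<and> integrable lborel \<rho> \<and> (\<integral>z. \<rho> z \<partial>lborel) = 1"


section \<open>The kinetic setting\<close>

type_synonym 'n phase = "(real^'n) \<times> (real^'n)"

definition admissible_potential :: "(real^'n \<Rightarrow> real) \<Rightarrow> bool"
  where "admissible_potential V \<longleftrightarrow>
    Ck 3 V \<and>
    bdd_below (range V) \<and>
    bdd_above (range (\<lambda>x. onorm (frechet_derivative (grad V) (at x)))) \<and>
    (\<forall>\<mu>\<in>multi_index. size \<mu> = 3 \<longrightarrow>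
      (\<exists>C\<ge>0. \<exists>m\<ge>0. \<forall>x. \<bar>mderiv \<mu> V x\<bar> \<le> C * (1 + norm x) powr m))"

definition gauss_weight :: "real \<Rightarrow> 'n::finite phase \<Rightarrow> real"
  where "gauss_weight \<theta> = (\<lambda>(x, v). exp (\<theta> * (1 + (norm x)\<^sup>2 + (norm v)\<^sup>2)))"

text \<open>The weight \<open>W\<^bsub>+,2m\<^esub>\<close>, with \<open>W = gauss_weight \<theta>\<close> and \<open>W\<^sub>+ = gauss_weight \<theta>'\<close>.\<close>

definition big_weight :: "real \<Rightarrow> real \<Rightarrow> nat \<Rightarrow> 'n::finite phase \<Rightarrow> real"
  where "big_weight \<theta> \<theta>' m = (\<lambda>(x, v).
    (1 + norm x + norm v) ^ (2 * m) * (gauss_weight \<theta> (x, v))\<^sup>2 * gauss_weight \<theta>' (x, v))"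

definition phi_ki :: "(real^'n \<Rightarrow> real) \<Rightarrow> real \<Rightarrow> real \<Rightarrow> real \<Rightarrow> 'n::finite phase \<Rightarrow> real"
  where "phi_ki V \<gamma> \<beta> l = (\<lambda>(x, v).
    l * V x + \<beta> / \<gamma> * (v \<bullet> grad V x) + \<beta> / 2 * (norm v)\<^sup>2)"

definition psi :: "(real^'n \<Rightarrow> real) \<Rightarrow> real \<Rightarrow> real \<Rightarrow> real \<Rightarrow> 'n::finite phase \<Rightarrow> real"
  where "psi V \<gamma> \<beta> l z = exp (- phi_ki V \<gamma> \<beta> l z / 2)"

definition grad_x :: "('n::finite phase \<Rightarrow> real) \<Rightarrow> 'n phase \<Rightarrow> real^'n"
  where "grad_x f = (\<lambda>(x, v). grad (\<lambda>x'. f (x', v)) x)"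

definition grad_v :: "('n::finite phase \<Rightarrow> real) \<Rightarrow> 'n phase \<Rightarrow> real^'n"
  where "grad_v f = (\<lambda>(x, v). grad (\<lambda>v'. f (x, v')) v)"

definition laplacian_v :: "('n::finite phase \<Rightarrow> real) \<Rightarrow> 'n phase \<Rightarrow> real"
  where "laplacian_v f = (\<lambda>(x, v). laplacian (\<lambda>v'. f (x, v')) v)"

definition U_field :: "(real^'n \<Rightarrow> real) \<Rightarrow> real \<Rightarrow> 'n::finite phase \<Rightarrow> real^'n"
  where "U_field V \<gamma> = (\<lambda>(x, v). grad V x + \<gamma> *\<^sub>R v)"

definition D0_op :: "real \<Rightarrow> real \<Rightarrow> ('n::finite phase \<Rightarrow> real) \<Rightarrow> 'n phase \<Rightarrow> real"
  where "D0_op \<gamma> \<beta> f = (\<lambda>(x, v).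
    v \<bullet> grad_x f (x, v) + \<gamma> / \<beta> * laplacian_v f (x, v))"

definition L_op ::
  "(real^'n \<Rightarrow> real) \<Rightarrow> real \<Rightarrow> real \<Rightarrow> ('n::finite phase \<Rightarrow> real) \<Rightarrow> 'n phase \<Rightarrow> real"
  where "L_op V \<gamma> \<beta> f z = D0_op \<gamma> \<beta> f z - U_field V \<gamma> z \<bullet> grad_v f z"


section \<open>The one-step kinetic kernel operator\<close>

definition G_kernel :: "real \<Rightarrow> real \<Rightarrow> real \<Rightarrow> 'n::finite phase \<Rightarrow> 'n phase \<Rightarrow> real"
  where "G_kernel \<gamma> \<beta> h = (\<lambda>(x, v) (y, w).
    3 powr (real CARD('n) / 2) * (\<beta> / \<gamma>) ^ CARD('n) / (2 * pi * h\<^sup>2) ^ CARD('n)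
    * exp (- (3 * \<beta> / (\<gamma> * h ^ 3)) * (norm (x - y - (h / 2) *\<^sub>R (v + w)))\<^sup>2
           - \<beta> / (4 * \<gamma> * h) * (norm (v - w))\<^sup>2))"

definition G_op ::
  "real \<Rightarrow> real \<Rightarrow> real \<Rightarrow> ('n::finite phase \<Rightarrow> real) \<Rightarrow> 'n phase \<Rightarrow> real"
  where "G_op \<gamma> \<beta> h g p = (\<integral>z. G_kernel \<gamma> \<beta> h z p * g z \<partial>lborel)"

definition K_op ::
  "(real^'n \<Rightarrow> real) \<Rightarrow> real \<Rightarrow> real \<Rightarrow> real \<Rightarrow> real
    \<Rightarrow> ('n::finite phase \<Rightarrow> real) \<Rightarrow> 'n phase \<Rightarrow> real"
  where "K_op V \<gamma> \<beta> l h \<rho> z =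
    psi V \<gamma> \<beta> l z
    * (\<integral>p. G_kernel \<gamma> \<beta> h z p * (\<rho> p / G_op \<gamma> \<beta> h (psi V \<gamma> \<beta> l) p) \<partial>lborel)"


section \<open>Forward and backward equations\<close>

text \<open>Distributional solutions on \<open>[0, T)\<close> of
  \[ \partial_t\rho + v\cdot\nabla_x\rho - \nabla_v\cdot(\nabla_x V(x)\,\rho)
     = \nabla_v\cdot(\gamma v\rho + \gamma\beta^{-1}\nabla_v\rho), \]
  tested against \<open>C\<^sup>\<infinity>\<close> functions with compact support in \<open>(-\<infinity>, T) \<times> \<real>\<^bsup>2d\<^esup>\<close>; all derivatives
  are moved to the test function, and the boundary term at \<open>t = 0\<close> carries the initial data.\<close>

definition test_function :: "real \<Rightarrow> (real \<times> 'n::finite phase \<Rightarrow> real) \<Rightarrow> bool"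
  where "test_function T \<phi> \<longleftrightarrow>
    (\<forall>k. Ck k \<phi>) \<and>
    (\<exists>K. compact K \<and> K \<subseteq> {..<T} \<times> UNIV \<and> (\<forall>p. p \<notin> K \<longrightarrow> \<phi> p = 0))"

definition kFP_solution ::
  "(real^'n \<Rightarrow> real) \<Rightarrow> real \<Rightarrow> real \<Rightarrow> real
    \<Rightarrow> ('n::finite phase \<Rightarrow> real) \<Rightarrow> (real \<Rightarrow> 'n phase \<Rightarrow> real) \<Rightarrow> bool"
  where "kFP_solution V \<gamma> \<beta> T \<rho>\<^sub>0 \<rho> \<longleftrightarrow>
    (\<forall>t\<in>{0..T}. prob_density (\<rho> t)) \<and>
    set_borel_measurable lborel ({0..T} \<times> UNIV) (\<lambda>(t, z). \<rho> t z) \<and>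
    (AE z in lborel. \<rho> 0 z = \<rho>\<^sub>0 z) \<and>
    (\<forall>\<phi>. test_function T \<phi> \<longrightarrow>
      (LINT p:{0..T} \<times> UNIV|lborel.
        (case p of (t, x, v) \<Rightarrow>
          \<rho> t (x, v) *
          (pd (1, 0) \<phi> (t, x, v)
           + v \<bullet> grad_x (\<lambda>z. \<phi> (t, z)) (x, v)
           - grad V x \<bullet> grad_v (\<lambda>z. \<phi> (t, z)) (x, v)
           - \<gamma> * (v \<bullet> grad_v (\<lambda>z. \<phi> (t, z)) (x, v))
           + \<gamma> / \<beta> * laplacian_v (\<lambda>z. \<phi> (t, z)) (x, v))))
      + (\<integral>z. \<phi> (0, z) * \<rho>\<^sub>0 z \<partial>lborel) = 0)"

text \<open>Time derivatives on the closed interval \<open>[0, T]\<close> are one-sided at the endpoints.\<close>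

definition time_deriv :: "real \<Rightarrow> (real \<Rightarrow> 'a \<Rightarrow> real) \<Rightarrow> real \<Rightarrow> 'a \<Rightarrow> real"
  where "time_deriv T u t z = vector_derivative (\<lambda>s. u s z) (at t within {0..T})"

definition time_differentiable :: "real \<Rightarrow> (real \<Rightarrow> 'a \<Rightarrow> real) \<Rightarrow> bool"
  where "time_differentiable T u \<longleftrightarrow>
    (\<forall>t\<in>{0..T}. \<forall>z. (\<lambda>s. u s z) differentiable (at t within {0..T}))"

text \<open>Classical solutions, of class \<open>C\<^bsup>1,2\<^esup>([0, T] \<times> \<real>\<^bsup>2d\<^esup>)\<close>, of \<open>\<partial>\<^sub>t u = L u\<close>, \<open>u(0) = f\<close>.\<close>

definition backward_solution ::
  "(real^'n \<Rightarrow> real) \<Rightarrow> real \<Rightarrow> real \<Rightarrow> real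
    \<Rightarrow> ('n::finite phase \<Rightarrow> real) \<Rightarrow> (real \<Rightarrow> 'n phase \<Rightarrow> real) \<Rightarrow> bool"
  where "backward_solution V \<gamma> \<beta> T f u \<longleftrightarrow>
    (\<forall>t\<in>{0..T}. Ck 2 (u t)) \<and>
    (\<forall>\<alpha>\<in>multi_index. size \<alpha> \<le> 2 \<longrightarrow>
      continuous_on ({0..T} \<times> UNIV) (\<lambda>(t, z). mderiv \<alpha> (u t) z)) \<and>
    time_differentiable T u \<and>
    continuous_on ({0..T} \<times> UNIV) (\<lambda>(t, z). time_deriv T u t z) \<and>
    (\<forall>t\<in>{0..T}. \<forall>z. time_deriv T u t z = L_op V \<gamma> \<beta> (u t) z) \<and>
    u 0 = f"

end

(*
  The operator K_h is dual to the Markov operator P_h g = G_h (g psi) / G_h psi, so by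
  telescoping along u((n - k) h) the error is controlled by the local error
  P_h g - g - h L g = O(h^2) in the large weight, together with a second-order Taylor estimate
  of u in time.

  For the local error put s = sqrt h and write a point distributed according to G_h as
  (y + s^2 w + s^3 zeta, w + s xi) with (zeta, xi) Gaussian with a law independent of h.
  Averaging over (zeta, xi) and (-zeta, -xi) removes all odd powers of s.  The ratio
  psi(z) / psi(y, w) then only has to be expanded to relative order s^2 in its even part and
  s^3 in its odd part, for which it suffices that grad V is Lipschitz; the test function needs a
  fourth-order Taylor expansion.  The coefficient of s^2 integrates to h L g because the
  covariance of xi is 2 gamma / beta.  All Gaussian factors exp(eps (1 + |z|)^2) produced on the
  way are absorbed by W_+ for small h, so that m = 0 is enough.
*)

theory Submission
  imports Defs "HOL-Probability.Distributions"
begin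

subsection \<open>Directional derivatives of \<open>C\<^sup>k\<close> functions\<close>

text \<open>The obstacle is that \<psi> contains grad V, so g \<psi> is not smooth enough for a
  fourth-order expansion. Hence only g is expanded, and the ratio of \<psi> is kept as an
  exponential. Since g p + h L g p is subtracted before multiplying by that ratio, the even part of
  the ratio meets a factor of size s^2 and its odd part a factor of size s. Errors of size s^2 and
  s^3 in the two parts therefore both give s^4 = h^2. A Lipschitz gradient provides them because the
  positions reached from \<omega> and - \<omega> differ only by 2 s^3 \<zeta> and both lie within
  O(s^2) of y. The drift of L is a correlation effect: the order s term of the ratio and the order s
  term of g are both linear in \<xi>, and their product integrates to - U \<bullet> grad_v g. The
  normaliser G_h \<psi> / \<psi> is not evaluated. A lower bound decaying like exp(- \<epsilon> (1 +
  |p|)^2) suffices, at the price of one more Gaussian factor in the weight, and the total mass of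
  the rescaled kernel drops out because the coefficient of s^2 integrates to zero.\<close>

lemma pd_has_derivative:
  assumes "f differentiable (at z)"
  shows "(f has_derivative (\<lambda>v. pd v f z)) (at z)"
  using assms unfolding pd_def by (simp add: frechet_derivative_works[symmetric])

lemma pd_eqI:
  assumes "(f has_derivative f') (at z)"
  shows "pd v f z = f' v"
  using frechet_derivative_at[OF assms] by (simp add: pd_def)

lemma pd_lincomb_dir:
  assumes "f differentiable (at z)"
  shows "pd (\<alpha> *\<^sub>R a + \<beta> *\<^sub>R b) f z = \<alpha> * pd a f z + \<beta> * pd b f z"
proof -
  have "linear (\<lambda>v. pd v f z)"
    using pd_has_derivative[OF assms] has_derivative_bounded_linear bounded_linear.linear by blast
  note lin = this
  from linear_add[OF lin, of "\<alpha> *\<^sub>R a" "\<beta> *\<^sub>R b"] show ?thesis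
    by (simp add: linear_cmul[OF lin])
qed

lemma pd_Basis_expand:
  fixes f :: "'a::euclidean_space \<Rightarrow> real"
  assumes "f differentiable (at z)"
  shows "pd v f z = (\<Sum>b\<in>Basis. (v \<bullet> b) * pd b f z)"
proof -
  have lin: "linear (\<lambda>v. pd v f z)"
    using pd_has_derivative[OF assms] has_derivative_bounded_linear bounded_linear.linear by blast
  have "pd v f z = pd (\<Sum>b\<in>Basis. (v \<bullet> b) *\<^sub>R b) f z"
    by (simp add: euclidean_representation)
  also have "\<dots> = (\<Sum>b\<in>Basis. (v \<bullet> b) * pd b f z)"
    using linear_sum[OF lin, of "\<lambda>b. (v \<bullet> b) *\<^sub>R b" Basis] by (simp add: linear_cmul[OF lin])
  finally show ?thesis .
qed

lemma pd_lincomb_fun: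
  assumes "\<And>z. f differentiable (at z)" "\<And>z. g differentiable (at z)"
  shows "pd v (\<lambda>z. \<alpha> * f z + \<beta> * g z) = (\<lambda>z. \<alpha> * pd v f z + \<beta> * pd v g z)"
proof
  fix z
  show "pd v (\<lambda>z. \<alpha> * f z + \<beta> * g z) z = \<alpha> * pd v f z + \<beta> * pd v g z"
    by (rule pd_eqI) (intro derivative_intros pd_has_derivative assms)
qed

lemma Ck_SucD:
  assumes "Ck (Suc k) f"
  shows "f differentiable (at z)" "b \<in> Basis \<Longrightarrow> Ck k (pd b f)"
  using assms by auto

lemma Ck_continuous: "Ck k f \<Longrightarrow> continuous_on UNIV f"
  by (cases k)
    (auto intro!: differentiable_imp_continuous_on simp: differentiable_on_def
      intro: differentiable_at_withinI)

lemma Ck_pred: "Ck (Suc k) f \<Longrightarrow> Ck k f"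
proof (induction k arbitrary: f)
  case 0
  then show ?case using Ck_continuous[of "Suc 0" f] by simp
next
  case (Suc k)
  show ?case
    using Suc.prems Suc.IH unfolding Ck.simps(2)[of "Suc k"] Ck.simps(2)[of k] by blast
qed

lemma Ck_antimono: "Ck k f \<Longrightarrow> j \<le> k \<Longrightarrow> Ck j f"
  by (induction k) (auto simp: le_Suc_eq simp del: Ck.simps(2) dest: Ck_pred)

lemma Ck_const: "Ck k (\<lambda>_. c)"
proof (induction k arbitrary: c)
  case (Suc k)
  have "pd b (\<lambda>_. c) = (\<lambda>_. 0)" for b :: 'a
    by (rule ext) (rule pd_eqI, rule has_derivative_const)
  then show ?case using Suc by simp
qed simp

lemma Ck_lincomb: "Ck k f \<Longrightarrow> Ck k g \<Longrightarrow> Ck k (\<lambda>z. \<alpha> * f z + \<beta> * g z)"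
proof (induction k arbitrary: f g)
  case 0
  then show ?case by (auto intro!: continuous_intros)
next
  case (Suc k)
  then show ?case
    using pd_lincomb_fun[of f g _ \<alpha> \<beta>] by (auto intro!: derivative_intros)
qed

lemma Ck_sum:
  assumes "finite I" "\<And>i. i \<in> I \<Longrightarrow> Ck k (f i)"
  shows "Ck k (\<lambda>z. \<Sum>i\<in>I. c i * f i z)"
  using assms
proof (induction I rule: finite_induct)
  case empty
  then show ?case by (simp add: Ck_const)
next
  case (insert i I)
  then show ?case
    using Ck_lincomb[of k "f i" "\<lambda>z. \<Sum>i\<in>I. c i * f i z" "c i" 1] by simp
qed

lemma Ck_pd:
  assumes "Ck (Suc k) f"
  shows "Ck k (pd v f)"
proof -
  have "pd v f = (\<lambda>z. \<Sum>b\<in>Basis. (v \<bullet> b) * pd b f z)"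
    using pd_Basis_expand[OF Ck_SucD(1)[OF assms]] by blast
  then show ?thesis
    using Ck_sum[of Basis k "\<lambda>b. pd b f" "\<lambda>b. v \<bullet> b"] assms by simp
qed

lemma Ck_foldr_pd: "Ck (k + length vs) f \<Longrightarrow> Ck k (foldr pd vs f)"
  by (induction vs arbitrary: k) (auto intro!: Ck_pd simp del: Ck.simps(2))

lemma has_real_derivative_line:
  assumes "f differentiable (at (z + t *\<^sub>R v))"
  shows "((\<lambda>t. f (z + t *\<^sub>R v)) has_real_derivative pd v f (z + t *\<^sub>R v)) (at t)"
proof -
  have "((\<lambda>t. z + t *\<^sub>R v) has_derivative (\<lambda>s. s *\<^sub>R v)) (at t)"
    by (auto intro!: derivative_eq_intros)
  from diff_chain_at[OF this, unfolded o_def, OF pd_has_derivative[OF assms]]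
  have "((\<lambda>t. f (z + t *\<^sub>R v)) has_derivative (\<lambda>s. pd (s *\<^sub>R v) f (z + t *\<^sub>R v))) (at t)" .
  moreover have "pd (s *\<^sub>R v) f (z + t *\<^sub>R v) = s * pd v f (z + t *\<^sub>R v)" for s
    using pd_lincomb_dir[OF assms, of s v 0 0] by simp
  ultimately show ?thesis
    by (simp only: has_field_derivative_def mult_commute_abs)
qed

text \<open>The mean value theorem is used twice: on the increment over h b as a function of the
  a-coordinate, and on \<open>pd a f\<close> along b. The second difference is symmetric in a and b,
  so both orders of differentiation represent it at points close to z.\<close>

lemma second_difference_mvt:
  fixes f :: "'a::euclidean_space \<Rightarrow> real"
  assumes f: "Ck 2 f" and h: "h > 0"
  shows "\<exists>s t. 0 < s \<and> s < h \<and> 0 < t \<and> t < h \<and>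
    f (z + h *\<^sub>R a + h *\<^sub>R b) - f (z + h *\<^sub>R a) - f (z + h *\<^sub>R b) + f z
      = h\<^sup>2 * pd b (pd a f) (z + s *\<^sub>R a + t *\<^sub>R b)"
proof -
  have f2: "Ck (Suc (Suc 0)) f" using f by (simp only: numeral_2_eq_2)
  have df: "f differentiable (at x)" for x using f2 by (rule Ck_SucD)
  have dp: "pd a f differentiable (at x)" for x
    using Ck_pd[OF f2] by (rule Ck_SucD)
  define \<phi> where "\<phi> s = f ((z + h *\<^sub>R b) + s *\<^sub>R a) - f (z + s *\<^sub>R a)" for s
  have "DERIV \<phi> s :> pd a f ((z + h *\<^sub>R b) + s *\<^sub>R a) - pd a f (z + s *\<^sub>R a)" for s
    unfolding \<phi>_def by (intro DERIV_diff has_real_derivative_line df)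
  from MVT2[of 0 h \<phi>, OF h this] obtain s where s: "0 < s" "s < h"
    and eq1: "\<phi> h - \<phi> 0 = h * (pd a f ((z + h *\<^sub>R b) + s *\<^sub>R a) - pd a f (z + s *\<^sub>R a))"
    by auto
  have "DERIV (\<lambda>t. pd a f ((z + s *\<^sub>R a) + t *\<^sub>R b)) t :> pd b (pd a f) ((z + s *\<^sub>R a) + t *\<^sub>R b)" for t
    by (intro has_real_derivative_line dp)
  from MVT2[of 0 h "\<lambda>t. pd a f ((z + s *\<^sub>R a) + t *\<^sub>R b)", OF h this] obtain t where t: "0 < t" "t < h"
    and eq2: "pd a f ((z + s *\<^sub>R a) + h *\<^sub>R b) - pd a f (z + s *\<^sub>R a) = h * pd b (pd a f) ((z + s *\<^sub>R a) + t *\<^sub>R b)"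
    by auto
  have "z + h *\<^sub>R b + s *\<^sub>R a = z + s *\<^sub>R a + h *\<^sub>R b" "z + h *\<^sub>R b + h *\<^sub>R a = z + h *\<^sub>R a + h *\<^sub>R b"
    by (simp_all add: algebra_simps)
  then have "f (z + h *\<^sub>R a + h *\<^sub>R b) - f (z + h *\<^sub>R a) - f (z + h *\<^sub>R b) + f z
      = h\<^sup>2 * pd b (pd a f) (z + s *\<^sub>R a + t *\<^sub>R b)"
    using eq1 eq2 by (simp add: \<phi>_def power2_eq_square algebra_simps)
  then show ?thesis using s t by blast
qed

text \<open>Schwarz's theorem. It is needed because \<open>mderiv\<close> fixes the order of
  differentiation by a choice operator, whose result is otherwise unknown.\<close>

lemma pd_commute:
  fixes f :: "'a::euclidean_space \<Rightarrow> real"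
  assumes f: "Ck 2 f"
  shows "pd a (pd b f) = pd b (pd a f)"
proof
  fix z
  have c: "continuous (at z) (pd u (pd v f))" for u v
    using Ck_pd[OF Ck_pd, of 0 f u v] f
    by (auto simp: numeral_2_eq_2 continuous_on_eq_continuous_at simp del: Ck.simps(2))
  show "pd a (pd b f) z = pd b (pd a f) z"
  proof (rule ccontr)
    define p where "p = pd a (pd b f)"
    define q where "q = pd b (pd a f)"
    assume "pd a (pd b f) z \<noteq> pd b (pd a f) z"
    then have e: "\<bar>p z - q z\<bar> / 2 > 0" (is "?e > 0") by (simp add: p_def q_def)
    obtain d1 where d1: "d1 > 0" "\<And>x. dist x z < d1 \<Longrightarrow> dist (p x) (p z) < ?e"
      using c[of a b, folded p_def] e unfolding continuous_at_eps_delta by meson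
    obtain d2 where d2: "d2 > 0" "\<And>x. dist x z < d2 \<Longrightarrow> dist (q x) (q z) < ?e"
      using c[of b a, folded q_def] e unfolding continuous_at_eps_delta by meson
    \<comment> \<open>This size keeps every point z + s a + t b with s, t < h inside both continuity
      balls; the summand 1 excludes a zero denominator.\<close>
    define h where "h = min d1 d2 / (2 * (norm a + norm b + 1))"
    have n: "norm a + norm b + 1 > 0" by (meson add_nonneg_pos norm_ge_zero zero_less_one add_nonneg_nonneg)
    have h: "h > 0" using d1 d2 n by (simp add: h_def)
    have small: "dist (z + s *\<^sub>R u + t *\<^sub>R v) z < min d1 d2"
      if "0 < s" "s < h" "0 < t" "t < h" "norm u + norm v = norm a + norm b" for s t u v
    proof -
      have "dist (z + s *\<^sub>R u + t *\<^sub>R v) z = norm (s *\<^sub>R u + t *\<^sub>R v)" by (simp add: dist_norm algebra_simps)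
      also have "\<dots> \<le> s * norm u + t * norm v"
        using norm_triangle_ineq[of "s *\<^sub>R u" "t *\<^sub>R v"] that by simp
      also have "\<dots> \<le> h * norm u + h * norm v"
        using that by (intro add_mono mult_right_mono) auto
      also have "\<dots> = h * (norm a + norm b)" using that(5) by (metis distrib_left)
      also have "\<dots> \<le> h * (norm a + norm b + 1)" using h by simp
      also have "\<dots> = min d1 d2 / 2" using n unfolding h_def by (metis nonzero_mult_div_cancel_right divide_divide_eq_left less_irrefl times_divide_eq_left)
      also have "\<dots> < min d1 d2" using d1(1) d2(1) by (simp add: min_def)
      finally show ?thesis .
    qed
    obtain s t where st: "0 < s" "s < h" "0 < t" "t < h"
      and 1: "f (z + h *\<^sub>R a + h *\<^sub>R b) - f (z + h *\<^sub>R a) - f (z + h *\<^sub>R b) + f z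
      = h\<^sup>2 * q (z + s *\<^sub>R a + t *\<^sub>R b)"
      using second_difference_mvt[OF f h, of z a b] unfolding q_def by blast
    obtain s' t' where st': "0 < s'" "s' < h" "0 < t'" "t' < h"
      and 2: "f (z + h *\<^sub>R b + h *\<^sub>R a) - f (z + h *\<^sub>R b) - f (z + h *\<^sub>R a) + f z
      = h\<^sup>2 * p (z + s' *\<^sub>R b + t' *\<^sub>R a)"
      using second_difference_mvt[OF f h, of z b a] unfolding p_def by blast
    have "z + h *\<^sub>R b + h *\<^sub>R a = z + h *\<^sub>R a + h *\<^sub>R b" by (simp add: algebra_simps)
    with 1 2 have "h\<^sup>2 * q (z + s *\<^sub>R a + t *\<^sub>R b) = h\<^sup>2 * p (z + s' *\<^sub>R b + t' *\<^sub>R a)"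
      by (simp only:)
    then have eq: "q (z + s *\<^sub>R a + t *\<^sub>R b) = p (z + s' *\<^sub>R b + t' *\<^sub>R a)" using h by simp
    have "dist (q (z + s *\<^sub>R a + t *\<^sub>R b)) (q z) < ?e"
      using small[OF st, of a b] by (intro d2) simp
    moreover have "dist (p (z + s' *\<^sub>R b + t' *\<^sub>R a)) (p z) < ?e"
      using small[OF st', of b a] by (intro d1) simp
    ultimately show False using eq by (auto simp: dist_real_def abs_if split: if_splits)
  qed
qed

lemma foldr_pd_commute:
  assumes "Ck (Suc (length vs)) f"
  shows "foldr pd vs (pd b f) = pd b (foldr pd vs f)"
  using assms
proof (induction vs)
  case (Cons v vs)
  have "Ck 2 (foldr pd vs f)"
    using Ck_foldr_pd[of 2 vs f] Cons.prems by (simp add: numeral_2_eq_2 del: Ck.simps(2))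
  from pd_commute[OF this, of v b] show ?case
    using Cons.IH Ck_pred[OF Cons.prems, unfolded list.size] by (simp del: Ck.simps(2))
qed simp

text \<open>The head of one list is located in the other and commuted past the derivatives in front
  of it. This makes the unspecified enumeration inside \<open>mderiv\<close> harmless.\<close>

lemma foldr_pd_perm:
  assumes "mset bs = mset cs" "Ck (length bs) f"
  shows "foldr pd bs f = foldr pd cs f"
  using assms
proof (induction bs arbitrary: cs)
  case (Cons b bs)
  then have "b \<in> set cs" by (metis list.set_intros(1) set_mset_mset)
  then obtain c1 c2 where cs: "cs = c1 @ b # c2" by (meson split_list)
  then have m: "mset bs = mset (c1 @ c2)" using Cons.prems by simp
  then have len: "length bs = length c1 + length c2" by (metis length_append size_mset)
  have "foldr pd cs f = pd b (foldr pd c1 (foldr pd c2 f))"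
    using foldr_pd_commute[of c1 "foldr pd c2 f" b] Ck_foldr_pd[of "Suc (length c1)" c2 f]
      Cons.prems(2) len cs by (simp del: Ck.simps(2))
  also have "\<dots> = pd b (foldr pd bs f)"
    using Cons.IH[OF m] Ck_pred[of "length bs" f] Cons.prems(2) by (simp del: Ck.simps(2))
  finally show ?case by simp
qed simp

text \<open>Multilinearity: each direction is expanded in the basis, its coefficients are at most
  its norm, and every derivative contributes DIM('a) terms.\<close>

lemma foldr_pd_bound:
  fixes f :: "'a::euclidean_space \<Rightarrow> real"
  assumes "Ck (length vs) f"
    and "\<And>bs. set bs \<subseteq> Basis \<Longrightarrow> length bs = length vs \<Longrightarrow> \<bar>foldr pd bs f z\<bar> \<le> K"
  shows "\<bar>foldr pd vs f z\<bar> \<le> real DIM('a) ^ length vs * prod_list (map norm vs) * K"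
  using assms
proof (induction vs arbitrary: f)
  case Nil
  then show ?case using Nil(2)[of "[]"] by simp
next
  case (Cons v vs)
  let ?C = "real DIM('a) ^ length vs * prod_list (map norm vs) * K"
  have d: "foldr pd vs f differentiable (at z)"
    using Ck_foldr_pd[of 1 vs f] Cons.prems(1) by simp
  have each: "\<bar>(v \<bullet> b) * pd b (foldr pd vs f) z\<bar> \<le> norm v * ?C" if b: "b \<in> Basis" for b
  proof -
    have "\<bar>foldr pd bs (pd b f) z\<bar> \<le> K" if "set bs \<subseteq> Basis" "length bs = length vs" for bs
      using Cons.prems(2)[of "bs @ [b]"] that b by simp
    then have "\<bar>foldr pd vs (pd b f) z\<bar> \<le> ?C"
      using Cons.IH[of "pd b f"] Ck_pd[of "length vs" f b] Cons.prems(1) by (simp del: Ck.simps(2))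
    moreover have "pd b (foldr pd vs f) = foldr pd vs (pd b f)"
      using foldr_pd_commute[of vs f b] Cons.prems(1) by simp
    moreover have "\<bar>v \<bullet> b\<bar> \<le> norm v" using b by (rule Basis_le_norm)
    ultimately show ?thesis by (simp add: abs_mult mult_mono)
  qed
  have "foldr pd (v # vs) f z = (\<Sum>b\<in>Basis. (v \<bullet> b) * pd b (foldr pd vs f) z)"
    using pd_Basis_expand[OF d, of v] by simp
  also have "\<bar>\<dots>\<bar> \<le> (\<Sum>b\<in>(Basis::'a set). norm v * ?C)"
    by (rule order_trans[OF sum_abs]) (rule sum_mono, rule each)
  also have "\<dots> = real DIM('a) ^ length (v # vs) * prod_list (map norm (v # vs)) * K"
    by (simp add: mult_ac)
  finally show ?case .
qed

text \<open>Interface between the weighted norm, a sum over multi-indices, and iterated directional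
  derivatives. Taylor expansion along the kernel differentiates in the directions of the random
  displacement, hence along arbitrary vectors.\<close>

lemma Ck_weighted_derivative_bound:
  fixes f :: "'a::euclidean_space \<Rightarrow> real"
  assumes f: "Ck k f" "Ck_wnorm k \<omega> f \<le> ennreal N" and \<omega>: "\<And>z. \<omega> z > 0" and N: "N \<ge> 0"
    and vs: "length vs \<le> k"
  shows "\<bar>foldr pd vs f z\<bar> \<le> real DIM('a) ^ length vs * prod_list (map norm vs) * (N * \<omega> z)"
proof (rule foldr_pd_bound)
  show "Ck (length vs) f" using f(1) vs by (rule Ck_antimono)
  fix bs :: "'a list" assume bs: "set bs \<subseteq> Basis" "length bs = length vs"
  let ?cs = "SOME cs. mset cs = mset bs"
  have cs: "mset ?cs = mset bs" by (rule someI[of _ bs]) simp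
  have eq: "mderiv (mset bs) f = foldr pd bs f"
    unfolding mderiv_def
    by (rule foldr_pd_perm[OF cs]) (metis Ck_antimono bs(2) cs f(1) size_mset vs)
  let ?A = "{\<alpha>. \<alpha> \<in> (multi_index :: 'a multiset set) \<and> size \<alpha> \<le> k}"
  have "mset bs \<in> ?A" using bs vs by (auto simp: multi_index_def)
  then have "wnorm \<omega> (mderiv (mset bs) f) \<le> Ck_wnorm k \<omega> f"
    unfolding Ck_wnorm_def using finite_multi_index_le[of k]
    by (intro member_le_sum) auto
  then have "wnorm \<omega> (foldr pd bs f) \<le> ennreal N" using f(2) eq by simp
  then have "ennreal (\<bar>foldr pd bs f z\<bar> / \<omega> z) \<le> ennreal N"
    unfolding wnorm_def by (rule order_trans[OF SUP_upper[OF UNIV_I]])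
  then have "\<bar>foldr pd bs f z\<bar> / \<omega> z \<le> N" using N by (simp add: ennreal_le_iff)
  then show "\<bar>foldr pd bs f z\<bar> \<le> N * \<omega> z" using \<omega>[of z] by (simp add: field_simps)
qed

lemma Taylor_line:
  fixes f :: "'a::euclidean_space \<Rightarrow> real"
  assumes f: "Ck n f" and n: "n > 0"
    and K: "\<And>t. 0 < t \<Longrightarrow> t < 1 \<Longrightarrow> \<bar>(pd v ^^ n) f (z + t *\<^sub>R v)\<bar> \<le> K"
  shows "\<bar>f (z + v) - (\<Sum>m<n. (pd v ^^ m) f z / fact m)\<bar> \<le> K / fact n"
proof -
  have "\<forall>m t. m < n \<and> 0 \<le> t \<and> t \<le> 1 \<longrightarrow>
      DERIV (\<lambda>t. (pd v ^^ m) f (z + t *\<^sub>R v)) t :> (pd v ^^ Suc m) f (z + t *\<^sub>R v)"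
  proof (intro allI impI)
    fix m t assume "m < n \<and> 0 \<le> t \<and> t \<le> (1::real)"
    then have "Ck (Suc 0 + length (replicate m v)) f"
      using Ck_antimono[OF f, of "Suc m"] by (simp del: Ck.simps(2))
    from Ck_SucD(1)[OF Ck_foldr_pd[OF this]] have "(pd v ^^ m) f differentiable (at x)" for x
      by simp
    then show "DERIV (\<lambda>t. (pd v ^^ m) f (z + t *\<^sub>R v)) t :> (pd v ^^ Suc m) f (z + t *\<^sub>R v)"
      using has_real_derivative_line[of "(pd v ^^ m) f" z t v] by simp
  qed
  from Taylor_up[of n "\<lambda>m t. (pd v ^^ m) f (z + t *\<^sub>R v)" "\<lambda>t. f (z + t *\<^sub>R v)" 0 1 0, OF n _ this]
  obtain t where t: "0 < t" "t < 1"
    and eq: "f (z + v) = (\<Sum>m<n. (pd v ^^ m) f z / fact m) + (pd v ^^ n) f (z + t *\<^sub>R v) / fact n"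
    by auto
  show ?thesis
    using K[OF t] eq by (simp add: divide_right_mono)
qed

subsection \<open>Gaussian integrals\<close>

text \<open>One change of variables serves four purposes: reflection at the origin, translation, the
  flip of a single coordinate, and the anisotropic rescaling of the kernel.\<close>

lemma lborel_integral_diagonal_affine:
  fixes c :: "'a::euclidean_space \<Rightarrow> real" and t and F :: "'a \<Rightarrow> real"
  defines "T x \<equiv> t + (\<Sum>j\<in>Basis. (c j * (x \<bullet> j)) *\<^sub>R j)"
  assumes c: "\<And>j. j \<in> Basis \<Longrightarrow> c j \<noteq> 0" and F[measurable]: "F \<in> borel_measurable borel"
  shows "integrable lborel F \<longleftrightarrow> integrable lborel (\<lambda>x. F (T x))"
    and "integral\<^sup>L lborel F = (\<Prod>j\<in>Basis. \<bar>c j\<bar>) * integral\<^sup>L lborel (\<lambda>x. F (T x))"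
proof -
  have T[measurable]: "T \<in> borel \<rightarrow>\<^sub>M borel" by (simp add: T_def[abs_def])
  define p where "p = (\<Prod>j\<in>Basis. \<bar>c j\<bar>)"
  have p: "p > 0" unfolding p_def using c by (simp add: prod_pos)
  have eq: "lborel = density (distr lborel borel T) (\<lambda>_. ennreal p)"
    unfolding T_def p_def by (rule trans[OF lborel_affine_euclidean[of c t]]) (simp_all add: c prod_ennreal)
  show "integrable lborel F \<longleftrightarrow> integrable lborel (\<lambda>x. F (T x))"
    using p by (subst eq) (simp add: integrable_density integrable_distr_eq)
  show "integral\<^sup>L lborel F = (\<Prod>j\<in>Basis. \<bar>c j\<bar>) * integral\<^sup>L lborel (\<lambda>x. F (T x))"
    unfolding p_def[symmetric] using p by (subst eq) (simp add: integral_density integral_distr)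
qed

lemma lborel_integral_uminus:
  fixes F :: "'a::euclidean_space \<Rightarrow> real"
  assumes F: "F \<in> borel_measurable borel"
  shows "integrable lborel F \<longleftrightarrow> integrable lborel (\<lambda>x. F (- x))"
    and "integral\<^sup>L lborel F = integral\<^sup>L lborel (\<lambda>x. F (- x))"
  using lborel_integral_diagonal_affine[of "\<lambda>_. -1" F "0::'a", OF _ F]
  by (simp_all add: sum_negf euclidean_representation)

lemma lborel_integral_translate:
  fixes F :: "'a::euclidean_space \<Rightarrow> real"
  assumes F: "F \<in> borel_measurable borel"
  shows "integral\<^sup>L lborel (\<lambda>x. F (x - a)) = integral\<^sup>L lborel F"
  using lborel_integral_diagonal_affine(2)[of "\<lambda>_. 1" F "-a", OF _ F]
  by (simp add: euclidean_representation)

lemma prod_exp_neg_square_inner: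
  fixes x :: "'a::euclidean_space" and a :: real
  shows "(\<Prod>b\<in>Basis. exp (- a * (x \<bullet> b)\<^sup>2)) = exp (- a * (norm x)\<^sup>2)"
proof -
  have "(norm x)\<^sup>2 = (\<Sum>b\<in>Basis. (x \<bullet> b)\<^sup>2)"
    unfolding power2_norm_eq_inner by (subst euclidean_inner) (simp add: power2_eq_square)
  then have "- a * (norm x)\<^sup>2 = (\<Sum>b\<in>Basis. - a * (x \<bullet> b)\<^sup>2)"
    by (simp only: sum_distrib_left)
  then show ?thesis by (simp only: exp_sum[OF finite_Basis])
qed

text \<open>In one dimension the integrand is a multiple of the normal density of variance 1/(2 a);
  the product formula for nonnegative integrals over the coordinates gives the general case.\<close>

lemma integrable_exp_neg_square_norm:
  fixes a :: real
  assumes a: "a > 0"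
  shows "integrable lborel (\<lambda>x::'a::euclidean_space. exp (- a * (norm x)\<^sup>2))"
proof (rule integrableI_bounded)
  define \<sigma> where "\<sigma> = 1 / sqrt (2 * a)"
  have s: "\<sigma> > 0" "1 / (2 * \<sigma>\<^sup>2) = a" using a by (auto simp: \<sigma>_def power_divide)
  have e: "exp (- a * x\<^sup>2) = sqrt (2 * pi * \<sigma>\<^sup>2) * normal_density 0 \<sigma> x" for x
    using s a by (simp add: normal_density_def flip: s(2))
  have "integrable lborel (\<lambda>x. exp (- a * x\<^sup>2))"
    unfolding e using s(1) by (intro integrable_mult_right integrable_normal_density)
  then have fin: "(\<integral>\<^sup>+x. ennreal (exp (- a * x\<^sup>2)) \<partial>lborel) < \<infinity>"
    by (simp add: integrable_iff_bounded)
  have "(\<integral>\<^sup>+x. ennreal (norm (exp (- a * (norm (x::'a))\<^sup>2))) \<partial>lborel)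
      = (\<integral>\<^sup>+x. (\<Prod>b\<in>Basis. ennreal (exp (- a * (x \<bullet> b)\<^sup>2))) \<partial>(lborel :: 'a measure))"
    by (intro nn_integral_cong)
      (subst prod_ennreal, simp, subst prod_exp_neg_square_inner, simp)
  also have "\<dots> = (\<Prod>b\<in>(Basis::'a set). \<integral>\<^sup>+x. ennreal (exp (- a * x\<^sup>2)) \<partial>lborel)"
    by (rule nn_integral_lborel_prod) auto
  also have "\<dots> < \<infinity>"
    using fin by (simp add: power_less_top_ennreal)
  finally show "(\<integral>\<^sup>+x. ennreal (norm (exp (- a * (norm (x::'a))\<^sup>2))) \<partial>lborel) < \<infinity>" .
qed simp

lemma square_le_exp:
  fixes x :: real
  assumes "a > 0"
  shows "x\<^sup>2 \<le> exp (a * x\<^sup>2) / a"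
proof -
  have "a * x\<^sup>2 \<le> exp (a * x\<^sup>2)" using exp_ge_add_one_self[of "a * x\<^sup>2"] by linarith
  then show ?thesis using assms by (simp add: field_simps)
qed

lemma integrable_square_norm_exp:
  fixes a :: real
  assumes a: "a > 0"
  shows "integrable lborel (\<lambda>x::'a::euclidean_space. (norm x)\<^sup>2 * exp (- a * (norm x)\<^sup>2))"
proof (rule Bochner_Integration.integrable_bound)
  show "integrable lborel (\<lambda>x::'a. 2 / a * exp (- (a/2) * (norm x)\<^sup>2))"
    using a by (intro integrable_mult_right integrable_exp_neg_square_norm) simp
  have "(norm x)\<^sup>2 * exp (- a * (norm x)\<^sup>2) \<le> 2 / a * exp (- (a/2) * (norm x)\<^sup>2)" for x :: 'a
  proof -
    have "(norm x)\<^sup>2 * exp (- a * (norm x)\<^sup>2)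
        \<le> exp (a / 2 * (norm x)\<^sup>2) / (a/2) * exp (- a * (norm x)\<^sup>2)"
      using a by (intro mult_right_mono square_le_exp) auto
    also have "\<dots> = 2 / a * exp (- (a/2) * (norm x)\<^sup>2)"
      using a by (simp add: exp_minus field_simps flip: exp_add)
    finally show ?thesis .
  qed
  then show "AE x in lborel. norm ((norm (x::'a))\<^sup>2 * exp (- a * (norm x)\<^sup>2))
      \<le> norm (2 / a * exp (- (a/2) * (norm x)\<^sup>2))"
    using a by auto
qed simp

lemma integrable_inner_inner_exp:
  fixes i j :: "'a::euclidean_space"
  assumes "a > 0" "i \<in> Basis" "j \<in> Basis"
  shows "integrable lborel (\<lambda>x::'a. (x \<bullet> i) * (x \<bullet> j) * exp (- a * (norm x)\<^sup>2))"
proof (rule Bochner_Integration.integrable_bound[OF integrable_square_norm_exp[OF assms(1)]])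
  have "\<bar>x \<bullet> i\<bar> * \<bar>x \<bullet> j\<bar> \<le> (norm x)\<^sup>2" for x :: 'a
    unfolding power2_eq_square using assms by (intro mult_mono Basis_le_norm) auto
  then show "AE x in lborel. norm ((x \<bullet> i) * (x \<bullet> j) * exp (- a * (norm (x::'a))\<^sup>2))
      \<le> norm ((norm x)\<^sup>2 * exp (- a * (norm x)\<^sup>2))"
    by (auto simp: abs_mult)
qed simp

text \<open>The second moment of a centred normal law of variance 1/(2 a), stated with nonnegative
  integrals so that it can replace one factor of the product formula over the coordinates.\<close>

lemma nn_integral_square_exp_neg_square:
  fixes a :: real
  assumes a: "a > 0"
  shows "(\<integral>\<^sup>+x. ennreal (x\<^sup>2 * exp (- a * x\<^sup>2)) \<partial>lborel)
    = ennreal (1 / (2 * a)) * (\<integral>\<^sup>+x. ennreal (exp (- a * x\<^sup>2)) \<partial>lborel)"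
proof -
  define \<sigma> where "\<sigma> = 1 / sqrt (2 * a)"
  have s: "\<sigma> > 0" "1 / (2 * \<sigma>\<^sup>2) = a" "\<sigma>\<^sup>2 = 1 / (2 * a)"
    using a by (auto simp: \<sigma>_def power_divide)
  define c where "c = sqrt (2 * pi * \<sigma>\<^sup>2)"
  have c: "c > 0" using s(1) by (simp add: c_def)
  have e: "exp (- a * x\<^sup>2) = c * normal_density 0 \<sigma> x" for x
    using s(1) a by (simp add: normal_density_def c_def flip: s(2))
  have m0: "has_bochner_integral lborel (\<lambda>x. exp (- a * x\<^sup>2)) (c * 1)"
    unfolding e
    by (intro has_bochner_integral_mult_right)
      (simp add: has_bochner_integral_iff integrable_normal_density[OF s(1)] integral_normal_density[OF s(1)])
  have "has_bochner_integral lborel (\<lambda>x. c * (normal_density 0 \<sigma> x * (x - 0) ^ (2 * 1)))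
      (c * (fact (2 * 1) / ((2 / \<sigma>\<^sup>2)^1 * fact 1)))"
    by (intro has_bochner_integral_mult_right normal_moment_even s(1))
  then have m2: "has_bochner_integral lborel (\<lambda>x. x\<^sup>2 * exp (- a * x\<^sup>2)) (c * (1 / (2 * a)))"
    unfolding e using s(3) by (simp add: mult_ac)
  have "(\<integral>\<^sup>+x. ennreal (x\<^sup>2 * exp (- a * x\<^sup>2)) \<partial>lborel) = ennreal (c * (1 / (2 * a)))"
    using m2 by (subst nn_integral_eq_integral) (auto simp: has_bochner_integral_iff)
  moreover have "(\<integral>\<^sup>+x. ennreal (exp (- a * x\<^sup>2)) \<partial>lborel) = ennreal (c * 1)"
    using m0 by (subst nn_integral_eq_integral) (auto simp: has_bochner_integral_iff)
  ultimately show ?thesis using c a by (simp only: mult_1_right) (subst ennreal_mult[symmetric], simp_all add: mult.commute)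
qed

lemma integral_square_inner_exp:
  fixes i :: "'a::euclidean_space"
  assumes a: "a > 0" and i: "i \<in> Basis"
  shows "(\<integral>x. (x \<bullet> i) * (x \<bullet> i) * exp (- a * (norm x)\<^sup>2) \<partial>lborel)
    = 1 / (2 * a) * (\<integral>x. exp (- a * (norm (x::'a))\<^sup>2) \<partial>lborel)"
proof -
  let ?e = "\<lambda>t::real. ennreal (exp (- a * t\<^sup>2))"
  let ?f = "\<lambda>b t::real. ennreal (if b = i then t\<^sup>2 * exp (- a * t\<^sup>2) else exp (- a * t\<^sup>2))"
  note prod = prod_exp_neg_square_inner[of a]
  have prodi: "(\<Prod>b\<in>Basis. ?f b (x \<bullet> b)) = ennreal ((x \<bullet> i) * (x \<bullet> i) * exp (- a * (norm x)\<^sup>2))"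
    for x :: 'a
  proof -
    have "(\<Prod>b\<in>Basis. (if b = i then (x \<bullet> b)\<^sup>2 * exp (- a * (x \<bullet> b)\<^sup>2) else exp (- a * (x \<bullet> b)\<^sup>2)))
      = (\<Prod>b\<in>Basis. (if b = i then (x \<bullet> b)\<^sup>2 else 1) * exp (- a * (x \<bullet> b)\<^sup>2))"
      by (intro prod.cong) auto
    also have "\<dots> = (x \<bullet> i) * (x \<bullet> i) * exp (- a * (norm x)\<^sup>2)"
      unfolding prod.distrib prod using i by (simp add: power2_eq_square)
    finally show ?thesis by (subst prod_ennreal) auto
  qed
  have "(\<integral>\<^sup>+x. ennreal ((x \<bullet> i) * (x \<bullet> i) * exp (- a * (norm (x::'a))\<^sup>2)) \<partial>lborel)
      = (\<Prod>b\<in>(Basis::'a set). \<integral>\<^sup>+t. ?f b t \<partial>lborel)"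
    unfolding prodi[symmetric] by (rule nn_integral_lborel_prod) auto
  also have "\<dots> = (\<Prod>b\<in>(Basis::'a set). (if b = i then ennreal (1 / (2 * a)) else 1) * (\<integral>\<^sup>+t. ?e t \<partial>lborel))"
    by (intro prod.cong refl) (auto simp: nn_integral_square_exp_neg_square[OF a, simplified])
  also have "\<dots> = ennreal (1 / (2 * a)) * (\<Prod>b\<in>(Basis::'a set). \<integral>\<^sup>+t. ?e t \<partial>lborel)"
    using i by (subst prod.distrib) (simp add: prod.delta)
  also have "(\<Prod>b\<in>(Basis::'a set). \<integral>\<^sup>+t. ?e t \<partial>lborel) = (\<integral>\<^sup>+x. (\<Prod>b\<in>Basis. ?e (x \<bullet> b)) \<partial>(lborel :: 'a measure))"
    by (rule nn_integral_lborel_prod[symmetric]) auto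
  also have "\<dots> = (\<integral>\<^sup>+x. ennreal (exp (- a * (norm x)\<^sup>2)) \<partial>(lborel :: 'a measure))"
    by (intro nn_integral_cong) (subst prod_ennreal, simp, subst prod, rule refl)
  finally have "ennreal (\<integral>x. (x \<bullet> i) * (x \<bullet> i) * exp (- a * (norm (x::'a))\<^sup>2) \<partial>lborel)
    = ennreal (1 / (2 * a)) * ennreal (\<integral>x. exp (- a * (norm (x::'a))\<^sup>2) \<partial>lborel)"
    using nn_integral_eq_integral[OF integrable_inner_inner_exp[OF a i i]]
      nn_integral_eq_integral[OF integrable_exp_neg_square_norm[OF a, where 'a = 'a]] by simp
  then show ?thesis
    using a by (subst (asm) ennreal_mult[symmetric]) (auto intro!: Bochner_Integration.integral_nonneg)
qed

text \<open>Off the diagonal, flipping coordinate i preserves Lebesgue measure and the norm but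
  reverses the sign of the integrand, so the integral equals its own negative.\<close>

lemma integral_inner_inner_exp:
  fixes i j :: "'a::euclidean_space"
  assumes a: "a > 0" and i: "i \<in> Basis" and j: "j \<in> Basis"
  shows "(\<integral>x. (x \<bullet> i) * (x \<bullet> j) * exp (- a * (norm x)\<^sup>2) \<partial>lborel)
    = (if i = j then 1 / (2 * a) * (\<integral>x. exp (- a * (norm (x::'a))\<^sup>2) \<partial>lborel) else 0)"
proof (cases "i = j")
  case True
  then show ?thesis using integral_square_inner_exp[OF a i] by simp
next
  case False
  let ?c = "\<lambda>k. if k = i then - 1 else (1::real)"
  let ?T = "\<lambda>x::'a. 0 + (\<Sum>k\<in>Basis. (?c k * (x \<bullet> k)) *\<^sub>R k)"
  let ?F = "\<lambda>x::'a. (x \<bullet> i) * (x \<bullet> j) * exp (- a * (norm x)\<^sup>2)"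
  have comp: "?T x \<bullet> k = ?c k * (x \<bullet> k)" if "k \<in> Basis" for x k
    using that by (simp add: inner_sum_left_Basis)
  have n: "norm (?T x) = norm x" for x
    unfolding norm_eq_sqrt_inner euclidean_inner[of "?T x" "?T x"] euclidean_inner[of x x]
    by (intro arg_cong[where f = sqrt] sum.cong refl) (simp only: comp, simp)
  have "?F (?T x) = - ?F x" for x
    unfolding comp[OF i] comp[OF j] n using False by simp
  moreover have "integral\<^sup>L lborel ?F = (\<Prod>k\<in>Basis. \<bar>?c k\<bar>) * integral\<^sup>L lborel (\<lambda>x. ?F (?T x))"
    by (rule lborel_integral_diagonal_affine(2)) auto
  moreover have "(\<Prod>k\<in>(Basis::'a set). \<bar>?c k\<bar>) = 1" by (rule prod.neutral) auto
  ultimately have "integral\<^sup>L lborel ?F = - integral\<^sup>L lborel ?F" by simp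
  then show ?thesis using False by simp
qed

subsection \<open>The kernel in rescaled coordinates\<close>

text \<open>The kinetic scaling with s = sqrt h: transport by h times the velocity, a position
  fluctuation of size h^(3/2) and a velocity fluctuation of size h^(1/2). Working in s keeps all
  powers integral.\<close>

definition shift :: "real \<Rightarrow> 'n::finite phase \<Rightarrow> 'n phase \<Rightarrow> 'n phase"
  where "shift s p \<omega> = p + (s\<^sup>2 *\<^sub>R snd p + s ^ 3 *\<^sub>R fst \<omega>, s *\<^sub>R snd \<omega>)"

text \<open>The kernel at unit time started from the origin. By the scaling in
  \<open>G_kernel_shift\<close> it is the law of the rescaled noise for every h.\<close>

definition Gam :: "real \<Rightarrow> real \<Rightarrow> 'n::finite phase \<Rightarrow> real"
  where "Gam \<gamma> \<beta> \<omega> = G_kernel \<gamma> \<beta> 1 \<omega> 0"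

definition Gam_const :: "real \<Rightarrow> real \<Rightarrow> 'n::finite itself \<Rightarrow> real"
  where "Gam_const \<gamma> \<beta> n = 3 powr (real CARD('n) / 2) * (\<beta> / \<gamma>) ^ CARD('n) / (2 * pi) ^ CARD('n)"

lemma Gam_eq:
  "Gam \<gamma> \<beta> (\<zeta>, \<xi>) = Gam_const \<gamma> \<beta> TYPE('n::finite)
    * exp (- (3 * \<beta> / \<gamma>) * (norm (\<zeta> - (1 / 2) *\<^sub>R \<xi>))\<^sup>2 - \<beta> / (4 * \<gamma>) * (norm (\<xi> :: real^'n))\<^sup>2)"
  by (simp add: Gam_def G_kernel_def Gam_const_def zero_prod_def)

text \<open>Along \<open>shift\<close> the quantity x - y - (h/2)(v + w) becomes s^3 (\<zeta> -
  \<xi>/2) and v - w becomes s \<xi>, so the powers of s cancel h^3 and h in the exponent. The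
  factor s^(4 d) is the Jacobian s^(3 d) s^d.\<close>

lemma G_kernel_shift:
  fixes p \<omega> :: "'n::finite phase"
  assumes s: "s > 0"
  shows "G_kernel \<gamma> \<beta> (s\<^sup>2) (shift s p \<omega>) p * s ^ (4 * CARD('n)) = Gam \<gamma> \<beta> \<omega>"
proof -
  obtain y w \<zeta> \<xi> where [simp]: "p = (y, w)" "\<omega> = (\<zeta>, \<xi>)" by fastforce
  have "(s\<^sup>2 / 2) *\<^sub>R (w + w) = s\<^sup>2 *\<^sub>R w" by (simp flip: scaleR_2)
  then have diff: "y + (s\<^sup>2 *\<^sub>R w + s ^ 3 *\<^sub>R \<zeta>) - y - (s\<^sup>2 / 2) *\<^sub>R (w + s *\<^sub>R \<xi> + w)
      = s ^ 3 *\<^sub>R (\<zeta> - (1 / 2) *\<^sub>R \<xi>)"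
    by (simp add: scaleR_add_right scaleR_diff_right power2_eq_square power3_eq_cube)
  have e1: "3 * \<beta> / (\<gamma> * (s\<^sup>2) ^ 3) * (norm (s ^ 3 *\<^sub>R (\<zeta> - (1 / 2) *\<^sub>R \<xi>)))\<^sup>2
      = 3 * \<beta> / \<gamma> * (norm (\<zeta> - (1 / 2) *\<^sub>R \<xi>))\<^sup>2"
    using s by (simp add: power_mult_distrib flip: power_mult)
  have e2: "\<beta> / (4 * \<gamma> * s\<^sup>2) * (norm (w + s *\<^sub>R \<xi> - w))\<^sup>2 = \<beta> / (4 * \<gamma>) * (norm \<xi>)\<^sup>2"
    using s by (simp add: power_mult_distrib)
  have "G_kernel \<gamma> \<beta> (s\<^sup>2) (shift s p \<omega>) p
     = 3 powr (real CARD('n) / 2) * (\<beta> / \<gamma>) ^ CARD('n) / (2 * pi * (s\<^sup>2)\<^sup>2) ^ CARD('n)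
    * exp (- (3 * \<beta> / \<gamma> * (norm (\<zeta> - (1 / 2) *\<^sub>R \<xi>))\<^sup>2) - \<beta> / (4 * \<gamma>) * (norm \<xi>)\<^sup>2)"
    unfolding e1[symmetric] e2[symmetric] diff[symmetric]
    by (simp add: G_kernel_def shift_def)
  moreover have "(2 * pi * (s\<^sup>2)\<^sup>2) ^ CARD('n) = (2 * pi) ^ CARD('n) * s ^ (4 * CARD('n))"
    by (simp only: power_mult_distrib power_mult[symmetric]) simp
  ultimately show ?thesis
    using s by (simp add: Gam_eq Gam_const_def)
qed

text \<open>Brings \<open>shift\<close> into the shape that
  \<open>lborel_integral_diagonal_affine\<close> expects. The test \<open>snd j = 0\<close>
  recognises the position directions, which are scaled by s^3.\<close>

lemma shift_diagonal:
  fixes p \<omega> :: "'n::finite phase"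
  shows "shift s p \<omega> = (p + (s\<^sup>2 *\<^sub>R snd p, 0))
    + (\<Sum>j\<in>Basis. ((if snd j = 0 then s ^ 3 else s) * (\<omega> \<bullet> j)) *\<^sub>R j)"
proof -
  have "(\<Sum>j\<in>Basis. ((if snd j = 0 then s ^ 3 else s) * (\<omega> \<bullet> j)) *\<^sub>R j)
    = (\<Sum>u\<in>Basis. (s ^ 3 * (fst \<omega> \<bullet> u)) *\<^sub>R (u, 0)) + (\<Sum>u\<in>Basis. (s * (snd \<omega> \<bullet> u)) *\<^sub>R (0, u))"
    by (subst sum_Basis_prod_eq) (auto simp: inner_prod_def nonzero_Basis intro!: sum.cong)
  also have "\<dots> = (s ^ 3 *\<^sub>R (\<Sum>u\<in>Basis. (fst \<omega> \<bullet> u) *\<^sub>R u), s *\<^sub>R (\<Sum>u\<in>Basis. (snd \<omega> \<bullet> u) *\<^sub>R u))"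
    by (simp add: prod_eq_iff fst_sum snd_sum scaleR_sum_right)
  finally show ?thesis
    by (simp add: shift_def euclidean_representation prod_eq_iff)
qed

lemma shift_measurable [measurable]: "shift s p \<in> borel_measurable borel"
  unfolding shift_def[abs_def]
  by (intro borel_measurable_continuous_onI continuous_intros)

lemma prod_shift_factor:
  fixes s :: real
  assumes "s > 0"
  shows "(\<Prod>j\<in>(Basis :: 'n::finite phase set). \<bar>if snd j = 0 then s ^ 3 else s\<bar>) = s ^ (4 * CARD('n))"
proof -
  have "(\<Prod>j\<in>(Basis :: 'n phase set). \<bar>if snd j = 0 then s ^ 3 else s\<bar>)
     = (\<Prod>j\<in>(\<lambda>u. (u, 0)) ` (Basis :: (real^'n) set). \<bar>if snd j = (0 :: real^'n) then s ^ 3 else s\<bar>)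
     * (\<Prod>j\<in>(\<lambda>u. (0 :: real^'n, u)) ` (Basis :: (real^'n) set). \<bar>if snd j = 0 then s ^ 3 else s\<bar>)"
    unfolding Basis_prod_def by (rule prod.union_disjoint) (auto dest: nonzero_Basis)
  also have "\<dots> = (\<Prod>u\<in>(Basis :: (real^'n) set). s ^ 3) * (\<Prod>u\<in>(Basis :: (real^'n) set). s)"
    using abs_of_pos[OF assms] abs_of_pos[OF zero_less_power[OF assms, of 3]]
    by (subst (1 2) prod.reindex) (auto simp: inj_on_def nonzero_Basis intro!: prod.cong)
  also have "\<dots> = s ^ (3 * CARD('n)) * s ^ CARD('n)"
    using assms by (simp add: power_mult)
  finally show ?thesis by (simp flip: power_add)
qed

lemma G_kernel_measurable [measurable]:
  "(\<lambda>(z, p). G_kernel \<gamma> \<beta> h z p) \<in> borel_measurable (borel :: ('n::finite phase \<times> 'n phase) measure)"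
proof -
  have "(\<lambda>q::'n phase \<times> 'n phase. C * exp (a * (norm (fst (fst q) - fst (snd q) - c *\<^sub>R (snd (fst q) + snd (snd q))))\<^sup>2
           - b * (norm (snd (fst q) - snd (snd q)))\<^sup>2)) \<in> borel_measurable borel" for C a b c
    by (intro borel_measurable_continuous_onI continuous_intros)
  then show ?thesis unfolding G_kernel_def case_prod_beta' .
qed

lemma G_kernel_measurable_fst [measurable]:
  "(\<lambda>z. G_kernel \<gamma> \<beta> h z p) \<in> borel_measurable (borel :: 'n::finite phase measure)"
proof -
  have "(\<lambda>z. (z, p)) \<in> borel \<rightarrow>\<^sub>M (borel :: ('n phase \<times> 'n phase) measure)"
    by (intro borel_measurable_continuous_onI continuous_intros)
  from measurable_compose[OF this G_kernel_measurable] show ?thesis by simp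
qed

lemma Gam_measurable [measurable]:
  "Gam \<gamma> \<beta> \<in> borel_measurable (borel :: 'n::finite phase measure)"
  unfolding Gam_def[abs_def] by measurable

lemma G_op_rescaled:
  fixes F :: "'n::finite phase \<Rightarrow> real"
  assumes s: "s > 0" and F[measurable]: "F \<in> borel_measurable borel"
  shows "integrable lborel (\<lambda>z. G_kernel \<gamma> \<beta> (s\<^sup>2) z p * F z)
      \<longleftrightarrow> integrable lborel (\<lambda>\<omega>. Gam \<gamma> \<beta> \<omega> * F (shift s p \<omega>))" (is ?int)
    and "G_op \<gamma> \<beta> (s\<^sup>2) F p = (\<integral>\<omega>. Gam \<gamma> \<beta> \<omega> * F (shift s p \<omega>) \<partial>lborel)" (is ?eq)
proof -
  let ?c = "\<lambda>j :: 'n phase. if snd j = 0 then s ^ 3 else s"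
  let ?H = "\<lambda>z. G_kernel \<gamma> \<beta> (s\<^sup>2) z p * F z"
  have c: "?c j \<noteq> 0" for j using s by simp
  have H: "?H \<in> borel_measurable borel" by measurable
  note aff = lborel_integral_diagonal_affine[of ?c ?H "p + (s\<^sup>2 *\<^sub>R snd p, 0)", OF c H,
    folded shift_diagonal, unfolded prod_shift_factor[OF s]]
  define c where "c = 1 / s ^ (4 * CARD('n))"
  have c: "c \<noteq> 0" "s ^ (4 * CARD('n)) * c = 1" using s by (simp_all add: c_def)
  have eq: "?H (shift s p \<omega>) = c * (Gam \<gamma> \<beta> \<omega> * F (shift s p \<omega>))" for \<omega>
    using s G_kernel_shift[OF s, of \<gamma> \<beta> p \<omega>] by (simp add: c_def field_simps)
  show ?int using aff(1) c(1) unfolding eq by simp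
  show ?eq unfolding G_op_def aff(2) unfolding eq integral_mult_right_zero
    using c(2) by (simp flip: mult.assoc)
qed

context
  fixes \<gamma> \<beta> :: real
  assumes pos: "\<gamma> > 0" "\<beta> > 0"
begin

lemma Gam_const_pos: "Gam_const \<gamma> \<beta> TYPE('n::finite) > 0"
  using pos by (simp add: Gam_const_def)

lemma Gam_pos: "Gam \<gamma> \<beta> \<omega> > 0"
  by (cases \<omega>) (simp add: Gam_eq Gam_const_pos)

lemma Gam_uminus: "Gam \<gamma> \<beta> (- \<omega>) = Gam \<gamma> \<beta> \<omega>"
proof (cases \<omega>)
  case (Pair \<zeta> \<xi>)
  have "- \<zeta> - (1 / 2) *\<^sub>R (- \<xi>) = - (\<zeta> - (1 / 2) *\<^sub>R \<xi>)" by simp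
  then have "norm (- \<zeta> - (1 / 2) *\<^sub>R (- \<xi>)) = norm (\<zeta> - (1 / 2) *\<^sub>R \<xi>)"
    by (simp only: norm_minus_cancel)
  then show ?thesis unfolding Pair uminus_Pair Gam_eq by (simp only: norm_minus_cancel)
qed

text \<open>The two components are decoupled by |\<zeta>|^2 \<le> 2 |\<eta>|^2 + |\<xi>|^2 / 2 with
  \<eta> = \<zeta> - \<xi>/2. The rate \<beta> / (6 \<gamma>) is chosen so that the resulting 3/2 in
  front of |\<xi>|^2 becomes 1/4, the coefficient in the kernel.\<close>

lemma Gam_le:
  fixes \<omega> :: "'n::finite phase"
  shows "Gam \<gamma> \<beta> \<omega> \<le> Gam_const \<gamma> \<beta> TYPE('n) * exp (- (\<beta> / (6 * \<gamma>)) * (norm \<omega>)\<^sup>2)"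
proof (cases \<omega>)
  case (Pair \<zeta> \<xi>)
  let ?\<eta> = "\<zeta> - (1 / 2) *\<^sub>R \<xi>"
  have "norm \<zeta> \<le> norm ?\<eta> + norm \<xi> / 2"
    using norm_triangle_ineq[of ?\<eta> "(1 / 2) *\<^sub>R \<xi>"] by simp
  then have "(norm \<zeta>)\<^sup>2 \<le> (norm ?\<eta> + norm \<xi> / 2)\<^sup>2" by (rule power_mono) simp
  also have "\<dots> \<le> 2 * (norm ?\<eta>)\<^sup>2 + (norm \<xi>)\<^sup>2 / 2"
    using zero_le_power2[of "norm ?\<eta> - norm \<xi> / 2"] by (simp add: power2_eq_square algebra_simps)
  moreover have "(norm \<omega>)\<^sup>2 = (norm \<zeta>)\<^sup>2 + (norm \<xi>)\<^sup>2" by (simp add: Pair norm_Pair)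
  moreover have "0 \<le> (norm ?\<eta>)\<^sup>2" by simp
  ultimately have 1: "(norm \<omega>)\<^sup>2 \<le> 18 * (norm ?\<eta>)\<^sup>2 + (3 / 2) * (norm \<xi>)\<^sup>2"
    by linarith
  have "\<beta> / (6 * \<gamma>) * (norm \<omega>)\<^sup>2 \<le> \<beta> / (6 * \<gamma>) * (18 * (norm ?\<eta>)\<^sup>2 + (3 / 2) * (norm \<xi>)\<^sup>2)"
    using pos by (intro mult_left_mono 1) simp
  also have "\<dots> = (3 * \<beta> / \<gamma>) * (norm ?\<eta>)\<^sup>2 + \<beta> / (4 * \<gamma>) * (norm \<xi>)\<^sup>2"
    using pos by (simp add: field_simps)
  finally show ?thesis
    unfolding Pair Gam_eq using less_imp_le[OF Gam_const_pos[where 'n = 'n]]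
    by (intro mult_left_mono) auto
qed

lemma integrable_Gam_exp:
  assumes "a < \<beta> / (6 * \<gamma>)"
  shows "integrable lborel (\<lambda>\<omega>::'n::finite phase. Gam \<gamma> \<beta> \<omega> * exp (a * (norm \<omega>)\<^sup>2))"
proof (rule Bochner_Integration.integrable_bound)
  let ?C = "Gam_const \<gamma> \<beta> TYPE('n)"
  show "integrable lborel (\<lambda>\<omega>::'n phase. ?C * exp (- (\<beta> / (6 * \<gamma>) - a) * (norm \<omega>)\<^sup>2))"
    using assms by (intro integrable_mult_right integrable_exp_neg_square_norm) simp
  have "Gam \<gamma> \<beta> \<omega> * exp (a * (norm \<omega>)\<^sup>2) \<le> ?C * exp (- (\<beta> / (6 * \<gamma>) - a) * (norm \<omega>)\<^sup>2)" for \<omega> :: "'n phase"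
  proof -
    have "Gam \<gamma> \<beta> \<omega> * exp (a * (norm \<omega>)\<^sup>2)
        \<le> ?C * exp (- (\<beta> / (6 * \<gamma>)) * (norm \<omega>)\<^sup>2) * exp (a * (norm \<omega>)\<^sup>2)"
      by (intro mult_right_mono Gam_le) simp
    also have "\<dots> = ?C * exp (- (\<beta> / (6 * \<gamma>) - a) * (norm \<omega>)\<^sup>2)"
      by (simp add: algebra_simps flip: exp_add)
    finally show ?thesis .
  qed
  then have "norm (Gam \<gamma> \<beta> \<omega> * exp (a * (norm (\<omega>::'n phase))\<^sup>2))
      \<le> norm (?C * exp (- (\<beta> / (6 * \<gamma>) - a) * (norm \<omega>)\<^sup>2))" for \<omega>
    using abs_of_pos[OF Gam_pos[of \<omega>]] abs_of_pos[OF Gam_const_pos[where 'n = 'n]]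
    by (simp only: real_norm_def abs_mult abs_exp_cancel)
  then show "AE \<omega> in lborel. norm (Gam \<gamma> \<beta> \<omega> * exp (a * (norm (\<omega>::'n phase))\<^sup>2))
      \<le> norm (?C * exp (- (\<beta> / (6 * \<gamma>) - a) * (norm \<omega>)\<^sup>2))"
    by (rule AE_I2)
qed simp

lemma integrable_Gam_bound:
  fixes F :: "'n::finite phase \<Rightarrow> real"
  assumes "a < \<beta> / (6 * \<gamma>)" and [measurable]: "F \<in> borel_measurable borel"
    and F: "\<And>\<omega>. \<bar>F \<omega>\<bar> \<le> K * exp (a * (norm \<omega>)\<^sup>2)"
  shows "integrable lborel (\<lambda>\<omega>. Gam \<gamma> \<beta> \<omega> * F \<omega>)"
proof (rule Bochner_Integration.integrable_bound)
  show "integrable lborel (\<lambda>\<omega>::'n phase. K * (Gam \<gamma> \<beta> \<omega> * exp (a * (norm \<omega>)\<^sup>2)))"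
    by (intro integrable_mult_right integrable_Gam_exp assms)
  have "\<bar>Gam \<gamma> \<beta> \<omega> * F \<omega>\<bar> \<le> \<bar>K * (Gam \<gamma> \<beta> \<omega> * exp (a * (norm \<omega>)\<^sup>2))\<bar>" for \<omega>
  proof -
    have "\<bar>Gam \<gamma> \<beta> \<omega> * F \<omega>\<bar> = Gam \<gamma> \<beta> \<omega> * \<bar>F \<omega>\<bar>"
      using less_imp_le[OF Gam_pos[of \<omega>]] by (simp add: abs_mult)
    also have "\<dots> \<le> Gam \<gamma> \<beta> \<omega> * (K * exp (a * (norm \<omega>)\<^sup>2))"
      by (intro mult_left_mono F less_imp_le Gam_pos)
    finally show ?thesis by (simp add: mult_ac)
  qed
  then show "AE \<omega> in lborel. norm (Gam \<gamma> \<beta> \<omega> * F \<omega>) \<le> norm (K * (Gam \<gamma> \<beta> \<omega> * exp (a * (norm \<omega>)\<^sup>2)))"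
    by simp
qed measurable

lemma integrable_Gam: "integrable lborel (Gam \<gamma> \<beta> :: 'n::finite phase \<Rightarrow> real)"
  using integrable_Gam_exp[of 0, where 'n = 'n] pos by simp

text \<open>At fixed \<xi>, translation invariance removes the offset \<xi>/2 from the integral over
  \<zeta>. The marginal in \<xi> is therefore Gaussian with exponent \<beta> / (4 \<gamma>),
  whatever the correlation of the two components.\<close>

lemma integral_Gam_snd:
  fixes Q :: "real^'n::finite \<Rightarrow> real"
  assumes [measurable]: "Q \<in> borel_measurable borel"
    and int: "integrable lborel (\<lambda>\<omega>. Gam \<gamma> \<beta> \<omega> * Q (snd \<omega>))"
  shows "(\<integral>\<omega>. Gam \<gamma> \<beta> \<omega> * Q (snd \<omega>) \<partial>lborel)
    = Gam_const \<gamma> \<beta> TYPE('n) * (\<integral>\<zeta>. exp (- (3 * \<beta> / \<gamma>) * (norm (\<zeta> :: real^'n))\<^sup>2) \<partial>lborel)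
      * (\<integral>\<xi>. Q \<xi> * exp (- (\<beta> / (4 * \<gamma>)) * (norm \<xi>)\<^sup>2) \<partial>lborel)"
proof -
  let ?C = "Gam_const \<gamma> \<beta> TYPE('n)"
  let ?K = "(\<integral>\<zeta>. exp (- (3 * \<beta> / \<gamma>) * (norm (\<zeta> :: real^'n))\<^sup>2) \<partial>lborel)"
  have int': "integrable (lborel \<Otimes>\<^sub>M lborel) (\<lambda>(\<zeta>, \<xi>). Gam \<gamma> \<beta> (\<zeta>, \<xi>) * Q \<xi>)"
    using int by (simp add: lborel_prod case_prod_beta')
  have inner: "(\<integral>\<zeta>. Gam \<gamma> \<beta> (\<zeta>, \<xi>) * Q \<xi> \<partial>lborel) = ?C * ?K * (Q \<xi> * exp (- (\<beta> / (4 * \<gamma>)) * (norm \<xi>)\<^sup>2))" for \<xi>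
  proof -
    have "Gam \<gamma> \<beta> (\<zeta>, \<xi>) * Q \<xi> = (?C * Q \<xi> * exp (- (\<beta> / (4 * \<gamma>)) * (norm \<xi>)\<^sup>2))
        * exp (- (3 * \<beta> / \<gamma>) * (norm (\<zeta> - (1 / 2) *\<^sub>R \<xi>))\<^sup>2)" for \<zeta>
      by (simp only: Gam_eq diff_conv_add_uminus exp_add mult_minus_left mult_minus_right mult_ac)
    then have "(\<integral>\<zeta>. Gam \<gamma> \<beta> (\<zeta>, \<xi>) * Q \<xi> \<partial>lborel) = (?C * Q \<xi> * exp (- (\<beta> / (4 * \<gamma>)) * (norm \<xi>)\<^sup>2))
      * (\<integral>\<zeta>. exp (- (3 * \<beta> / \<gamma>) * (norm (\<zeta> - (1 / 2) *\<^sub>R \<xi>))\<^sup>2) \<partial>lborel)"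
      by (simp only: integral_mult_right_zero)
    also have "(\<integral>\<zeta>. exp (- (3 * \<beta> / \<gamma>) * (norm (\<zeta> - (1 / 2) *\<^sub>R \<xi>))\<^sup>2) \<partial>lborel) = ?K"
      by (rule lborel_integral_translate) measurable
    finally show ?thesis by (simp only: mult_ac)
  qed
  have "(\<integral>\<omega>. Gam \<gamma> \<beta> \<omega> * Q (snd \<omega>) \<partial>lborel) = integral\<^sup>L (lborel \<Otimes>\<^sub>M lborel) (\<lambda>(\<zeta>, \<xi>). Gam \<gamma> \<beta> (\<zeta>, \<xi>) * Q \<xi>)"
    by (simp add: lborel_prod case_prod_beta')
  also have "\<dots> = (\<integral>\<xi>. (\<integral>\<zeta>. Gam \<gamma> \<beta> (\<zeta>, \<xi>) * Q \<xi> \<partial>lborel) \<partial>lborel)"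
    by (rule lborel_pair.integral_snd[OF int', symmetric])
  also have "\<dots> = ?C * ?K * (\<integral>\<xi>. Q \<xi> * exp (- (\<beta> / (4 * \<gamma>)) * (norm \<xi>)\<^sup>2) \<partial>lborel)"
    unfolding inner by (rule integral_mult_right_zero)
  finally show ?thesis .
qed

lemma integrable_Gam_inner_inner:
  fixes i j :: "real^'n::finite"
  assumes "i \<in> Basis" "j \<in> Basis"
  shows "integrable lborel (\<lambda>\<omega>. Gam \<gamma> \<beta> \<omega> * ((snd \<omega> \<bullet> i) * (snd \<omega> \<bullet> j)))"
proof (rule integrable_Gam_bound)
  let ?a = "\<beta> / (12 * \<gamma>)"
  show "?a < \<beta> / (6 * \<gamma>)" using pos by (simp add: field_simps)
  show "(\<lambda>\<omega> :: (real^'n) \<times> (real^'n). (snd \<omega> \<bullet> i) * (snd \<omega> \<bullet> j)) \<in> borel_measurable borel"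
    by (intro borel_measurable_continuous_onI continuous_intros)
  fix \<omega> :: "(real^'n) \<times> (real^'n)"
  have "\<bar>snd \<omega> \<bullet> b\<bar> \<le> norm \<omega>" if "b \<in> Basis" for b
    using Basis_le_norm[OF that, of "snd \<omega>"] norm_snd_le[of "snd \<omega>" "fst \<omega>"] by simp
  then have "\<bar>(snd \<omega> \<bullet> i) * (snd \<omega> \<bullet> j)\<bar> \<le> norm \<omega> * norm \<omega>"
    unfolding abs_mult using assms by (intro mult_mono) auto
  also have "\<dots> \<le> 1 / ?a * exp (?a * (norm \<omega>)\<^sup>2)"
    using square_le_exp[of ?a "norm \<omega>"] pos by (simp add: power2_eq_square mult_ac)
  finally show "\<bar>(snd \<omega> \<bullet> i) * (snd \<omega> \<bullet> j)\<bar> \<le> 1 / ?a * exp (?a * (norm \<omega>)\<^sup>2)" .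
qed

text \<open>The variance 2 \<gamma> / \<beta> is 1/(2 a) for the marginal exponent a = \<beta> / (4
  \<gamma>). The value is given relative to the total mass of \<open>Gam\<close>, which therefore
  never has to be computed.\<close>

lemma integral_Gam_inner_inner:
  fixes i j :: "real^'n::finite"
  assumes ij: "i \<in> Basis" "j \<in> Basis"
  shows "(\<integral>\<omega>. Gam \<gamma> \<beta> \<omega> * ((snd \<omega> \<bullet> i) * (snd \<omega> \<bullet> j)) \<partial>lborel)
    = (if i = j then 2 * \<gamma> / \<beta> * (\<integral>\<omega>. Gam \<gamma> \<beta> (\<omega> :: 'n phase) \<partial>lborel) else 0)"
proof -
  let ?A = "Gam_const \<gamma> \<beta> TYPE('n) * (\<integral>\<zeta>. exp (- (3 * \<beta> / \<gamma>) * (norm (\<zeta> :: real^'n))\<^sup>2) \<partial>lborel)"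
  have k: "\<beta> / (4 * \<gamma>) > 0" using pos by simp
  have 1: "(\<integral>\<omega>. Gam \<gamma> \<beta> (\<omega> :: 'n phase) \<partial>lborel) = ?A * (\<integral>\<xi>. exp (- (\<beta> / (4 * \<gamma>)) * (norm (\<xi>::real^'n))\<^sup>2) \<partial>lborel)"
    using integral_Gam_snd[of "\<lambda>_. 1 :: real"] integrable_Gam by simp
  have "(\<lambda>\<xi>. (\<xi> \<bullet> i) * (\<xi> \<bullet> j)) \<in> borel_measurable borel" by measurable
  from integral_Gam_snd[OF this integrable_Gam_inner_inner[OF ij]]
  show ?thesis
    unfolding integral_inner_inner_exp[OF k ij] 1 by simp
qed

text \<open>The leading term of the local error is a quadratic form in the velocity noise plus a
  constant, and only the trace of the form survives integration.\<close>

lemma integral_Gam_quadratic: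
  fixes a :: "real^'n::finite \<Rightarrow> real^'n \<Rightarrow> real"
  shows "integrable lborel (\<lambda>\<omega>. Gam \<gamma> \<beta> \<omega> * ((\<Sum>i\<in>Basis. \<Sum>j\<in>Basis. (snd \<omega> \<bullet> i) * (snd \<omega> \<bullet> j) * a i j) + c))"
    and "(\<integral>\<omega>. Gam \<gamma> \<beta> \<omega> * ((\<Sum>i\<in>Basis. \<Sum>j\<in>Basis. (snd \<omega> \<bullet> i) * (snd \<omega> \<bullet> j) * a i j) + c) \<partial>lborel)
      = (2 * \<gamma> / \<beta> * (\<Sum>i\<in>Basis. a i i) + c) * (\<integral>\<omega>. Gam \<gamma> \<beta> (\<omega> :: 'n phase) \<partial>lborel)"
proof -
  let ?B = "Basis :: (real^'n) set"
  let ?q = "\<lambda>i j (\<omega> :: 'n phase). Gam \<gamma> \<beta> \<omega> * ((snd \<omega> \<bullet> i) * (snd \<omega> \<bullet> j))"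
  have eq: "Gam \<gamma> \<beta> \<omega> * ((\<Sum>i\<in>Basis. \<Sum>j\<in>Basis. (snd \<omega> \<bullet> i) * (snd \<omega> \<bullet> j) * a i j) + c)
     = (\<Sum>i\<in>?B. \<Sum>j\<in>?B. a i j * ?q i j \<omega>) + c * Gam \<gamma> \<beta> \<omega>" for \<omega>
    by (simp add: distrib_left sum_distrib_left mult_ac)
  have i1: "integrable lborel (\<lambda>\<omega>. a i j * ?q i j \<omega>)" if "i \<in> ?B" "j \<in> ?B" for i j
    by (intro integrable_mult_right integrable_Gam_inner_inner that)
  have i2: "integrable lborel (\<lambda>\<omega>. \<Sum>i\<in>?B. \<Sum>j\<in>?B. a i j * ?q i j \<omega>)"
    by (intro Bochner_Integration.integrable_sum i1)
  have i3: "integrable lborel (\<lambda>\<omega>::'n phase. c * Gam \<gamma> \<beta> \<omega>)"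
    by (intro integrable_mult_right integrable_Gam)
  show "integrable lborel (\<lambda>\<omega>. Gam \<gamma> \<beta> \<omega> * ((\<Sum>i\<in>Basis. \<Sum>j\<in>Basis. (snd \<omega> \<bullet> i) * (snd \<omega> \<bullet> j) * a i j) + c))"
    unfolding eq by (intro Bochner_Integration.integrable_add i2 i3)
  have "(\<integral>\<omega>. (\<Sum>i\<in>?B. \<Sum>j\<in>?B. a i j * ?q i j \<omega>) + c * Gam \<gamma> \<beta> \<omega> \<partial>lborel)
     = (\<integral>\<omega>. (\<Sum>i\<in>?B. \<Sum>j\<in>?B. a i j * ?q i j \<omega>) \<partial>lborel) + (\<integral>\<omega>. c * Gam \<gamma> \<beta> (\<omega>::'n phase) \<partial>lborel)"
    by (rule Bochner_Integration.integral_add[OF i2 i3])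
  also have "(\<integral>\<omega>. (\<Sum>i\<in>?B. \<Sum>j\<in>?B. a i j * ?q i j \<omega>) \<partial>lborel)
     = (\<Sum>i\<in>?B. \<integral>\<omega>. (\<Sum>j\<in>?B. a i j * ?q i j \<omega>) \<partial>lborel)"
    by (intro Bochner_Integration.integral_sum Bochner_Integration.integrable_sum i1)
  also have "\<dots> = (\<Sum>i\<in>?B. \<Sum>j\<in>?B. a i j * (\<integral>\<omega>. ?q i j \<omega> \<partial>lborel))"
    by (intro sum.cong refl, subst Bochner_Integration.integral_sum, rule i1, assumption+)
      (simp only: integral_mult_right_zero)
  also have "\<dots> = (\<Sum>i\<in>?B. \<Sum>j\<in>?B. if i = j then a i j * (2 * \<gamma> / \<beta> * (\<integral>\<omega>. Gam \<gamma> \<beta> (\<omega> :: 'n phase) \<partial>lborel)) else 0)"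
    by (intro sum.cong refl) (simp add: integral_Gam_inner_inner)
  also have "\<dots> = 2 * \<gamma> / \<beta> * (\<Sum>i\<in>?B. a i i) * (\<integral>\<omega>. Gam \<gamma> \<beta> (\<omega> :: 'n phase) \<partial>lborel)"
    by (simp add: sum_distrib_left sum_distrib_right sum_divide_distrib mult_ac)
  finally show "(\<integral>\<omega>. Gam \<gamma> \<beta> \<omega> * ((\<Sum>i\<in>Basis. \<Sum>j\<in>Basis. (snd \<omega> \<bullet> i) * (snd \<omega> \<bullet> j) * a i j) + c) \<partial>lborel)
      = (2 * \<gamma> / \<beta> * (\<Sum>i\<in>Basis. a i i) + c) * (\<integral>\<omega>. Gam \<gamma> \<beta> (\<omega> :: 'n phase) \<partial>lborel)"
    unfolding eq by (simp add: distrib_right)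
qed

text \<open>Since \<open>Gam\<close> is even, the average over \<omega> and - \<omega> has the same
  integral. Odd powers of s then cancel pointwise, before absolute values are taken.\<close>

lemma integral_Gam_symmetrize:
  fixes F :: "'n::finite phase \<Rightarrow> real"
  assumes [measurable]: "F \<in> borel_measurable borel"
    and int: "integrable lborel (\<lambda>\<omega>. Gam \<gamma> \<beta> \<omega> * F \<omega>)"
  shows "integrable lborel (\<lambda>\<omega>. Gam \<gamma> \<beta> \<omega> * ((F \<omega> + F (- \<omega>)) / 2))"
    and "(\<integral>\<omega>. Gam \<gamma> \<beta> \<omega> * F \<omega> \<partial>lborel) = (\<integral>\<omega>. Gam \<gamma> \<beta> \<omega> * ((F \<omega> + F (- \<omega>)) / 2) \<partial>lborel)"
proof -
  let ?H = "\<lambda>\<omega>. Gam \<gamma> \<beta> \<omega> * F \<omega>"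
  have H: "?H \<in> borel_measurable borel" by measurable
  note um = lborel_integral_uminus[OF H, unfolded Gam_uminus]
  have int': "integrable lborel (\<lambda>\<omega>. Gam \<gamma> \<beta> \<omega> * F (- \<omega>))" using um(1) int by blast
  have eq: "Gam \<gamma> \<beta> \<omega> * ((F \<omega> + F (- \<omega>)) / 2) = (?H \<omega> + Gam \<gamma> \<beta> \<omega> * F (- \<omega>)) / 2" for \<omega>
    by (simp add: distrib_left)
  show "integrable lborel (\<lambda>\<omega>. Gam \<gamma> \<beta> \<omega> * ((F \<omega> + F (- \<omega>)) / 2))"
    unfolding eq by (intro integrable_divide Bochner_Integration.integrable_add int int')
  show "(\<integral>\<omega>. Gam \<gamma> \<beta> \<omega> * F \<omega> \<partial>lborel) = (\<integral>\<omega>. Gam \<gamma> \<beta> \<omega> * ((F \<omega> + F (- \<omega>)) / 2) \<partial>lborel)"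
    unfolding eq using um(2) by (simp add: Bochner_Integration.integral_add[OF int int'])
qed

end

text \<open>If the integral vanished, a positive function would vanish almost everywhere, so the
  almost-everywhere filter of Lebesgue measure would be trivial. The lemma supplies positive
  Gaussian constants, one of which becomes a denominator.\<close>

lemma lborel_integral_pos:
  fixes f :: "'a::euclidean_space \<Rightarrow> real"
  assumes int: "integrable lborel f" and f: "\<And>x. f x > 0"
  shows "integral\<^sup>L lborel f > 0"
proof -
  have "integral\<^sup>L lborel f \<noteq> 0"
  proof
    assume "integral\<^sup>L lborel f = 0"
    then have "AE x in lborel. f x = 0"
      using integral_nonneg_eq_0_iff_AE[OF int] f less_imp_le by blast
    then have "AE x in (lborel :: 'a measure). False"
      by eventually_elim (metis f less_irrefl)
    then show False using ae_filter_eq_bot_iff[of "lborel :: 'a measure"] by (simp add: trivial_limit_def)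
  qed
  moreover have "integral\<^sup>L lborel f \<ge> 0"
    using f less_imp_le by (intro Bochner_Integration.integral_nonneg) blast
  ultimately show ?thesis by simp
qed

subsection \<open>Expansion of \<open>\<psi>\<close> along the kernel\<close>

lemma pd_eq_grad_inner:
  fixes f :: "'a::euclidean_space \<Rightarrow> real"
  assumes "f differentiable (at z)"
  shows "pd v f z = grad f z \<bullet> v"
  unfolding grad_def
  by (subst pd_Basis_expand[OF assms])
    (simp add: inner_sum_left inner_commute[of v] mult.commute[of _ "pd _ f z"])

lemma continuous_on_grad:
  fixes f :: "'a::euclidean_space \<Rightarrow> real"
  assumes "Ck (Suc k) f"
  shows "continuous_on UNIV (grad f)"
proof -
  have "continuous_on UNIV (pd b f)" if "b \<in> Basis" for b
    using Ck_continuous[OF Ck_SucD(2)[OF assms that]] .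
  then show ?thesis
    unfolding grad_def[abs_def] by (auto intro!: continuous_on_sum continuous_on_scaleR)
qed

lemma exp_Taylor_bounds:
  fixes x :: real
  assumes "\<bar>x\<bar> \<le> M"
  shows "\<bar>exp x - 1\<bar> \<le> M * exp M" "\<bar>exp x - 1 - x\<bar> \<le> M\<^sup>2 * exp M"
    "\<bar>exp x - 1 - x - x\<^sup>2 / 2\<bar> \<le> M ^ 3 * exp M"
proof -
  have *: "\<bar>exp x - (\<Sum>i\<le>n. x ^ i / fact i)\<bar> \<le> M ^ Suc n * exp M" for n
  proof -
    have "\<bar>exp x - (\<Sum>i\<le>n. x ^ i / fact i)\<bar> \<le> exp \<bar>x\<bar> * (\<bar>x\<bar> ^ Suc n) / fact n"
      using Taylor_exp_field[of x n] by simp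
    also have "\<dots> \<le> exp \<bar>x\<bar> * (\<bar>x\<bar> ^ Suc n) / 1"
      using fact_ge_1[of n, where 'a = real] by (intro divide_left_mono) auto
    also have "\<dots> \<le> exp M * M ^ Suc n"
      using assms by (auto intro!: mult_mono power_mono)
    finally show ?thesis by (simp add: mult.commute)
  qed
  show "\<bar>exp x - 1\<bar> \<le> M * exp M" using *[of 0] by simp
  show "\<bar>exp x - 1 - x\<bar> \<le> M\<^sup>2 * exp M" using *[of 1] by (simp add: power2_eq_square diff_diff_eq)
  show "\<bar>exp x - 1 - x - x\<^sup>2 / 2\<bar> \<le> M ^ 3 * exp M"
    using *[of 2] by (simp add: numeral_2_eq_2 numeral_3_eq_3 diff_diff_eq add.assoc)
qed

text \<open>B and A play the roles of the even and odd part of an exponent. In the half difference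
  the quadratic Taylor terms leave ((B + A)^2 - (B - A)^2) / 4 = A B, hence the summand |A| |B|;
  that part needs a cubic remainder, while a quadratic one is enough for the half sum.\<close>

lemma exp_symmetrized_bounds:
  fixes A B :: real
  assumes M: "M = \<bar>A\<bar> + \<bar>B\<bar>"
  shows "\<bar>(exp (B + A) + exp (B - A)) / 2 - 1\<bar> \<le> M\<^sup>2 * exp M + \<bar>B\<bar>"
    and "\<bar>(exp (B + A) - exp (B - A)) / 2 - A\<bar> \<le> M ^ 3 * exp M + \<bar>A\<bar> * \<bar>B\<bar>"
    and "\<bar>(exp (B + A) + exp (B - A)) / 2\<bar> \<le> exp M"
    and "\<bar>(exp (B + A) - exp (B - A)) / 2\<bar> \<le> M * exp M"
proof -
  have b: "\<bar>B + A\<bar> \<le> M" "\<bar>B - A\<bar> \<le> M" using M by auto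
  note p = exp_Taylor_bounds[OF b(1), THEN abs_le_D1] exp_Taylor_bounds[OF b(1), THEN abs_le_D2]
  note m = exp_Taylor_bounds[OF b(2), THEN abs_le_D1] exp_Taylor_bounds[OF b(2), THEN abs_le_D2]
  show "\<bar>(exp (B + A) + exp (B - A)) / 2 - 1\<bar> \<le> M\<^sup>2 * exp M + \<bar>B\<bar>"
    using p(2,5) m(2,5) abs_ge_self[of B] abs_ge_minus_self[of B]
    by (intro abs_leI) (simp_all add: field_simps)
  have sq: "(B + A)\<^sup>2 / 2 - (B - A)\<^sup>2 / 2 = 2 * (A * B)"
    by (simp add: power2_sum power2_diff add_divide_distrib diff_divide_distrib)
  have "\<bar>A * B\<bar> \<le> \<bar>A\<bar> * \<bar>B\<bar>" by (simp add: abs_mult)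
  note ab = abs_le_D1[OF this] abs_le_D2[OF this]
  have combine: "\<bar>(x - y) / 2 - A\<bar> \<le> Q + c"
    if "x - 1 - (B + A) - u \<le> Q" "- (x - 1 - (B + A) - u) \<le> Q"
      "y - 1 - (B - A) - v \<le> Q" "- (y - 1 - (B - A) - v) \<le> Q"
      "u - v = 2 * r" "r \<le> c" "- r \<le> c" for x y u v r Q c :: real
    using that by (intro abs_leI) (simp_all add: field_simps)
  show "\<bar>(exp (B + A) - exp (B - A)) / 2 - A\<bar> \<le> M ^ 3 * exp M + \<bar>A\<bar> * \<bar>B\<bar>"
    by (rule combine[OF p(3,6) m(3,6) sq ab])
  have "exp (B + A) \<le> exp M" "exp (B - A) \<le> exp M" using b by auto
  then show "\<bar>(exp (B + A) + exp (B - A)) / 2\<bar> \<le> exp M"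
    using exp_gt_zero[of "B + A"] exp_gt_zero[of "B - A"] by (simp add: abs_le_iff field_simps del: exp_le_cancel_iff)
  have combine': "\<bar>(x - y) / 2\<bar> \<le> Q" if "x - 1 \<le> Q" "- (x - 1) \<le> Q" "y - 1 \<le> Q" "- (y - 1) \<le> Q"
    for x y Q :: real
    using that by (intro abs_leI) (simp_all add: field_simps)
  show "\<bar>(exp (B + A) - exp (B - A)) / 2\<bar> \<le> M * exp M"
    by (rule combine'[OF p(1,4) m(1,4)])
qed

locale kinetic =
  fixes V :: "real^'n \<Rightarrow> real" and \<gamma> \<beta> l :: real
  assumes gamma_pos: "\<gamma> > 0" and beta_pos: "\<beta> > 0" and l_pos: "l > 0"
    and V: "admissible_potential V"
begin

lemma V_Ck: "Ck 3 V" and V_differentiable: "V differentiable (at x)"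
proof -
  show 1: "Ck 3 V" using V by (simp add: admissible_potential_def)
  show "V differentiable (at x)" using 1 by (simp add: numeral_3_eq_3)
qed

lemma potential_bounds:
  obtains L where "L \<ge> 0"
    and "\<And>a b. norm (grad V a - grad V b) \<le> L * norm (a - b)"
    and "\<And>b. norm (grad V b) \<le> L * (1 + norm b)"
    and "\<And>a b. \<bar>V a - V b\<bar> \<le> L * norm (a - b) * (1 + norm b + norm (a - b))"
proof -
  have d: "pd b V differentiable (at x)" if "b \<in> Basis" for b x
    using V_Ck that by (simp add: numeral_3_eq_3)
  have gd: "grad V differentiable (at x)" for x
    unfolding grad_def[abs_def]
    by (intro differentiable_sum finite_Basis ballI differentiableI[OF has_derivative_scaleR_left[OF pd_has_derivative[OF d]]])
  obtain L0 where L0: "\<And>x. onorm (frechet_derivative (grad V) (at x)) \<le> L0"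
    using V by (auto simp: admissible_potential_def bdd_above_def)
  define L where "L = max L0 0 + norm (grad V 0)"
  have "norm (grad V a - grad V b) \<le> max L0 0 * norm (a - b)" for a b
  proof (rule differentiable_bound[of UNIV])
    fix x
    show "(grad V has_derivative frechet_derivative (grad V) (at x)) (at x within UNIV)"
      using gd frechet_derivative_works by blast
    show "onorm (frechet_derivative (grad V) (at x)) \<le> max L0 0" using L0[of x] by simp
  qed auto
  moreover have "max L0 0 \<le> L" by (simp add: L_def)
  ultimately have lip: "norm (grad V a - grad V b) \<le> L * norm (a - b)" for a b
    by (meson mult_right_mono norm_ge_zero order_trans)
  have L: "L \<ge> 0" by (simp add: L_def)
  have lin: "norm (grad V b) \<le> L * (1 + norm b)" for b
  proof -
    have "norm (grad V b) \<le> norm (grad V 0) + norm (grad V b - grad V 0)"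
      by (metis norm_triangle_sub)
    also have "\<dots> \<le> L + L * norm b" using lip[of b 0] by (simp add: L_def)
    finally show ?thesis by (simp add: distrib_left)
  qed
  have "\<bar>V a - V b\<bar> \<le> L * norm (a - b) * (1 + norm b + norm (a - b))" for a b
  proof -
    \<comment> \<open>A convex set containing a and b on which the linear growth of grad V gives a
      uniform bound.\<close>
    let ?S = "cball b (norm (a - b))"
    have "norm (V a - V b) \<le> (L * (1 + norm b + norm (a - b))) * norm (a - b)"
    proof (rule differentiable_bound[of ?S])
      fix x assume x: "x \<in> ?S"
      show "(V has_derivative (\<lambda>v. pd v V x)) (at x within ?S)"
        by (rule has_derivative_at_withinI[OF pd_has_derivative[OF V_differentiable]])
      have "norm x \<le> norm b + norm (a - b)"
        using x norm_triangle_ineq[of b "x - b"] by (simp add: dist_norm norm_minus_commute)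
      then have "norm (grad V x) \<le> L * (1 + norm b + norm (a - b))"
        using order_trans[OF lin[of x] mult_left_mono[OF _ L, of "1 + norm x" "1 + norm b + norm (a - b)"]]
        by simp
      then show "onorm (\<lambda>v. pd v V x) \<le> L * (1 + norm b + norm (a - b))"
        unfolding pd_eq_grad_inner[OF V_differentiable] real_norm_def
        by (intro onorm_bound) (use L in \<open>auto intro!: order_trans[OF Cauchy_Schwarz_ineq2] mult_right_mono\<close>)
    qed (auto simp: dist_norm norm_minus_commute)
    then show ?thesis by (simp add: mult_ac)
  qed
  with L lip lin that show thesis by blast
qed

abbreviation "\<Psi> \<equiv> psi V \<gamma> \<beta> l"

text \<open>The exponent of the ratio of \<psi> between the end point and the start point of a step,
  as \<open>psi_shift\<close> shows.\<close>

definition Edev :: "real \<Rightarrow> 'n phase \<Rightarrow> 'n phase \<Rightarrow> real"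
  where "Edev s p \<omega> = - (phi_ki V \<gamma> \<beta> l (shift s p \<omega>) - phi_ki V \<gamma> \<beta> l p) / 2"

definition Aodd :: "real \<Rightarrow> 'n phase \<Rightarrow> 'n phase \<Rightarrow> real"
  where "Aodd s p \<omega> = (Edev s p \<omega> - Edev s p (- \<omega>)) / 2"

definition Beven :: "real \<Rightarrow> 'n phase \<Rightarrow> 'n phase \<Rightarrow> real"
  where "Beven s p \<omega> = (Edev s p \<omega> + Edev s p (- \<omega>)) / 2"

text \<open>Minus half the derivative of \<open>phi_ki\<close> in the direction (0, \<xi>): its
  v-gradient is (\<beta> / \<gamma>) grad V + \<beta> v, which is \<beta> / \<gamma> times
  \<open>U_field\<close>.\<close>

definition e1 :: "'n phase \<Rightarrow> 'n phase \<Rightarrow> real"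
  where "e1 p \<omega> = - (\<beta> / (2 * \<gamma>)) * (U_field V \<gamma> p \<bullet> snd \<omega>)"

lemma psi_shift: "\<Psi> (shift s p \<omega>) = \<Psi> p * exp (Edev s p \<omega>)"
proof -
  have "- phi_ki V \<gamma> \<beta> l (shift s p \<omega>) / 2 = - phi_ki V \<gamma> \<beta> l p / 2 + Edev s p \<omega>"
    by (simp add: Edev_def field_simps)
  then show ?thesis by (simp only: psi_def exp_add)
qed

lemma phase_size:
  fixes p \<omega> :: "'n phase"
  assumes "p = (y, w)" "\<omega> = (\<zeta>, \<xi>)" "P = 1 + norm p + norm \<omega>"
  shows "norm y \<le> norm p" "norm w \<le> norm p" "norm \<zeta> \<le> norm \<omega>" "norm \<xi> \<le> norm \<omega>"
    "1 \<le> P" "1 + norm p \<le> P" "norm p \<le> P" "norm \<omega> \<le> P"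
proof -
  show "norm y \<le> norm p" "norm w \<le> norm p" "norm \<zeta> \<le> norm \<omega>" "norm \<xi> \<le> norm \<omega>"
    unfolding assms(1,2) by (rule norm_fst_le norm_snd_le)+
  show "1 \<le> P" "1 + norm p \<le> P" "norm p \<le> P" "norm \<omega> \<le> P"
    using norm_ge_zero[of p] norm_ge_zero[of \<omega>] unfolding assms(3) by linarith+
qed

text \<open>The positions reached from \<omega> and - \<omega> are y + a and y + a' with a, a' of
  size s^2 and a - a' = 2 s^3 \<zeta>. Differences between these two positions are O(s^3) and enter
  the odd part; differences to y are O(s^2) and suffice for the even part. Lipschitz estimates for V
  and grad V thus give both orders.\<close>

lemma Edev_expansion:
  obtains C where "C > 0"
    and "\<And>s p \<omega>. 0 < s \<Longrightarrow> s \<le> 1 \<Longrightarrow>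
      \<bar>Aodd s p \<omega> - s * e1 p \<omega>\<bar> \<le> C * s ^ 3 * (1 + norm p + norm \<omega>)\<^sup>2"
    and "\<And>s p \<omega>. 0 < s \<Longrightarrow> s \<le> 1 \<Longrightarrow>
      \<bar>Beven s p \<omega>\<bar> \<le> C * s\<^sup>2 * (1 + norm p + norm \<omega>)\<^sup>2"
    and "\<And>p \<omega>. \<bar>e1 p \<omega>\<bar> \<le> C * (1 + norm p) * norm \<omega>"
proof -
  obtain L where L: "L \<ge> 0"
    and lip: "\<And>a b. norm (grad V a - grad V b) \<le> L * norm (a - b)"
    and lin: "\<And>b. norm (grad V b) \<le> L * (1 + norm b)"
    and Vb: "\<And>a b. \<bar>V a - V b\<bar> \<le> L * norm (a - b) * (1 + norm b + norm (a - b))"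
    by (rule potential_bounds) blast
  define C where "C = 2 * l * L + \<beta> / \<gamma> * L + \<beta> / (2 * \<gamma>) * (L + \<gamma>)"
  have bg: "\<beta> / \<gamma> > 0" using beta_pos gamma_pos by simp
  have C: "C > 0"
    unfolding C_def using L l_pos bg gamma_pos beta_pos
    by (intro add_nonneg_pos) (auto intro!: mult_pos_pos add_nonneg_nonneg mult_nonneg_nonneg)
  have AB: "\<bar>Aodd s p \<omega> - s * e1 p \<omega>\<bar> \<le> C * s ^ 3 * (1 + norm p + norm \<omega>)\<^sup>2 \<and>
      \<bar>Beven s p \<omega>\<bar> \<le> (C + \<beta>) * s\<^sup>2 * (1 + norm p + norm \<omega>)\<^sup>2"
    if s: "0 < s" "s \<le> 1" for s p \<omega>
  proof -
    obtain y w \<zeta> \<xi> where p: "p = (y, w)" and \<omega>: "\<omega> = (\<zeta>, \<xi>)" by fastforce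
    define P where "P = 1 + norm p + norm \<omega>"
    note sz = phase_size[OF p \<omega> P_def]
    have P0: "P \<ge> 0" using sz by simp
    define a where "a = s\<^sup>2 *\<^sub>R w + s ^ 3 *\<^sub>R \<zeta>"
    define a' where "a' = s\<^sup>2 *\<^sub>R w - s ^ 3 *\<^sub>R \<zeta>"
    have s32: "s ^ 3 \<le> s\<^sup>2" "s\<^sup>2 \<le> 1" "s ^ 3 \<le> 1"
      using s by (auto intro: power_decreasing power_le_one)
    have "norm a \<le> s\<^sup>2 * norm w + s ^ 3 * norm \<zeta>" "norm a' \<le> s\<^sup>2 * norm w + s ^ 3 * norm \<zeta>"
      unfolding a_def a'_def
      using norm_triangle_ineq[of "s\<^sup>2 *\<^sub>R w" "s ^ 3 *\<^sub>R \<zeta>"] norm_triangle_ineq4[of "s\<^sup>2 *\<^sub>R w" "s ^ 3 *\<^sub>R \<zeta>"] s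
      by auto
    moreover have "s\<^sup>2 * norm w + s ^ 3 * norm \<zeta> \<le> s\<^sup>2 * norm p + s\<^sup>2 * norm \<omega>"
      using sz s32 s by (intro add_mono mult_mono) auto
    moreover have "s\<^sup>2 * norm p + s\<^sup>2 * norm \<omega> \<le> s\<^sup>2 * P"
      unfolding P_def distrib_left[symmetric] by (intro mult_left_mono) auto
    ultimately have a: "norm a \<le> s\<^sup>2 * P" "norm a' \<le> s\<^sup>2 * P" by linarith+
    have s2P: "s\<^sup>2 * P \<le> P" using s32(2) P0 by (simp add: mult_left_le_one_le)
    have aa: "norm (a - a') \<le> 2 * s ^ 3 * P"
    proof -
      have "a - a' = (2 * s ^ 3) *\<^sub>R \<zeta>" by (simp add: a_def a'_def scaleR_2 flip: scaleR_scaleR)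
      then have "norm (a - a') = 2 * s ^ 3 * norm \<zeta>" using s by simp
      also have "\<dots> \<le> 2 * s ^ 3 * P" using sz s by (intro mult_left_mono) auto
      finally show ?thesis .
    qed
    have aa2: "norm (a - a') \<le> 2 * P"
      using aa mult_right_mono[OF s32(3) P0] by simp
    have T1: "\<bar>V (y + a) - V (y + a')\<bar> \<le> 8 * L * s ^ 3 * P\<^sup>2"
    proof -
      have "\<bar>V (y + a) - V (y + a')\<bar> \<le> L * norm (a - a') * (1 + norm (y + a') + norm (a - a'))"
        using Vb[of "y + a" "y + a'"] by simp
      also have "\<dots> \<le> L * (2 * s ^ 3 * P) * (4 * P)"
      proof (intro mult_mono mult_left_mono)
        show "1 + norm (y + a') + norm (a - a') \<le> 4 * P"
          using aa2 a s2P sz norm_triangle_ineq[of y a'] by linarith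
      qed (use L aa s P0 in auto)
      finally show ?thesis by (simp add: power2_eq_square mult_ac)
    qed
    have V1: "\<bar>V (y + c) - V y\<bar> \<le> 2 * L * s\<^sup>2 * P\<^sup>2" if "norm c \<le> s\<^sup>2 * P" for c
    proof -
      have "\<bar>V (y + c) - V y\<bar> \<le> L * norm c * (1 + norm y + norm c)"
        using Vb[of "y + c" y] by simp
      also have "\<dots> \<le> L * (s\<^sup>2 * P) * (2 * P)"
      proof (intro mult_mono mult_left_mono)
        show "1 + norm y + norm c \<le> 2 * P" using that s2P sz by linarith
      qed (use L that P0 in auto)
      finally show ?thesis by (simp add: power2_eq_square mult_ac)
    qed
    have inner_le: "\<bar>v \<bullet> (grad V c - grad V d)\<bar> \<le> P * (L * r)"
      if "norm v \<le> P" "norm (c - d) \<le> r" for v c d r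
    proof -
      have "\<bar>v \<bullet> (grad V c - grad V d)\<bar> \<le> norm v * norm (grad V c - grad V d)"
        by (rule Cauchy_Schwarz_ineq2)
      also have "\<dots> \<le> P * (L * norm (c - d))" using that lip P0 by (intro mult_mono) auto
      also have "\<dots> \<le> P * (L * r)" using that L P0 by (intro mult_left_mono) auto
      finally show ?thesis .
    qed
    have nw: "norm w \<le> P" "norm \<xi> \<le> P" using sz by linarith+
    have T2: "\<bar>v \<bullet> (grad V (y + a) - grad V (y + a'))\<bar> \<le> 2 * L * s ^ 3 * P\<^sup>2" if "norm v \<le> P" for v
      using inner_le[of v "y + a" "y + a'" "2 * s ^ 3 * P"] aa that by (simp add: power2_eq_square mult_ac)
    have T3: "\<bar>v \<bullet> (grad V (y + a) - grad V y)\<bar> \<le> L * s\<^sup>2 * P\<^sup>2"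
      "\<bar>v \<bullet> (grad V (y + a') - grad V y)\<bar> \<le> L * s\<^sup>2 * P\<^sup>2" if "norm v \<le> P" for v
      using inner_le[of v "y + a" y "s\<^sup>2 * P"] inner_le[of v "y + a'" y "s\<^sup>2 * P"] a that
      by (simp_all add: power2_eq_square mult_ac)
    have sh: "shift s p \<omega> = (y + a, w + s *\<^sub>R \<xi>)" "shift s p (- \<omega>) = (y + a', w - s *\<^sub>R \<xi>)"
      by (simp_all add: shift_def p \<omega> a_def a'_def)
    have nsq: "(norm (w + s *\<^sub>R \<xi>))\<^sup>2 = (norm w)\<^sup>2 + 2 * s * (w \<bullet> \<xi>) + s\<^sup>2 * (norm \<xi>)\<^sup>2"
      "(norm (w - s *\<^sub>R \<xi>))\<^sup>2 = (norm w)\<^sup>2 - 2 * s * (w \<bullet> \<xi>) + s\<^sup>2 * (norm \<xi>)\<^sup>2"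
      unfolding power2_norm_eq_inner
      by (simp_all add: inner_add_left inner_add_right inner_diff_left
          inner_diff_right inner_commute[of \<xi> w] power2_eq_square algebra_simps)
    define k where "k = \<beta> / \<gamma>"
    have k0: "k > 0" using bg by (simp add: k_def)
    define X where "X = l * (V (y + a) - V (y + a'))"
    define Y where "Y = w \<bullet> (grad V (y + a) - grad V (y + a'))"
    \<comment> \<open>\<open>Z\<close> is the cost of evaluating grad V at y, as \<open>e1\<close>
      does, instead of at y + a and y + a': a factor s from the velocity noise times a difference of
      size s^2.\<close>
    define Z where "Z = s * (\<xi> \<bullet> (grad V (y + a) - grad V y)) + s * (\<xi> \<bullet> (grad V (y + a') - grad V y))"
    have phi: "phi_ki V \<gamma> \<beta> l (shift s p \<omega>) = l * V (y + a) + k * ((w + s *\<^sub>R \<xi>) \<bullet> grad V (y + a))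
        + \<beta> / 2 * ((norm w)\<^sup>2 + 2 * s * (w \<bullet> \<xi>) + s\<^sup>2 * (norm \<xi>)\<^sup>2)"
      "phi_ki V \<gamma> \<beta> l (shift s p (- \<omega>)) = l * V (y + a') + k * ((w - s *\<^sub>R \<xi>) \<bullet> grad V (y + a'))
        + \<beta> / 2 * ((norm w)\<^sup>2 - 2 * s * (w \<bullet> \<xi>) + s\<^sup>2 * (norm \<xi>)\<^sup>2)"
      "phi_ki V \<gamma> \<beta> l p = l * V y + k * (w \<bullet> grad V y) + \<beta> / 2 * (norm w)\<^sup>2"
      unfolding sh nsq[symmetric] by (simp_all only: phi_ki_def p prod.case k_def)
    have Aeq: "Aodd s p \<omega> - s * e1 p \<omega> = - (X + k * (Y + Z)) / 4"
    proof -
      have "\<beta> / (2 * \<gamma>) * (U_field V \<gamma> p \<bullet> \<xi>) = k * (\<xi> \<bullet> grad V y) / 2 + \<beta> * (w \<bullet> \<xi>) / 2"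
        using gamma_pos by (simp add: k_def U_field_def p inner_add_left inner_commute[of _ \<xi>] inner_add_right field_simps)
      then have e: "e1 p \<omega> = - (k * (\<xi> \<bullet> grad V y) / 2 + \<beta> * (w \<bullet> \<xi>) / 2)"
        by (simp add: e1_def \<omega>)
      show ?thesis
        unfolding Aodd_def Edev_def minus_minus phi e X_def Y_def Z_def k_def[symmetric]
        by (simp add: inner_diff_right inner_add_left inner_diff_left field_simps)
    qed
    define X' where "X' = l * (V (y + a) - V y) + l * (V (y + a') - V y)"
    define Y' where "Y' = w \<bullet> (grad V (y + a) - grad V y) + w \<bullet> (grad V (y + a') - grad V y)"
    define Z' where "Z' = s * (\<xi> \<bullet> (grad V (y + a) - grad V (y + a')))"
    \<comment> \<open>In the sum over \<omega> and - \<omega> the terms linear in w \<bullet> \<xi>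
      cancel, but \<beta> s^2 |\<xi>|^2 stays. It accounts for the additional \<beta> in the
      constant of the even part.\<close>
    have Beq: "Beven s p \<omega> = - (X' + k * (Y' + Z') + \<beta> * (s\<^sup>2 * (norm \<xi>)\<^sup>2)) / 4"
      unfolding Beven_def Edev_def minus_minus phi X'_def Y'_def Z'_def k_def[symmetric]
      by (simp add: inner_diff_right inner_add_left inner_diff_left field_simps)
    have sx: "\<bar>s * x\<bar> \<le> s * y" if "\<bar>x\<bar> \<le> y" for x y using that s by (simp add: abs_mult)
    have s1: "\<bar>s * x\<bar> \<le> y" if "\<bar>x\<bar> \<le> y" for x y
      using that s mult_left_le_one_le[of "\<bar>x\<bar>" s] by (simp add: abs_mult)
    have lx: "\<bar>l * x\<bar> \<le> l * y" if "\<bar>x\<bar> \<le> y" for x y using that l_pos by (simp add: abs_mult)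
    have bx: "\<bar>k * x\<bar> \<le> k * y" if "\<bar>x\<bar> \<le> y" for x y
      using that k0 by (simp add: abs_mult)
    have quarter: "d \<le> v" if "a \<le> 8 * u + 4 * t" "4 * d = a" "v = 2 * u + t" for a d u t v :: real
      using that by linarith
    have quarter': "d \<le> v" if "a \<le> 4 * u + 4 * t + r" "0 \<le> u" "0 \<le> r" "4 * d = a" "v = 2 * u + t + r"
      for a d u t v r :: real
      using that by linarith
    define K3 where "K3 = s ^ 3 * P\<^sup>2"
    define K2 where "K2 = s\<^sup>2 * P\<^sup>2"
    have K0: "K3 \<ge> 0" "K2 \<ge> 0" using s by (simp_all add: K3_def K2_def)
    have K32: "K3 \<le> K2" unfolding K3_def K2_def using s32 by (intro mult_right_mono) auto
    have X: "\<bar>X\<bar> \<le> 8 * (l * L * K3)"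
      using lx[OF T1] by (simp add: X_def K3_def mult_ac)
    have "\<bar>Y\<bar> \<le> 2 * (L * K3)" using T2[OF nw(1)] by (simp add: Y_def K3_def mult_ac)
    moreover have "\<bar>Z\<bar> \<le> 2 * (L * K3)"
      using sx[OF T3(1)[OF nw(2)]] sx[OF T3(2)[OF nw(2)]]
      by (simp add: Z_def K3_def power3_eq_cube power2_eq_square mult_ac)
    ultimately have "\<bar>Y + Z\<bar> \<le> 4 * (L * K3)" by linarith
    from bx[OF this] have "\<bar>k * (Y + Z)\<bar> \<le> 4 * (k * L * K3)"
      by (simp only: mult_ac)
    with X have "\<bar>X + k * (Y + Z)\<bar> \<le> 8 * (l * L * K3) + 4 * (k * L * K3)"
      by linarith
    moreover have "4 * \<bar>Aodd s p \<omega> - s * e1 p \<omega>\<bar> = \<bar>X + k * (Y + Z)\<bar>"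
      unfolding Aeq abs_divide abs_minus_cancel by simp
    moreover have "(2 * l * L + k * L) * K3 = 2 * (l * L * K3) + k * L * K3"
      by (simp only: distrib_right mult.assoc)
    ultimately have "\<bar>Aodd s p \<omega> - s * e1 p \<omega>\<bar> \<le> (2 * l * L + k * L) * K3"
      by (rule quarter)
    also have "\<dots> \<le> C * K3"
      using K0 L gamma_pos beta_pos by (intro mult_right_mono) (simp_all add: C_def k_def)
    finally have 1: "\<bar>Aodd s p \<omega> - s * e1 p \<omega>\<bar> \<le> C * K3" .
    have X': "\<bar>X'\<bar> \<le> 4 * (l * L * K2)"
      using lx[OF V1[OF a(1)]] lx[OF V1[OF a(2)]] by (simp add: X'_def K2_def mult_ac)
    have "\<bar>Y'\<bar> \<le> 2 * (L * K2)"
      using T3[OF nw(1)] by (simp add: Y'_def K2_def mult_ac)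
    moreover have "\<bar>Z'\<bar> \<le> 2 * (L * K2)"
      using s1[OF T2[OF nw(2)]] mult_left_mono[OF K32 L] by (simp add: Z'_def K3_def mult_ac)
    ultimately have "\<bar>Y' + Z'\<bar> \<le> 4 * (L * K2)" by linarith
    from bx[OF this] have YZ: "\<bar>k * (Y' + Z')\<bar> \<le> 4 * (k * L * K2)"
      by (simp only: mult_ac)
    have "\<beta> * (s\<^sup>2 * (norm \<xi>)\<^sup>2) \<le> \<beta> * K2"
      unfolding K2_def using nw beta_pos by (intro mult_left_mono power_mono) auto
    moreover have "0 \<le> \<beta> * (s\<^sup>2 * (norm \<xi>)\<^sup>2)" using beta_pos by simp
    ultimately have "\<bar>X' + k * (Y' + Z') + \<beta> * (s\<^sup>2 * (norm \<xi>)\<^sup>2)\<bar>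
      \<le> 4 * (l * L * K2) + 4 * (k * L * K2) + \<beta> * K2"
      using X' YZ by linarith
    moreover have "0 \<le> l * L * K2" "0 \<le> \<beta> * K2" using l_pos L K0 beta_pos by simp_all
    moreover have "4 * \<bar>Beven s p \<omega>\<bar>
        = \<bar>X' + k * (Y' + Z') + \<beta> * (s\<^sup>2 * (norm \<xi>)\<^sup>2)\<bar>"
      unfolding Beq abs_divide abs_minus_cancel by simp
    moreover have "(2 * l * L + k * L + \<beta>) * K2
        = 2 * (l * L * K2) + k * L * K2 + \<beta> * K2"
      by (simp only: distrib_right mult.assoc)
    ultimately have "\<bar>Beven s p \<omega>\<bar> \<le> (2 * l * L + k * L + \<beta>) * K2"
      by (rule quarter')
    also have "\<dots> \<le> (C + \<beta>) * K2"
      using K0 L gamma_pos beta_pos by (intro mult_right_mono) (simp_all add: C_def k_def)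
    finally show ?thesis using 1 by (simp add: K3_def K2_def P_def mult.assoc)
  qed
  have e1b: "\<bar>e1 p \<omega>\<bar> \<le> C * (1 + norm p) * norm \<omega>" for p \<omega>
  proof -
    obtain y w \<zeta> \<xi> where p: "p = (y, w)" and \<omega>: "\<omega> = (\<zeta>, \<xi>)" by fastforce
    note sz = phase_size[OF p \<omega> refl]
    have "norm (grad V y + \<gamma> *\<^sub>R w) \<le> L * (1 + norm y) + \<gamma> * norm w"
      using norm_triangle_ineq[of "grad V y" "\<gamma> *\<^sub>R w"] lin[of y] gamma_pos by simp
    also have "\<dots> \<le> L * (1 + norm p) + \<gamma> * (1 + norm p)"
      using sz L gamma_pos by (intro add_mono mult_left_mono) auto
    finally have U: "norm (U_field V \<gamma> p) \<le> (L + \<gamma>) * (1 + norm p)"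
      by (simp add: U_field_def p distrib_right)
    have "\<bar>U_field V \<gamma> p \<bullet> \<xi>\<bar> \<le> norm (U_field V \<gamma> p) * norm \<xi>" by (rule Cauchy_Schwarz_ineq2)
    also have "\<dots> \<le> (L + \<gamma>) * (1 + norm p) * norm \<omega>"
      using U sz by (intro mult_mono) (auto intro: order_trans[OF norm_ge_zero])
    finally have "\<beta> / (2 * \<gamma>) * \<bar>U_field V \<gamma> p \<bullet> \<xi>\<bar> \<le> \<beta> / (2 * \<gamma>) * ((L + \<gamma>) * (1 + norm p) * norm \<omega>)"
      using beta_pos gamma_pos by (intro mult_left_mono) auto
    then have "\<bar>e1 p \<omega>\<bar> \<le> (\<beta> / (2 * \<gamma>) * (L + \<gamma>)) * ((1 + norm p) * norm \<omega>)"
      using beta_pos gamma_pos by (simp add: e1_def \<omega> abs_mult mult_ac)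
    also have "\<dots> \<le> C * ((1 + norm p) * norm \<omega>)"
      unfolding C_def using L l_pos beta_pos gamma_pos by (intro mult_right_mono) auto
    finally show ?thesis by (simp add: mult.assoc)
  qed
  show thesis
  proof (rule that[of "C + \<beta>"])
    show "C + \<beta> > 0" using C beta_pos by simp
    fix s :: real and p \<omega> :: "'n phase" assume s: "0 < s" "s \<le> 1"
    show "\<bar>Beven s p \<omega>\<bar> \<le> (C + \<beta>) * s\<^sup>2 * (1 + norm p + norm \<omega>)\<^sup>2" using AB[OF s] by blast
    have "C * s ^ 3 * (1 + norm p + norm \<omega>)\<^sup>2 \<le> (C + \<beta>) * s ^ 3 * (1 + norm p + norm \<omega>)\<^sup>2"
      using s beta_pos by (intro mult_right_mono) auto
    then show "\<bar>Aodd s p \<omega> - s * e1 p \<omega>\<bar> \<le> (C + \<beta>) * s ^ 3 * (1 + norm p + norm \<omega>)\<^sup>2"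
      using AB[OF s, of p \<omega>] by linarith
  next
    fix p \<omega> :: "'n phase"
    have "C * (1 + norm p) * norm \<omega> \<le> (C + \<beta>) * (1 + norm p) * norm \<omega>"
      using beta_pos by (intro mult_right_mono) auto
    then show "\<bar>e1 p \<omega>\<bar> \<le> (C + \<beta>) * (1 + norm p) * norm \<omega>" using e1b[of p \<omega>] by linarith
  qed
qed

end

subsection \<open>Symmetric Taylor expansion\<close>

lemma pd_lincomb_dir_Ck:
  assumes "Ck (Suc k) f"
  shows "pd (\<alpha> *\<^sub>R a + \<beta> *\<^sub>R b) f = (\<lambda>z. \<alpha> * pd a f z + \<beta> * pd b f z)"
  using pd_lincomb_dir[OF Ck_SucD(1)[OF assms]] by blast

lemma pd_lincomb_fun_Ck:
  assumes "Ck (Suc k) f" "Ck (Suc k) g"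
  shows "pd v (\<lambda>z. \<alpha> * f z + \<beta> * g z) = (\<lambda>z. \<alpha> * pd v f z + \<beta> * pd v g z)"
  by (rule pd_lincomb_fun) (rule Ck_SucD(1)[OF assms(1)] Ck_SucD(1)[OF assms(2)])+

text \<open>The mixed derivatives are left in the order in which they arise. Later they are only
  bounded, or occur with both orders added, so no commutation is required; the same holds for the
  third-order version.\<close>

lemma pd2_lincomb:
  assumes g: "Ck (Suc (Suc k)) g"
  shows "pd (\<alpha> *\<^sub>R a + \<beta> *\<^sub>R b) (pd (\<alpha> *\<^sub>R a + \<beta> *\<^sub>R b) g)
    = (\<lambda>z. \<alpha> * (\<alpha> * pd a (pd a g) z + \<beta> * pd a (pd b g) z)
         + \<beta> * (\<alpha> * pd b (pd a g) z + \<beta> * pd b (pd b g) z))"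
proof -
  have g1: "Ck (Suc k) (pd v g)" for v by (rule Ck_pd[OF g])
  have c: "Ck (Suc k) (\<lambda>z. \<alpha> * pd a g z + \<beta> * pd b g z)" by (intro Ck_lincomb g1)
  show ?thesis
    unfolding pd_lincomb_dir_Ck[OF g] unfolding pd_lincomb_dir_Ck[OF c]
    unfolding pd_lincomb_fun_Ck[OF g1 g1] by (rule refl)
qed

lemma pd3_lincomb:
  assumes g: "Ck (Suc (Suc (Suc k))) g"
  defines "D3 u v w \<equiv> pd u (pd v (pd w g))"
  shows "pd (\<alpha> *\<^sub>R a + \<beta> *\<^sub>R b) (pd (\<alpha> *\<^sub>R a + \<beta> *\<^sub>R b) (pd (\<alpha> *\<^sub>R a + \<beta> *\<^sub>R b) g))
    = (\<lambda>z. \<alpha> * (\<alpha> * (\<alpha> * D3 a a a z + \<beta> * D3 a a b z) + \<beta> * (\<alpha> * D3 a b a z + \<beta> * D3 a b b z))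
         + \<beta> * (\<alpha> * (\<alpha> * D3 b a a z + \<beta> * D3 b a b z) + \<beta> * (\<alpha> * D3 b b a z + \<beta> * D3 b b b z)))"
proof -
  have g2: "Ck (Suc k) (pd u (pd v g))" for u v by (intro Ck_pd g)
  have c: "Ck (Suc k) (\<lambda>z. \<alpha> * pd u (pd v g) z + \<beta> * pd u' (pd v' g) z)" for u v u' v'
    by (intro Ck_lincomb g2)
  have c2: "Ck (Suc k) (\<lambda>z. \<alpha> * (\<alpha> * pd a (pd a g) z + \<beta> * pd a (pd b g) z)
         + \<beta> * (\<alpha> * pd b (pd a g) z + \<beta> * pd b (pd b g) z))"
    by (intro Ck_lincomb g2)
  show ?thesis
    unfolding pd2_lincomb[OF g] unfolding pd_lincomb_dir_Ck[OF c2] unfolding pd_lincomb_fun_Ck[OF c c]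
    unfolding pd_lincomb_fun_Ck[OF g2 g2] D3_def by (rule refl)
qed

text \<open>Intended for e the transport, k the velocity noise and i the position noise, so that the
  two points are \<open>shift\<close> at \<omega> and at - \<omega>. The direction i carries s^3, so
  it enters the even part only from order s^4 on. A cubic remainder suffices for the odd part
  because that part will be multiplied by a factor of size s.\<close>

lemma symmetric_Taylor:
  fixes g :: "'a::euclidean_space \<Rightarrow> real"
  assumes g: "Ck 4 g" and s: "0 < s" "s \<le> 1" and P: "P \<ge> 1" and Q: "Q \<ge> 0"
    and bound: "\<And>vs z. length vs \<le> 4 \<Longrightarrow> norm (z - p) \<le> s * P \<Longrightarrow>
      \<bar>foldr pd vs g z\<bar> \<le> prod_list (map norm vs) * Q"
    and vec: "norm e \<le> P" "norm k \<le> P" "norm i \<le> P" "norm (k + s\<^sup>2 *\<^sub>R i) \<le> P"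
    and d: "norm (s\<^sup>2 *\<^sub>R e + s *\<^sub>R (k + s\<^sup>2 *\<^sub>R i)) \<le> s * P"
      "norm (s\<^sup>2 *\<^sub>R e - s *\<^sub>R (k + s\<^sup>2 *\<^sub>R i)) \<le> s * P"
  defines "gp \<equiv> g (p + (s\<^sup>2 *\<^sub>R e + s *\<^sub>R (k + s\<^sup>2 *\<^sub>R i)))"
    and "gm \<equiv> g (p + (s\<^sup>2 *\<^sub>R e - s *\<^sub>R (k + s\<^sup>2 *\<^sub>R i)))"
  shows "\<bar>(gp + gm) / 2 - g p - s\<^sup>2 * (pd e g p + pd k (pd k g) p / 2)\<bar> \<le> 5 * s ^ 4 * P ^ 4 * Q"
    and "\<bar>(gp - gm) / 2 - s * pd k g p\<bar> \<le> 3 * s ^ 3 * P ^ 3 * Q"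
proof -
  let ?c = "k + s\<^sup>2 *\<^sub>R i"
  have Suc4: "4 = Suc (Suc (Suc (Suc 0)))" and Suc3: "3 = Suc (Suc (Suc 0))" by simp_all
  have g4: "Ck (Suc (Suc (Suc (Suc 0)))) g" using g unfolding Suc4 .
  have g3: "Ck (Suc (Suc (Suc 0))) g" using Ck_pred[OF g4] .
  have g2: "Ck (Suc (Suc 0)) g" using Ck_pred[OF g3] .
  have sP: "0 \<le> s * P" using s P by simp
  have line: "\<bar>(pd v ^^ m) g (p + t *\<^sub>R v)\<bar> \<le> (s * P) ^ m * Q"
    if "norm v \<le> s * P" "0 < t" "t < 1" "m \<le> 4" for v t m
  proof -
    have "norm (p + t *\<^sub>R v - p) \<le> s * P"
      using that mult_left_le_one_le[of "norm v" t] by simp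
    then have "\<bar>foldr pd (replicate m v) g (p + t *\<^sub>R v)\<bar> \<le> prod_list (map norm (replicate m v)) * Q"
      using that by (intro bound) auto
    also have "\<dots> = norm v ^ m * Q" by (simp add: prod_list_replicate)
    also have "\<dots> \<le> (s * P) ^ m * Q" using that Q by (intro mult_right_mono power_mono) auto
    finally show ?thesis by simp
  qed
  have T4: "\<bar>g (p + v) - (g p + pd v g p + pd v (pd v g) p / 2 + pd v (pd v (pd v g)) p / 6)\<bar> \<le> s ^ 4 * P ^ 4 * Q"
    if "norm v \<le> s * P" for v
  proof -
    have "\<bar>g (p + v) - (\<Sum>m<4. (pd v ^^ m) g p / fact m)\<bar> \<le> (s * P) ^ 4 * Q / fact 4"
      by (rule Taylor_line[OF g]) (auto intro: line[OF that])
    also have "\<dots> \<le> (s * P) ^ 4 * Q / 1"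
      using Q sP by (intro divide_left_mono) (auto simp: fact_numeral)
    finally show ?thesis
      by (simp add: eval_nat_numeral add.assoc mult_ac)
  qed
  have T3: "\<bar>g (p + v) - (g p + pd v g p + pd v (pd v g) p / 2)\<bar> \<le> s ^ 3 * P ^ 3 * Q"
    if "norm v \<le> s * P" for v
  proof -
    have "Ck 3 g" using g3 unfolding Suc3 .
    then have "\<bar>g (p + v) - (\<Sum>m<3. (pd v ^^ m) g p / fact m)\<bar> \<le> (s * P) ^ 3 * Q / fact 3"
      by (rule Taylor_line) (auto intro: line[OF that])
    also have "\<dots> \<le> (s * P) ^ 3 * Q / 1"
      using Q sP by (intro divide_left_mono) (auto simp: fact_numeral)
    finally show ?thesis
      by (simp add: eval_nat_numeral add.assoc mult_ac)
  qed
  have pp: "norm (p - p) \<le> s * P" using sP by simp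
  have b1: "\<bar>pd u g p\<bar> \<le> P * Q" if "norm u \<le> P" for u
    using bound[of "[u]" p, OF _ pp] mult_right_mono[OF that Q] by simp
  have b2: "\<bar>pd u (pd v g) p\<bar> \<le> P\<^sup>2 * Q" if "norm u \<le> P" "norm v \<le> P" for u v
  proof -
    have "\<bar>pd u (pd v g) p\<bar> \<le> norm u * norm v * Q"
      using bound[of "[u, v]" p, OF _ pp] by simp
    also have "\<dots> \<le> P * P * Q" using that P Q by (intro mult_mono) auto
    finally show ?thesis by (simp add: power2_eq_square)
  qed
  have b3: "\<bar>pd u (pd v (pd w g)) p\<bar> \<le> P ^ 3 * Q" if "norm u \<le> P" "norm v \<le> P" "norm w \<le> P" for u v w
  proof -
    have "\<bar>pd u (pd v (pd w g)) p\<bar> \<le> norm u * norm v * norm w * Q"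
      using bound[of "[u, v, w]" p, OF _ pp] by (simp add: mult.assoc)
    also have "\<dots> \<le> P * P * P * Q" using that P Q by (intro mult_mono) auto
    finally show ?thesis by (simp add: power3_eq_cube)
  qed
  have Pp: "P \<le> P ^ 3" "P\<^sup>2 \<le> P ^ 3" "P ^ 3 \<le> P ^ 4" "P\<^sup>2 \<le> P ^ 4"
    using P by (auto intro: power_increasing self_le_power)
  define R3 where "R3 = P ^ 3 * Q"
  define R4 where "R4 = P ^ 4 * Q"
  have R: "P * Q \<le> R3" "P\<^sup>2 * Q \<le> R3" "P\<^sup>2 * Q \<le> R4" "P ^ 3 * Q \<le> R4" "R3 \<ge> 0" "R4 \<ge> 0"
    unfolding R3_def R4_def using Pp Q P by (auto intro: mult_right_mono)
  define S2 where "S2 = s\<^sup>2"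
  have S2: "0 < S2" "S2 \<le> 1" using s by (auto simp: S2_def power_le_one)
  have scale: "\<bar>c * x\<bar> \<le> y" if "\<bar>x\<bar> \<le> y" "0 \<le> c" "c \<le> 1" for c x y :: real
    using that mult_left_le_one_le[of "\<bar>x\<bar>" c] by (simp add: abs_mult)
  have plus: "s\<^sup>2 *\<^sub>R e + s *\<^sub>R ?c = S2 *\<^sub>R e + s *\<^sub>R ?c"
    and minus: "s\<^sup>2 *\<^sub>R e - s *\<^sub>R ?c = S2 *\<^sub>R e + (- s) *\<^sub>R ?c"
    by (simp_all add: S2_def)
  define ee where "ee = pd e (pd e g) p"
  define ec where "ec = pd e (pd ?c g) p"
  define ce where "ce = pd ?c (pd e g) p"
  define cc where "cc = pd ?c (pd ?c g) p"
  define t1 where "t1 = pd e (pd e (pd e g)) p"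
  define t2 where "t2 = pd e (pd ?c (pd ?c g)) p + pd ?c (pd e (pd ?c g)) p + pd ?c (pd ?c (pd e g)) p"
  define t3 where "t3 = pd e (pd e (pd ?c g)) p + pd e (pd ?c (pd e g)) p + pd ?c (pd e (pd e g)) p"
  define t4 where "t4 = pd ?c (pd ?c (pd ?c g)) p"
  \<comment> \<open>Here r stands for s or - s, so both end points share one expansion and the
    parity of each term can be read off from the power of r.\<close>
  have D1: "pd (S2 *\<^sub>R e + r *\<^sub>R ?c) g p = S2 * pd e g p + r * pd ?c g p" for r
    by (simp only: pd_lincomb_dir_Ck[OF g4])
  have D2: "pd (S2 *\<^sub>R e + r *\<^sub>R ?c) (pd (S2 *\<^sub>R e + r *\<^sub>R ?c) g) p
      = S2 * S2 * ee + r * (S2 * (ec + ce)) + r * r * cc" for r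
    unfolding pd2_lincomb[OF g3] ee_def ec_def ce_def cc_def by (simp add: algebra_simps)
  have D3: "pd (S2 *\<^sub>R e + r *\<^sub>R ?c) (pd (S2 *\<^sub>R e + r *\<^sub>R ?c) (pd (S2 *\<^sub>R e + r *\<^sub>R ?c) g)) p
      = S2 * S2 * S2 * t1 + r * (S2 * S2 * t3) + r * r * S2 * t2 + r * r * r * t4" for r
    unfolding pd3_lincomb[OF g4] t1_def t2_def t3_def t4_def by (simp add: algebra_simps)
  have dc: "pd ?c g p = pd k g p + S2 * pd i g p"
    using pd_lincomb_dir_Ck[OF g4, of 1 k S2 i] by (simp add: S2_def)
  have kk: "cc = pd k (pd k g) p + S2 * (pd k (pd i g) p + pd i (pd k g) p) + S2 * S2 * pd i (pd i g) p"
    using pd2_lincomb[OF g3, of 1 k S2 i] unfolding cc_def by (simp add: S2_def algebra_simps)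
  define m where "m = pd k (pd i g) p + pd i (pd k g) p + S2 * pd i (pd i g) p"
  have cc: "cc = pd k (pd k g) p + S2 * m" unfolding kk m_def by (simp add: algebra_simps)
  have m: "\<bar>m\<bar> \<le> 3 * (P\<^sup>2 * Q)"
    using b2[OF vec(2,3)] b2[OF vec(3,2)] scale[OF b2[OF vec(3,3)], of S2] S2 unfolding m_def by linarith
  have S4: "S2 * S2 = s ^ 4" by (simp add: S2_def power2_eq_square eval_nat_numeral)
  have ss: "s * s = S2" by (simp add: S2_def power2_eq_square)
  define q1 where "q1 = g p + (S2 * pd e g p + s * pd ?c g p) + (S2 * S2 * ee + s * (S2 * (ec + ce)) + S2 * cc) / 2
      + (S2 * S2 * S2 * t1 + s * (S2 * S2 * t3) + S2 * S2 * t2 + S2 * s * t4) / 6"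
  define q2 where "q2 = g p + (S2 * pd e g p - s * pd ?c g p) + (S2 * S2 * ee - s * (S2 * (ec + ce)) + S2 * cc) / 2
      + (S2 * S2 * S2 * t1 - s * (S2 * S2 * t3) + S2 * S2 * t2 - S2 * s * t4) / 6"
  have gp4: "\<bar>gp - q1\<bar> \<le> s ^ 4 * R4"
    using T4[OF d(1)] unfolding plus D1 D2 D3 ss gp_def R4_def q1_def by (simp only: mult.assoc)
  have gm4: "\<bar>gm - q2\<bar> \<le> s ^ 4 * R4"
    using T4[OF d(2)] unfolding minus D1 D2 D3 minus_mult_minus ss gm_def R4_def q2_def
    by (simp add: mult.assoc)
  \<comment> \<open>Everything of order s^4 in the even part of the Taylor polynomial. It is at most
    4 \<open>R4\<close>; the Taylor remainder itself adds the fifth unit of the final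
    constant.\<close>
  define rem where "rem = ee / 2 + m / 2 + S2 * t1 / 6 + t2 / 6"
  have q12: "(q1 + q2) / 2 = g p + S2 * (pd e g p + pd k (pd k g) p / 2) + S2 * S2 * rem"
    unfolding q1_def q2_def rem_def cc by (simp add: field_simps)
  have "\<bar>ee\<bar> \<le> R4" using b2[OF vec(1,1)] R unfolding ee_def by linarith
  moreover have "\<bar>m\<bar> \<le> 3 * R4" using m R by linarith
  moreover have "\<bar>S2 * t1\<bar> \<le> R4"
    using scale[OF order_trans[OF b3[OF vec(1,1,1)] R(4)], of S2] S2 unfolding t1_def by simp
  moreover have "\<bar>t2\<bar> \<le> 3 * R4"
    using b3[OF vec(1,4,4)] b3[OF vec(4,1,4)] b3[OF vec(4,4,1)] R unfolding t2_def by linarith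
  ultimately have rem: "\<bar>rem\<bar> \<le> 4 * R4" unfolding rem_def by linarith
  have "\<bar>s ^ 4 * rem\<bar> \<le> s ^ 4 * (4 * R4)"
    using rem s by (simp add: abs_mult)
  then have rem': "\<bar>S2 * S2 * rem\<bar> \<le> 4 * (s ^ 4 * R4)" unfolding S4 by simp
  have comb: "\<bar>(u + v) / 2 - a - b\<bar> \<le> 5 * r"
    if "\<bar>u - x\<bar> \<le> r" "\<bar>v - y\<bar> \<le> r" "(x + y) / 2 = a + b + w" "\<bar>w\<bar> \<le> 4 * r" for u v x y a b w r :: real
  proof -
    have eq: "(u + v) / 2 - a - b = (u - x) / 2 + (v - y) / 2 + w" using that(3) by (simp add: field_simps)
    have "\<bar>X / 2 + Y / 2 + w\<bar> \<le> 5 * r" if "\<bar>X\<bar> \<le> r" "\<bar>Y\<bar> \<le> r" "\<bar>w\<bar> \<le> 4 * r" for X Y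
      using that by linarith
    then show ?thesis unfolding eq using that(1,2,4) by blast
  qed
  show "\<bar>(gp + gm) / 2 - g p - s\<^sup>2 * (pd e g p + pd k (pd k g) p / 2)\<bar> \<le> 5 * s ^ 4 * P ^ 4 * Q"
    using comb[OF gp4 gm4 q12 rem'] by (simp add: S2_def R4_def mult.assoc)
  define r1 where "r1 = g p + (S2 * pd e g p + s * pd ?c g p) + (S2 * S2 * ee + s * (S2 * (ec + ce)) + S2 * cc) / 2"
  define r2 where "r2 = g p + (S2 * pd e g p - s * pd ?c g p) + (S2 * S2 * ee - s * (S2 * (ec + ce)) + S2 * cc) / 2"
  have gp3: "\<bar>gp - r1\<bar> \<le> s ^ 3 * R3"
    using T3[OF d(1)] unfolding plus D1 D2 ss gp_def R3_def r1_def by (simp only: mult.assoc)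
  have gm3: "\<bar>gm - r2\<bar> \<le> s ^ 3 * R3"
    using T3[OF d(2)] unfolding minus D1 D2 minus_mult_minus ss gm_def R3_def r2_def
    by (simp add: mult.assoc)
  \<comment> \<open>The order s^3 terms of the odd part, at most 2 \<open>R3\<close>; with the
    Taylor remainder this gives the constant 3.\<close>
  define rem2 where "rem2 = pd i g p + (ec + ce) / 2"
  have r12: "(r1 - r2) / 2 = s * pd k g p + s * S2 * rem2"
    unfolding r1_def r2_def rem2_def dc by (simp add: field_simps)
  have "\<bar>pd i g p\<bar> \<le> R3" using b1[OF vec(3)] R by linarith
  moreover have "\<bar>ec\<bar> \<le> R3" "\<bar>ce\<bar> \<le> R3"
    using b2[OF vec(1,4)] b2[OF vec(4,1)] R unfolding ec_def ce_def by linarith+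
  ultimately have "\<bar>rem2\<bar> \<le> 2 * R3" unfolding rem2_def by (simp add: abs_le_iff field_simps)
  then have "\<bar>s ^ 3 * rem2\<bar> \<le> s ^ 3 * (2 * R3)"
    using s by (simp add: abs_mult)
  moreover have "s ^ 3 = s * S2" by (simp add: S2_def power2_eq_square power3_eq_cube)
  ultimately have rem2': "\<bar>s * S2 * rem2\<bar> \<le> 2 * (s ^ 3 * R3)" by simp
  have comb: "\<bar>(u - v) / 2 - a\<bar> \<le> 3 * r"
    if "\<bar>u - x\<bar> \<le> r" "\<bar>v - y\<bar> \<le> r" "(x - y) / 2 = a + w" "\<bar>w\<bar> \<le> 2 * r" for u v x y a w r :: real
  proof -
    have eq: "(u - v) / 2 - a = (u - x) / 2 - (v - y) / 2 + w" using that(3) by (simp add: field_simps)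
    have "\<bar>X / 2 - Y / 2 + w\<bar> \<le> 3 * r" if "\<bar>X\<bar> \<le> r" "\<bar>Y\<bar> \<le> r" "\<bar>w\<bar> \<le> 2 * r" for X Y
      using that by linarith
    then show ?thesis unfolding eq using that(1,2,4) by blast
  qed
  show "\<bar>(gp - gm) / 2 - s * pd k g p\<bar> \<le> 3 * s ^ 3 * P ^ 3 * Q"
    using comb[OF gp3 gm3 r12 rem2'] by (simp add: R3_def mult.assoc)
qed

subsection \<open>The generator in terms of directional derivatives\<close>

lemma pd_slice_fst:
  fixes f :: "'a::euclidean_space \<times> 'b::euclidean_space \<Rightarrow> real"
  assumes "f differentiable (at (x, v))"
  shows "pd b (\<lambda>x'. f (x', v)) x = pd (b, 0) f (x, v)"
proof (rule pd_eqI)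
  have "((\<lambda>x'. (x', v)) has_derivative (\<lambda>b. (b, 0))) (at x)"
    by (auto intro!: derivative_eq_intros)
  from diff_chain_at[OF this pd_has_derivative[OF assms]]
  show "((\<lambda>x'. f (x', v)) has_derivative (\<lambda>b. pd (b, 0) f (x, v))) (at x)" by (simp add: o_def)
qed

lemma pd_slice_snd:
  fixes f :: "'a::euclidean_space \<times> 'b::euclidean_space \<Rightarrow> real"
  assumes "f differentiable (at (x, v))"
  shows "pd b (\<lambda>v'. f (x, v')) v = pd (0, b) f (x, v)"
proof (rule pd_eqI)
  have "((\<lambda>v'. (x, v')) has_derivative (\<lambda>b. (0, b))) (at v)"
    by (auto intro!: derivative_eq_intros)
  from diff_chain_at[OF this pd_has_derivative[OF assms]]
  show "((\<lambda>v'. f (x, v')) has_derivative (\<lambda>b. pd (0, b) f (x, v))) (at v)" by (simp add: o_def)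
qed

lemma slice_differentiable:
  fixes f :: "'a::euclidean_space \<times> 'b::euclidean_space \<Rightarrow> real"
  assumes "f differentiable (at (x, v))"
  shows "(\<lambda>x'. f (x', v)) differentiable (at x)" "(\<lambda>v'. f (x, v')) differentiable (at v)"
proof -
  have "((\<lambda>x'. (x', v)) has_derivative (\<lambda>b. (b, 0))) (at x)"
    by (auto intro!: derivative_eq_intros)
  from diff_chain_at[OF this pd_has_derivative[OF assms]]
  show "(\<lambda>x'. f (x', v)) differentiable (at x)" unfolding o_def by (rule differentiableI)
  have "((\<lambda>v'. (x, v')) has_derivative (\<lambda>b. (0, b))) (at v)"
    by (auto intro!: derivative_eq_intros)
  from diff_chain_at[OF this pd_has_derivative[OF assms]]
  show "(\<lambda>v'. f (x, v')) differentiable (at v)" unfolding o_def by (rule differentiableI)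
qed

text \<open>The definition differentiates partial functions of x or of v. Rewriting them as
  derivatives along (b, 0) and (0, b) in phase space matches the form of the Taylor
  coefficients.\<close>

lemma L_op_eq:
  fixes g :: "'n::finite phase \<Rightarrow> real"
  assumes g: "Ck (Suc (Suc k)) g"
  shows "L_op V \<gamma> \<beta> g p = pd (snd p, 0) g p
    + \<gamma> / \<beta> * (\<Sum>i\<in>Basis. pd (0, i) (pd (0, i) g) p) - pd (0, U_field V \<gamma> p) g p"
proof -
  obtain x v where p: "p = (x, v)" by fastforce
  have d: "g differentiable (at z)" for z using g by (rule Ck_SucD)
  have d1: "pd u g differentiable (at z)" for u z using Ck_pd[OF g] by (rule Ck_SucD)
  have gx: "u \<bullet> grad_x g (x, v) = pd (u, 0) g (x, v)" for u
    unfolding grad_x_def prod.case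
    using pd_eq_grad_inner[OF slice_differentiable(1)[OF d]] pd_slice_fst[OF d] by (metis inner_commute)
  have gv: "u \<bullet> grad_v g (x, v) = pd (0, u) g (x, v)" for u
    unfolding grad_v_def prod.case
    using pd_eq_grad_inner[OF slice_differentiable(2)[OF d]] pd_slice_snd[OF d] by (metis inner_commute)
  have "pd b (\<lambda>v'. g (x, v')) = (\<lambda>v'. pd (0, b) g (x, v'))" for b
    using pd_slice_snd[OF d] by blast
  then have "laplacian_v g (x, v) = (\<Sum>i\<in>Basis. pd (0, i) (pd (0, i) g) (x, v))"
    unfolding laplacian_v_def prod.case laplacian_def
    by (intro sum.cong refl) (simp add: pd_slice_snd[OF d1])
  then show ?thesis
    by (simp add: L_op_def D0_op_def p gx gv)
qed

subsection \<open>The local error\<close>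

text \<open>With u = c s P^2 one has |A| \<le> 2 u, |B| \<le> u and M \<le> 3 u. The constant 30 =
  27 + 2 + 1 comes from the odd part: M^3 \<le> 27 u^3, the product |A| |B|, and the given error of
  A. The coarser bounds reuse it.\<close>

lemma symmetrized_exp_estimate:
  fixes A B e c s P M :: real
  assumes c: "c \<ge> 1" and s: "0 < s" "s \<le> 1" and P: "P \<ge> 1"
    and e: "\<bar>e\<bar> \<le> c * P\<^sup>2" and A: "\<bar>A - s * e\<bar> \<le> c * s ^ 3 * P\<^sup>2" and B: "\<bar>B\<bar> \<le> c * s\<^sup>2 * P\<^sup>2"
    and M: "M = \<bar>A\<bar> + \<bar>B\<bar>"
  defines "Rs \<equiv> (exp (B + A) + exp (B - A)) / 2" and "Ra \<equiv> (exp (B + A) - exp (B - A)) / 2"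
  shows "\<bar>Rs - 1\<bar> \<le> 30 * c ^ 3 * s\<^sup>2 * P ^ 4 * exp M"
    and "\<bar>Ra - s * e\<bar> \<le> 30 * c ^ 3 * s ^ 3 * P ^ 6 * exp M"
    and "\<bar>Rs\<bar> \<le> exp M"
    and "\<bar>Ra\<bar> \<le> 30 * c ^ 3 * s * P\<^sup>2 * exp M"
proof -
  note b = exp_symmetrized_bounds[OF M, folded Rs_def Ra_def]
  have s3: "s ^ 3 \<le> s" "s\<^sup>2 \<le> s" "s ^ 3 \<le> s\<^sup>2"
    using s power_decreasing[of 1 3 s] power_decreasing[of 1 2 s] power_decreasing[of 2 3 s] by auto
  define u where "u = c * s * P\<^sup>2"
  have u0: "u \<ge> 0" using c s by (simp add: u_def)
  have "\<bar>s * e\<bar> \<le> s * (c * P\<^sup>2)" using e s by (simp add: abs_mult)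
  moreover have "c * s ^ 3 * P\<^sup>2 \<le> u" "c * s\<^sup>2 * P\<^sup>2 \<le> u"
    unfolding u_def using c s3 by (auto intro!: mult_right_mono)
  ultimately have Ab: "\<bar>A\<bar> \<le> 2 * u" and Bb: "\<bar>B\<bar> \<le> u"
    using A B by (auto simp: u_def mult_ac)
  have M0: "0 \<le> M" "M \<le> 3 * u" using Ab Bb M by auto
  have X: "exp M \<ge> 1" using M0 by simp
  have c3: "c \<le> c ^ 3" "c\<^sup>2 \<le> c ^ 3" "1 \<le> c ^ 3"
    using c power_increasing[of 1 3 c] power_increasing[of 2 3 c] by auto
  have P46: "P\<^sup>2 \<le> P ^ 4" "P\<^sup>2 \<le> P ^ 6" "P ^ 4 \<le> P ^ 6"
    using P by (auto intro: power_increasing)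
  show "\<bar>Rs\<bar> \<le> exp M" by (rule b(3))
  have "M * exp M \<le> (3 * u) * exp M" using M0 by simp
  also have "\<dots> = 3 * (c * (s * P\<^sup>2 * exp M))" by (simp add: u_def)
  also have "\<dots> \<le> 30 * (c ^ 3 * (s * P\<^sup>2 * exp M))"
    using c3 s c by (intro mult_mono) auto
  finally show "\<bar>Ra\<bar> \<le> 30 * c ^ 3 * s * P\<^sup>2 * exp M" using b(4) unfolding mult.assoc by (rule order_trans[rotated])
  have "M\<^sup>2 * exp M \<le> (3 * u)\<^sup>2 * exp M" using M0 by (intro mult_right_mono power_mono) auto
  also have "\<dots> = 9 * (c\<^sup>2 * (s\<^sup>2 * P ^ 4 * exp M))"
    by (simp add: u_def power_mult_distrib flip: power_mult)
  also have "\<dots> \<le> 9 * (c ^ 3 * (s\<^sup>2 * P ^ 4 * exp M))"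
    using c3 by (intro mult_left_mono mult_right_mono) auto
  finally have 1: "M\<^sup>2 * exp M \<le> 9 * (c ^ 3 * (s\<^sup>2 * P ^ 4 * exp M))" .
  have "c * s\<^sup>2 * P\<^sup>2 * 1 \<le> c ^ 3 * s\<^sup>2 * P ^ 4 * exp M"
    using c3 c P46 X by (intro mult_mono) auto
  then have 2: "\<bar>B\<bar> \<le> c ^ 3 * (s\<^sup>2 * P ^ 4 * exp M)" using B by (simp add: mult.assoc)
  have "0 \<le> c ^ 3 * (s\<^sup>2 * P ^ 4 * exp M)" using c by simp
  with 1 2 b(1) have "\<bar>Rs - 1\<bar> \<le> 30 * (c ^ 3 * (s\<^sup>2 * P ^ 4 * exp M))" by linarith
  then show "\<bar>Rs - 1\<bar> \<le> 30 * c ^ 3 * s\<^sup>2 * P ^ 4 * exp M" by (simp add: mult.assoc)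
  have "M ^ 3 * exp M \<le> (3 * u) ^ 3 * exp M" using M0 by (intro mult_right_mono power_mono) auto
  also have "\<dots> = 27 * (c ^ 3 * (s ^ 3 * P ^ 6 * exp M))"
    by (simp add: u_def power_mult_distrib flip: power_mult)
  finally have 3: "M ^ 3 * exp M \<le> 27 * (c ^ 3 * (s ^ 3 * P ^ 6 * exp M))" .
  have "\<bar>A\<bar> * \<bar>B\<bar> \<le> (2 * u) * (c * s\<^sup>2 * P\<^sup>2)" using Ab B u0 by (intro mult_mono) auto
  also have "\<dots> = 2 * (c\<^sup>2 * s ^ 3 * P ^ 4 * 1)"
    by (simp add: u_def eval_nat_numeral mult_ac)
  also have "\<dots> \<le> 2 * (c ^ 3 * s ^ 3 * P ^ 6 * exp M)"
    using c3 c P46 X s by (intro mult_left_mono mult_mono) auto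
  finally have 4: "\<bar>A\<bar> * \<bar>B\<bar> \<le> 2 * (c ^ 3 * (s ^ 3 * P ^ 6 * exp M))" by (simp add: mult.assoc)
  have "c * s ^ 3 * P\<^sup>2 * 1 \<le> c ^ 3 * s ^ 3 * P ^ 6 * exp M"
    using c3 c P46 X s by (intro mult_mono) auto
  then have 5: "\<bar>A - s * e\<bar> \<le> c ^ 3 * (s ^ 3 * P ^ 6 * exp M)" using A by (simp add: mult.assoc)
  from 3 4 5 b(2) have "\<bar>Ra - s * e\<bar> \<le> 30 * (c ^ 3 * (s ^ 3 * P ^ 6 * exp M))" by linarith
  then show "\<bar>Ra - s * e\<bar> \<le> 30 * c ^ 3 * s ^ 3 * P ^ 6 * exp M" by (simp add: mult.assoc)
qed

text \<open>Every error term is one of the two factors at order \<open>s\<^sup>4\<close> once the leading terms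
  \<open>s\<^sup>2 g\<^sub>2\<close>, \<open>s g\<^sub>1\<close>, \<open>1\<close> and \<open>s e\<close> have been split off.\<close>

lemma product_expansion:
  fixes Gs Ga Rs Ra g1 g2 e Lg s P Q X C K :: real
  assumes s: "0 < s" "s \<le> 1" and P: "P \<ge> 1" and Q: "Q \<ge> 0" and X: "X \<ge> 0" and C: "C \<ge> 0" and K: "K \<ge> 0"
    and Gs: "\<bar>Gs - s\<^sup>2 * g2\<bar> \<le> 5 * s ^ 4 * P ^ 4 * Q" and Ga: "\<bar>Ga - s * g1\<bar> \<le> 3 * s ^ 3 * P ^ 3 * Q"
    and g1: "\<bar>g1\<bar> \<le> P * Q" and g2: "\<bar>g2\<bar> \<le> 2 * P\<^sup>2 * Q" and Lg: "\<bar>Lg\<bar> \<le> K * P\<^sup>2 * Q"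
    and Rs1: "\<bar>Rs - 1\<bar> \<le> C * s\<^sup>2 * P ^ 4 * X" and Ra1: "\<bar>Ra - s * e\<bar> \<le> C * s ^ 3 * P ^ 6 * X"
    and Rs: "\<bar>Rs\<bar> \<le> X" and Ra: "\<bar>Ra\<bar> \<le> C * s * P\<^sup>2 * X"
  shows "\<bar>(Gs - s\<^sup>2 * Lg) * Rs + Ga * Ra - s\<^sup>2 * (g2 - Lg + g1 * e)\<bar>
    \<le> ((2 + K) * C + 5 + 4 * C) * s ^ 4 * P ^ 10 * Q * X"
proof -
  define Y where "Y = s ^ 4 * P ^ 10 * Q * X"
  have eq: "(Gs - s\<^sup>2 * Lg) * Rs + Ga * Ra - s\<^sup>2 * (g2 - Lg + g1 * e)
    = s\<^sup>2 * (g2 - Lg) * (Rs - 1) + (Gs - s\<^sup>2 * g2) * Rs + s * g1 * (Ra - s * e) + (Ga - s * g1) * Ra"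
    by (simp add: algebra_simps power2_eq_square)
  \<comment> \<open>The four error terms carry the powers 6, 4, 7 and 5 of P. All are raised to
    P^10, the power that \<open>power10_le_exp\<close> absorbs.\<close>
  have pw: "P ^ 6 \<le> P ^ 10" "P ^ 7 \<le> P ^ 10" "P ^ 4 \<le> P ^ 10" "P ^ 5 \<le> P ^ 10"
    using P by (auto intro: power_increasing)
  have absorb: "a * (s ^ 4 * P ^ k * Q * X) \<le> a * Y" if "a \<ge> 0" "P ^ k \<le> P ^ 10" for a k
    unfolding Y_def using that s Q X by (intro mult_left_mono mult_right_mono) auto
  have "\<bar>g2 - Lg\<bar> \<le> (2 + K) * P\<^sup>2 * Q" using g2 Lg by (simp add: distrib_right)
  then have "\<bar>s\<^sup>2 * (g2 - Lg) * (Rs - 1)\<bar> \<le> (s\<^sup>2 * ((2 + K) * P\<^sup>2 * Q)) * (C * s\<^sup>2 * P ^ 4 * X)"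
    unfolding abs_mult using Rs1 K Q s by (intro mult_mono) auto
  also have "\<dots> = (2 + K) * C * (s ^ 4 * P ^ 6 * Q * X)"
    by (simp add: eval_nat_numeral mult_ac)
  also have "\<dots> \<le> (2 + K) * C * Y" using K C pw by (intro absorb) auto
  finally have 1: "\<bar>s\<^sup>2 * (g2 - Lg) * (Rs - 1)\<bar> \<le> (2 + K) * C * Y" .
  have "\<bar>(Gs - s\<^sup>2 * g2) * Rs\<bar> \<le> (5 * s ^ 4 * P ^ 4 * Q) * X"
    unfolding abs_mult using Gs Rs Q s P by (intro mult_mono) auto
  also have "\<dots> = 5 * (s ^ 4 * P ^ 4 * Q * X)" by simp
  also have "\<dots> \<le> 5 * Y" using pw by (intro absorb) auto
  finally have 2: "\<bar>(Gs - s\<^sup>2 * g2) * Rs\<bar> \<le> 5 * Y" .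
  have "\<bar>s * g1 * (Ra - s * e)\<bar> \<le> (s * (P * Q)) * (C * s ^ 3 * P ^ 6 * X)"
    unfolding abs_mult using g1 Ra1 Q s P by (intro mult_mono) auto
  also have "\<dots> = C * (s ^ 4 * P ^ 7 * Q * X)" by (simp add: eval_nat_numeral mult_ac)
  also have "\<dots> \<le> C * Y" using C pw by (intro absorb) auto
  finally have 3: "\<bar>s * g1 * (Ra - s * e)\<bar> \<le> C * Y" .
  have "\<bar>(Ga - s * g1) * Ra\<bar> \<le> (3 * s ^ 3 * P ^ 3 * Q) * (C * s * P\<^sup>2 * X)"
    unfolding abs_mult using Ga Ra Q s P by (intro mult_mono) auto
  also have "\<dots> = (3 * C) * (s ^ 4 * P ^ 5 * Q * X)" by (simp add: eval_nat_numeral mult_ac)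
  also have "\<dots> \<le> (3 * C) * Y" using C pw by (intro absorb) auto
  finally have 4: "\<bar>(Ga - s * g1) * Ra\<bar> \<le> 3 * (C * Y)" by simp
  have "\<bar>(Gs - s\<^sup>2 * Lg) * Rs + Ga * Ra - s\<^sup>2 * (g2 - Lg + g1 * e)\<bar>
      \<le> (2 + K) * C * Y + 5 * Y + 4 * (C * Y)"
    unfolding eq using 1 2 3 4 by linarith
  also have "\<dots> = ((2 + K) * C + 5 + 4 * C) * Y" by (simp add: distrib_right)
  finally show ?thesis by (simp add: Y_def mult.assoc)
qed

section \<open>Absorbing Gaussian and polynomial factors into the weights\<close>

lemma gauss_weight_eq: "gauss_weight \<theta> z = exp (\<theta> * (1 + (norm z)\<^sup>2))"
  by (cases z) (simp add: gauss_weight_def norm_Pair add.assoc)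

lemma big_weight_0: "big_weight \<theta> \<theta>' 0 z = (gauss_weight \<theta> z)\<^sup>2 * gauss_weight \<theta>' z"
  by (cases z) (simp add: big_weight_def)

text \<open>Moving the weight from the end point back to the start point costs a square, by |z|^2
  \<le> 2 |p|^2 + 2 r^2. This is the origin of the squared factor in
  \<open>big_weight\<close>.\<close>

lemma gauss_weight_near:
  assumes "\<theta> \<ge> 0" "norm (z - p) \<le> r"
  shows "gauss_weight \<theta> z \<le> (gauss_weight \<theta> p)\<^sup>2 * exp (2 * \<theta> * r\<^sup>2)"
proof -
  have "norm z \<le> norm p + r" using assms norm_triangle_sub[of z p] by linarith
  then have "(norm z)\<^sup>2 \<le> (norm p + r)\<^sup>2" by (rule power_mono) simp
  also have "\<dots> \<le> 2 * (norm p)\<^sup>2 + 2 * r\<^sup>2"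
    using zero_le_power2[of "norm p - r"] by (simp add: power2_eq_square algebra_simps)
  finally have "\<theta> * (1 + (norm z)\<^sup>2) \<le> \<theta> * (1 + (2 * (norm p)\<^sup>2 + 2 * r\<^sup>2))"
    using assms(1) by (intro mult_left_mono) auto
  also have "\<dots> \<le> 2 * (\<theta> * (1 + (norm p)\<^sup>2)) + 2 * \<theta> * r\<^sup>2"
    using assms(1) by (simp add: algebra_simps)
  finally have "exp (\<theta> * (1 + (norm z)\<^sup>2)) \<le> exp (2 * (\<theta> * (1 + (norm p)\<^sup>2)) + 2 * \<theta> * r\<^sup>2)" by simp
  also have "\<dots> = (exp (\<theta> * (1 + (norm p)\<^sup>2)))\<^sup>2 * exp (2 * \<theta> * r\<^sup>2)"
    by (simp only: exp_add exp_double)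
  finally show ?thesis unfolding gauss_weight_eq .
qed

text \<open>The inequality y \<le> exp y at y = a x^2 / 5, raised to the fifth power.\<close>

lemma power10_le_exp:
  fixes x :: real
  assumes "a > 0"
  shows "x ^ 10 \<le> (5 / a) ^ 5 * exp (a * x\<^sup>2)"
proof -
  have "a * x\<^sup>2 / 5 \<le> exp (a * x\<^sup>2 / 5)" using exp_ge_add_one_self[of "a * x\<^sup>2 / 5"] by linarith
  then have "(a * x\<^sup>2 / 5) ^ 5 \<le> exp (a * x\<^sup>2 / 5) ^ 5"
    using assms by (intro power_mono) auto
  also have "\<dots> = exp (a * x\<^sup>2)" by (simp flip: exp_of_nat_mult)
  finally have "(5 / a) ^ 5 * (a * x\<^sup>2 / 5) ^ 5 \<le> (5 / a) ^ 5 * exp (a * x\<^sup>2)"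
    using assms by (intro mult_left_mono) auto
  moreover have "(5 / a) ^ 5 * (a * x\<^sup>2 / 5) ^ 5 = x ^ 10"
    unfolding power_mult_distrib[symmetric] using assms by (simp flip: power_mult)
  ultimately show ?thesis by simp
qed

lemma square_add_le: "(a + b)\<^sup>2 \<le> 2 * a\<^sup>2 + 2 * (b\<^sup>2 :: real)"
  using zero_le_power2[of "a - b"] by (simp add: power2_eq_square algebra_simps)

lemma norm_shift_diff:
  fixes p \<omega> :: "'n::finite phase"
  assumes s: "0 < s" "s \<le> 1"
  shows "norm (shift s p \<omega> - p) \<le> s * (1 + norm p + norm \<omega>)"
proof -
  obtain y w \<zeta> \<xi> where p: "p = (y, w)" and \<omega>: "\<omega> = (\<zeta>, \<xi>)" by fastforce
  have eq: "shift s p \<omega> - p = s\<^sup>2 *\<^sub>R (w, 0) + s *\<^sub>R (s\<^sup>2 *\<^sub>R \<zeta>, \<xi>)"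
    by (simp add: shift_def p \<omega> power2_eq_square power3_eq_cube)
  have "norm (s\<^sup>2 *\<^sub>R \<zeta>) \<le> norm \<zeta>" using s by (simp add: power_le_one mult_left_le_one_le)
  then have "norm (s\<^sup>2 *\<^sub>R \<zeta>, \<xi>) \<le> norm \<omega>"
    unfolding norm_Pair \<omega> by (intro real_sqrt_le_mono add_mono power_mono) auto
  moreover have "norm (w, 0 :: real^'n) \<le> norm p" using norm_snd_le[of w y] by (simp add: norm_Pair p)
  moreover have "s\<^sup>2 \<le> s" using s by (simp add: power2_eq_square mult_left_le_one_le)
  ultimately have "s\<^sup>2 * norm (w, 0 :: real^'n) + s * norm (s\<^sup>2 *\<^sub>R \<zeta>, \<xi>) \<le> s * norm p + s * norm \<omega>"
    using s by (intro add_mono mult_mono) auto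
  moreover have "norm (shift s p \<omega> - p) \<le> s\<^sup>2 * norm (w, 0 :: real^'n) + s * norm (s\<^sup>2 *\<^sub>R \<zeta>, \<xi>)"
    unfolding eq using norm_triangle_ineq[of "s\<^sup>2 *\<^sub>R (w, 0 :: real^'n)" "s *\<^sub>R (s\<^sup>2 *\<^sub>R \<zeta>, \<xi>)"] s
    by (simp only: norm_scaleR abs_of_pos zero_less_power)
  moreover have "s * norm p + s * norm \<omega> \<le> s * (1 + norm p + norm \<omega>)"
    using s by (simp add: distrib_left)
  ultimately show ?thesis by linarith
qed

context kinetic
begin

text \<open>Even in \<omega>, so that one quantity dominates the exponents of both points of a
  symmetrised pair.\<close>

definition Mdev :: "real \<Rightarrow> 'n phase \<Rightarrow> 'n phase \<Rightarrow> real"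
  where "Mdev s p \<omega> = \<bar>Aodd s p \<omega>\<bar> + \<bar>Beven s p \<omega>\<bar>"

lemma Edev_eq: "Edev s p \<omega> = Beven s p \<omega> + Aodd s p \<omega>" "Edev s p (- \<omega>) = Beven s p \<omega> - Aodd s p \<omega>"
  by (simp_all add: Aodd_def Beven_def field_simps)

lemma abs_Edev_le: "\<bar>Edev s p \<omega>\<bar> \<le> Mdev s p \<omega>"
  unfolding Edev_eq Mdev_def by linarith

text \<open>The exponent grows quadratically in p and \<omega> but carries at least one factor s, so
  any Gaussian rate \<epsilon> is reached by taking s small, uniformly in p and \<omega>.\<close>

lemma Mdev_small:
  assumes \<epsilon>: "\<epsilon> > 0"
  obtains s0 where "0 < s0" "s0 \<le> 1"
    "\<And>s p \<omega>. 0 < s \<Longrightarrow> s \<le> s0 \<Longrightarrow> Mdev s p \<omega> \<le> \<epsilon> * (1 + norm p)\<^sup>2 + \<epsilon> * (norm \<omega>)\<^sup>2"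
proof -
  obtain C where C: "C > 0"
    and A: "\<And>s p \<omega>. 0 < s \<Longrightarrow> s \<le> 1 \<Longrightarrow>
      \<bar>Aodd s p \<omega> - s * e1 p \<omega>\<bar> \<le> C * s ^ 3 * (1 + norm p + norm \<omega>)\<^sup>2"
    and B: "\<And>s p \<omega>. 0 < s \<Longrightarrow> s \<le> 1 \<Longrightarrow>
      \<bar>Beven s p \<omega>\<bar> \<le> C * s\<^sup>2 * (1 + norm p + norm \<omega>)\<^sup>2"
    and e: "\<And>p \<omega>. \<bar>e1 p \<omega>\<bar> \<le> C * (1 + norm p) * norm \<omega>"
    by (rule Edev_expansion) blast
  \<comment> \<open>The 5 is 1 + 2 + 2, from the leading odd term, its remainder and the even part;
    the two latter double because (n + q)^2 \<le> 2 (n^2 + q^2).\<close>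
  define s0 where "s0 = min 1 (\<epsilon> / (5 * C))"
  have s0: "0 < s0" "s0 \<le> 1" "5 * C * s0 \<le> \<epsilon>"
    using \<epsilon> C by (auto simp: s0_def min_def field_simps)
  show thesis
  proof (rule that[OF s0(1,2)])
    fix s :: real and p \<omega> :: "'n phase" assume s: "0 < s" "s \<le> s0"
    define n where "n = 1 + norm p"
    define q where "q = norm \<omega>"
    define S where "S = n\<^sup>2 + q\<^sup>2"
    have s1: "s \<le> 1" using s s0 by simp
    have s3: "s ^ 3 \<le> s" "s\<^sup>2 \<le> s"
      using s s1 power_decreasing[of 1 3 s] power_decreasing[of 1 2 s] by auto
    have nq: "0 \<le> n * q" by (simp add: n_def q_def)
    then have "n * q \<le> S" using sum_squares_bound[of n q] unfolding S_def mult.assoc by linarith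
    then have "C * (n * q) \<le> C * S" using C by simp
    moreover have "\<bar>e1 p \<omega>\<bar> \<le> C * (n * q)" using e[of p \<omega>] by (simp only: n_def q_def mult.assoc)
    ultimately have "\<bar>e1 p \<omega>\<bar> \<le> C * S" by linarith
    then have "s * \<bar>e1 p \<omega>\<bar> \<le> s * (C * S)" using s by simp
    then have 1: "\<bar>s * e1 p \<omega>\<bar> \<le> C * s * S" using s by (simp only: abs_mult abs_of_pos mult_ac)
    have sq: "(1 + norm p + norm \<omega>)\<^sup>2 \<le> 2 * S"
      using square_add_le[of n q] unfolding S_def by (simp add: n_def q_def)
    have S0: "S \<ge> 0" by (simp add: S_def)
    have "C * s ^ 3 * (1 + norm p + norm \<omega>)\<^sup>2 \<le> C * s * (2 * S)"
      using s3 C s S0 by (intro mult_mono sq mult_left_mono) auto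
    then have 2: "\<bar>Aodd s p \<omega> - s * e1 p \<omega>\<bar> \<le> 2 * (C * s * S)" using A[OF s(1) s1, of p \<omega>] by linarith
    have "C * s\<^sup>2 * (1 + norm p + norm \<omega>)\<^sup>2 \<le> C * s * (2 * S)"
      using s3 C s S0 by (intro mult_mono sq mult_left_mono) auto
    then have 3: "\<bar>Beven s p \<omega>\<bar> \<le> 2 * (C * s * S)" using B[OF s(1) s1, of p \<omega>] by linarith
    have "Mdev s p \<omega> \<le> 5 * (C * s * S)" using 1 2 3 unfolding Mdev_def by linarith
    also have "\<dots> = (5 * C * s) * S" by simp
    also have "\<dots> \<le> \<epsilon> * S"
    proof (rule mult_right_mono)
      have "5 * C * s \<le> 5 * C * s0" using s C by simp
      then show "5 * C * s \<le> \<epsilon>" using s0 by linarith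
    qed (rule S0)
    finally show "Mdev s p \<omega> \<le> \<epsilon> * (1 + norm p)\<^sup>2 + \<epsilon> * (norm \<omega>)\<^sup>2"
      by (simp add: S_def n_def q_def distrib_left)
  qed
qed

text \<open>The pointwise form of the local error: after symmetrisation only s^2 times an explicit
  coefficient remains up to O(s^4), and that coefficient integrates to zero by
  \<open>leading_term_integral\<close>. The bound keeps the polynomial, the displaced weight and the
  exponential of the ratio as separate factors, each absorbed on its own later.\<close>

lemma symmetrized_integrand_bound:
  obtains C where "C > 0"
    and "\<And>s p \<omega> g N \<theta>. 0 < s \<Longrightarrow> s \<le> 1 \<Longrightarrow> N \<ge> 0 \<Longrightarrow> \<theta> \<ge> 0 \<Longrightarrow> Ck 4 g \<Longrightarrow>
      Ck_wnorm 4 (gauss_weight \<theta>) g \<le> ennreal N \<Longrightarrow>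
      \<bar>((g (shift s p \<omega>) - g p - s\<^sup>2 * L_op V \<gamma> \<beta> g p) * exp (Edev s p \<omega>)
         + (g (shift s p (- \<omega>)) - g p - s\<^sup>2 * L_op V \<gamma> \<beta> g p) * exp (Edev s p (- \<omega>))) / 2
       - s\<^sup>2 * (pd (snd p, 0) g p + pd (0, snd \<omega>) (pd (0, snd \<omega>) g) p / 2 - L_op V \<gamma> \<beta> g p
          + pd (0, snd \<omega>) g p * e1 p \<omega>)\<bar>
      \<le> C * s ^ 4 * (1 + norm p + norm \<omega>) ^ 10
          * (N * (gauss_weight \<theta> p)\<^sup>2 * exp (2 * \<theta> * (s * (1 + norm p + norm \<omega>))\<^sup>2)) * exp (Mdev s p \<omega>)"
proof -
  obtain C0 where C0: "C0 > 0"
    and A: "\<And>s p \<omega>. 0 < s \<Longrightarrow> s \<le> 1 \<Longrightarrow>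
      \<bar>Aodd s p \<omega> - s * e1 p \<omega>\<bar> \<le> C0 * s ^ 3 * (1 + norm p + norm \<omega>)\<^sup>2"
    and B: "\<And>s p \<omega>. 0 < s \<Longrightarrow> s \<le> 1 \<Longrightarrow>
      \<bar>Beven s p \<omega>\<bar> \<le> C0 * s\<^sup>2 * (1 + norm p + norm \<omega>)\<^sup>2"
    and e: "\<And>p \<omega>. \<bar>e1 p \<omega>\<bar> \<le> C0 * (1 + norm p) * norm \<omega>"
    by (rule Edev_expansion) blast
  obtain L where L: "L \<ge> 0" and lin: "\<And>b. norm (grad V b) \<le> L * (1 + norm b)"
    by (rule potential_bounds) blast
  \<comment> \<open>A constant of at least 1 allows lower powers to be replaced by c^3.\<close>
  define c where "c = max C0 1"
  have c: "c \<ge> 1" "C0 \<le> c" by (auto simp: c_def)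
  define D where "D = real DIM('n phase)"
  have D1: "D \<ge> 1"
    unfolding D_def using DIM_positive[where 'a = "'n phase"] by linarith
  \<comment> \<open>The three summands bound transport, diffusion and drift in L g by multiples of
    P^2 Q.\<close>
  define K where "K = 1 + \<gamma> / \<beta> * DIM(real^'n) + (L + \<gamma>)"
  have K: "K \<ge> 0" using L gamma_pos beta_pos by (simp add: K_def)
  define C where "C = ((2 + K) * (30 * c ^ 3) + 5 + 4 * (30 * c ^ 3)) * D ^ 4"
  have C: "C > 0"
    unfolding C_def using K c D1 by (intro mult_pos_pos add_nonneg_pos add_pos_nonneg) auto
  show thesis
  proof (rule that[OF C])
    fix s :: real and p \<omega> :: "'n phase" and g :: "'n phase \<Rightarrow> real" and N \<theta> :: real
    assume s: "0 < s" "s \<le> 1" and N: "N \<ge> 0" and \<theta>: "\<theta> \<ge> 0" and g: "Ck 4 g"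
      and gN: "Ck_wnorm 4 (gauss_weight \<theta>) g \<le> ennreal N"
    obtain y w \<zeta> \<xi> where p: "p = (y, w)" and \<omega>: "\<omega> = (\<zeta>, \<xi>)" by fastforce
    define P where "P = 1 + norm p + norm \<omega>"
    note sz = phase_size[OF p \<omega> P_def]
    define W where "W = N * (gauss_weight \<theta> p)\<^sup>2 * exp (2 * \<theta> * (s * P)\<^sup>2)"
    \<comment> \<open>D^4 dominates the dimension factor of the directional derivative bound for
      every order up to four.\<close>
    define Q where "Q = D ^ 4 * W"
    have W0: "W \<ge> 0" using N by (simp add: W_def)
    have Q: "Q \<ge> 0" using W0 D1 by (simp add: Q_def)
    have bound: "\<bar>foldr pd vs g z\<bar> \<le> prod_list (map norm vs) * Q"
      if vs: "length vs \<le> 4" and z: "norm (z - p) \<le> s * P" for vs :: "'n phase list" and z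
    proof -
      have pl: "0 \<le> prod_list (map norm vs)" by (induction vs) auto
      have "\<bar>foldr pd vs g z\<bar> \<le> D ^ length vs * prod_list (map norm vs) * (N * gauss_weight \<theta> z)"
        unfolding D_def by (rule Ck_weighted_derivative_bound[OF g gN _ N vs]) (simp add: gauss_weight_eq)
      also have "\<dots> \<le> D ^ 4 * prod_list (map norm vs) * W"
      proof (intro mult_mono)
        show "D ^ length vs \<le> D ^ 4" using D1 vs by (rule power_increasing[rotated])
        show "N * gauss_weight \<theta> z \<le> W"
          using mult_left_mono[OF gauss_weight_near[OF \<theta> z] N] by (simp only: W_def mult.assoc)
      qed (use D1 N pl in \<open>auto simp: gauss_weight_eq\<close>)
      finally show ?thesis by (simp add: Q_def mult_ac)
    qed
    have shp: "shift s p \<omega> = p + (s\<^sup>2 *\<^sub>R (w, 0) + s *\<^sub>R ((0, \<xi>) + s\<^sup>2 *\<^sub>R (\<zeta>, 0)))"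
      and shm: "shift s p (- \<omega>) = p + (s\<^sup>2 *\<^sub>R (w, 0) - s *\<^sub>R ((0, \<xi>) + s\<^sup>2 *\<^sub>R (\<zeta>, 0)))"
      by (simp_all add: shift_def p \<omega> power2_eq_square power3_eq_cube)
    have dp: "norm (s\<^sup>2 *\<^sub>R (w, 0 :: real^'n) + s *\<^sub>R ((0, \<xi>) + s\<^sup>2 *\<^sub>R (\<zeta>, 0))) \<le> s * P"
      using norm_shift_diff[OF s, of p \<omega>] unfolding shp P_def by simp
    have dm: "norm (s\<^sup>2 *\<^sub>R (w, 0 :: real^'n) - s *\<^sub>R ((0, \<xi>) + s\<^sup>2 *\<^sub>R (\<zeta>, 0))) \<le> s * P"
      using norm_shift_diff[OF s, of p "- \<omega>"] unfolding shm P_def by simp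
    have vec: "norm (w, 0 :: real^'n) \<le> P" "norm (0 :: real^'n, \<xi>) \<le> P" "norm (\<zeta>, 0 :: real^'n) \<le> P"
      using sz by (simp_all add: norm_Pair)
    have "norm (s\<^sup>2 *\<^sub>R \<zeta>) \<le> norm \<zeta>" using s by (simp add: power_le_one mult_left_le_one_le)
    then have "norm (s\<^sup>2 *\<^sub>R \<zeta>, \<xi>) \<le> norm \<omega>"
      unfolding norm_Pair \<omega> by (intro real_sqrt_le_mono add_mono power_mono) auto
    then have vec4: "norm ((0 :: real^'n, \<xi>) + s\<^sup>2 *\<^sub>R (\<zeta>, 0)) \<le> P" using sz by simp
    have T: "\<bar>(g (shift s p \<omega>) + g (shift s p (- \<omega>))) / 2 - g p
        - s\<^sup>2 * (pd (w, 0) g p + pd (0, \<xi>) (pd (0, \<xi>) g) p / 2)\<bar> \<le> 5 * s ^ 4 * P ^ 4 * Q"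
      "\<bar>(g (shift s p \<omega>) - g (shift s p (- \<omega>))) / 2 - s * pd (0, \<xi>) g p\<bar> \<le> 3 * s ^ 3 * P ^ 3 * Q"
      unfolding shp shm
      by (rule symmetric_Taylor[OF g s sz(5) Q _ vec vec4 dp dm], rule bound, assumption+)+
    define Gs where "Gs = (g (shift s p \<omega>) + g (shift s p (- \<omega>))) / 2 - g p"
    define Ga where "Ga = (g (shift s p \<omega>) - g (shift s p (- \<omega>))) / 2"
    define Rs where "Rs = (exp (Edev s p \<omega>) + exp (Edev s p (- \<omega>))) / 2"
    define Ra where "Ra = (exp (Edev s p \<omega>) - exp (Edev s p (- \<omega>))) / 2"
    define g1 where "g1 = pd (0, \<xi>) g p"
    define g2 where "g2 = pd (w, 0) g p + pd (0, \<xi>) (pd (0, \<xi>) g) p / 2"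
    define Lg where "Lg = L_op V \<gamma> \<beta> g p"
    have sP: "norm (p - p) \<le> s * P" using s sz by simp
    have b1: "\<bar>pd u g p\<bar> \<le> norm u * Q" for u
      using bound[of "[u]" p, OF _ sP] by simp
    have b2: "\<bar>pd u (pd v g) p\<bar> \<le> norm u * norm v * Q" for u v
      using bound[of "[u, v]" p, OF _ sP] by simp
    have PP: "P \<le> P\<^sup>2" using sz by (simp add: power2_eq_square)
    have g1: "\<bar>g1\<bar> \<le> P * Q"
      using b1[of "(0, \<xi>)"] mult_right_mono[OF vec(2) Q] unfolding g1_def by linarith
    have PQ: "P * Q \<le> P\<^sup>2 * Q" using PP Q by (rule mult_right_mono)
    have "\<bar>pd (w, 0) g p\<bar> \<le> P\<^sup>2 * Q"
      using b1[of "(w, 0)"] mult_right_mono[OF vec(1) Q] PQ by linarith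
    note gw = this
    have "norm (0 :: real^'n, \<xi>) * norm (0 :: real^'n, \<xi>) * Q \<le> P * P * Q"
      using vec(2) Q sz by (intro mult_right_mono mult_mono) auto
    then have "\<bar>pd (0, \<xi>) (pd (0, \<xi>) g) p\<bar> \<le> P\<^sup>2 * Q"
      using b2[of "(0, \<xi>)" "(0, \<xi>)"] by (simp add: power2_eq_square)
    with gw have "\<bar>g2\<bar> \<le> P\<^sup>2 * Q + P\<^sup>2 * Q" unfolding g2_def by linarith
    then have g2: "\<bar>g2\<bar> \<le> 2 * P\<^sup>2 * Q" by (simp add: mult_ac)
    have Lg: "\<bar>Lg\<bar> \<le> K * P\<^sup>2 * Q"
    proof -
      have "Ck (Suc (Suc 2)) g" using g by simp
      note Leq = L_op_eq[OF this, of V \<gamma> \<beta> p]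
      have "norm (grad V y + \<gamma> *\<^sub>R w) \<le> L * (1 + norm y) + \<gamma> * norm w"
        using norm_triangle_ineq[of "grad V y" "\<gamma> *\<^sub>R w"] lin[of y] gamma_pos by simp
      also have "\<dots> \<le> L * P + \<gamma> * P"
        using sz L gamma_pos by (intro add_mono mult_left_mono) auto
      finally have "norm (U_field V \<gamma> p) \<le> (L + \<gamma>) * P"
        by (simp add: U_field_def p distrib_right)
      then have "norm (0 :: real^'n, U_field V \<gamma> p) * Q \<le> (L + \<gamma>) * P * Q"
        using Q by (intro mult_right_mono) (auto simp: norm_Pair)
      also have "\<dots> \<le> (L + \<gamma>) * (P\<^sup>2 * Q)"
        using mult_left_mono[OF PQ, of "L + \<gamma>"] L gamma_pos by (simp add: mult.assoc)
      finally have 1: "\<bar>pd (0, U_field V \<gamma> p) g p\<bar> \<le> (L + \<gamma>) * (P\<^sup>2 * Q)"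
        using b1[of "(0, U_field V \<gamma> p)"] by linarith
      have "\<bar>\<Sum>i\<in>(Basis :: (real^'n) set). pd (0, i) (pd (0, i) g) p\<bar> \<le> (\<Sum>i\<in>(Basis :: (real^'n) set). P\<^sup>2 * Q)"
      proof (rule order_trans[OF sum_abs sum_mono])
        fix i :: "real^'n" assume "i \<in> Basis"
        then have "norm (0 :: real^'n, i) = 1" by (simp add: norm_Pair)
        then have "\<bar>pd (0, i) (pd (0, i) g) p\<bar> \<le> Q" using b2[of "(0, i)" "(0, i)"] by simp
        also have "\<dots> \<le> P\<^sup>2 * Q" using Q sz(5) mult_right_mono[of 1 "P\<^sup>2" Q] one_le_power[of P 2] by simp
        finally show "\<bar>pd (0, i) (pd (0, i) g) p\<bar> \<le> P\<^sup>2 * Q" .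
      qed
      then have "\<gamma> / \<beta> * \<bar>\<Sum>i\<in>(Basis :: (real^'n) set). pd (0, i) (pd (0, i) g) p\<bar>
          \<le> \<gamma> / \<beta> * (DIM(real^'n) * (P\<^sup>2 * Q))"
        using gamma_pos beta_pos by (intro mult_left_mono) auto
      then have 2: "\<bar>\<gamma> / \<beta> * (\<Sum>i\<in>(Basis :: (real^'n) set). pd (0, i) (pd (0, i) g) p)\<bar>
          \<le> \<gamma> / \<beta> * DIM(real^'n) * (P\<^sup>2 * Q)"
        using gamma_pos beta_pos by (simp only: abs_mult abs_of_pos divide_pos_pos mult.assoc)
      have three: "\<bar>a + b - c\<bar> \<le> a' + b' + c'" if "\<bar>a\<bar> \<le> a'" "\<bar>b\<bar> \<le> b'" "\<bar>c\<bar> \<le> c'"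
        for a b c a' b' c' :: real
        using that by linarith
      have gw': "\<bar>pd (snd p, 0) g p\<bar> \<le> P\<^sup>2 * Q" using gw by (simp only: p snd_conv)
      have "\<bar>Lg\<bar> \<le> P\<^sup>2 * Q + \<gamma> / \<beta> * DIM(real^'n) * (P\<^sup>2 * Q) + (L + \<gamma>) * (P\<^sup>2 * Q)"
        unfolding Lg_def Leq by (rule three[OF gw' 2 1])
      also have "\<dots> = K * (P\<^sup>2 * Q)" by (simp only: K_def distrib_right mult_1)
      finally show ?thesis by (simp add: mult.assoc)
    qed
    have ecP: "\<bar>e1 p \<omega>\<bar> \<le> c * P\<^sup>2"
    proof -
      have "\<bar>e1 p \<omega>\<bar> \<le> C0 * (1 + norm p) * norm \<omega>" by (rule e)
      also have "\<dots> \<le> c * P * P" using c sz C0 by (intro mult_mono) auto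
      finally show ?thesis by (simp add: power2_eq_square)
    qed
    have Ac: "\<bar>Aodd s p \<omega> - s * e1 p \<omega>\<bar> \<le> c * s ^ 3 * P\<^sup>2"
      by (rule order_trans[OF A[OF s, of p \<omega>, folded P_def]]) (use c s in \<open>intro mult_right_mono, auto\<close>)
    have Bc: "\<bar>Beven s p \<omega>\<bar> \<le> c * s\<^sup>2 * P\<^sup>2"
      by (rule order_trans[OF B[OF s, of p \<omega>, folded P_def]]) (use c s in \<open>intro mult_right_mono, auto\<close>)
    note R = symmetrized_exp_estimate[OF c(1) s sz(5) ecP Ac Bc Mdev_def, folded Edev_eq, folded Rs_def Ra_def]
    have main: "\<bar>(Gs - s\<^sup>2 * Lg) * Rs + Ga * Ra - s\<^sup>2 * (g2 - Lg + g1 * e1 p \<omega>)\<bar>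
      \<le> ((2 + K) * (30 * c ^ 3) + 5 + 4 * (30 * c ^ 3)) * s ^ 4 * P ^ 10 * Q * exp (Mdev s p \<omega>)"
    proof (rule product_expansion[OF s sz(5) Q _ _ K _ _ g1 g2 Lg R])
      show "\<bar>Gs - s\<^sup>2 * g2\<bar> \<le> 5 * s ^ 4 * P ^ 4 * Q" using T(1) by (simp only: Gs_def g2_def)
      show "\<bar>Ga - s * g1\<bar> \<le> 3 * s ^ 3 * P ^ 3 * Q" using T(2) by (simp only: Ga_def g1_def)
    qed (use c in auto)
    \<comment> \<open>The average of a product over a symmetric pair is the product of the even
      parts plus the product of the odd parts. The subtracted s^2 L g is the same at both points, so
      it changes only the even factor.\<close>
    have eq: "((g (shift s p \<omega>) - g p - s\<^sup>2 * Lg) * exp (Edev s p \<omega>)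
         + (g (shift s p (- \<omega>)) - g p - s\<^sup>2 * Lg) * exp (Edev s p (- \<omega>))) / 2
       = (Gs - s\<^sup>2 * Lg) * Rs + Ga * Ra"
      unfolding Gs_def Ga_def Rs_def Ra_def by (simp add: field_simps)
    have "((2 + K) * (30 * c ^ 3) + 5 + 4 * (30 * c ^ 3)) * s ^ 4 * P ^ 10 * Q * exp (Mdev s p \<omega>)
      = C * s ^ 4 * P ^ 10 * W * exp (Mdev s p \<omega>)"
      unfolding C_def Q_def by (simp only: mult_ac)
    then show "\<bar>((g (shift s p \<omega>) - g p - s\<^sup>2 * L_op V \<gamma> \<beta> g p) * exp (Edev s p \<omega>)
         + (g (shift s p (- \<omega>)) - g p - s\<^sup>2 * L_op V \<gamma> \<beta> g p) * exp (Edev s p (- \<omega>))) / 2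
       - s\<^sup>2 * (pd (snd p, 0) g p + pd (0, snd \<omega>) (pd (0, snd \<omega>) g) p / 2 - L_op V \<gamma> \<beta> g p
          + pd (0, snd \<omega>) g p * e1 p \<omega>)\<bar>
      \<le> C * s ^ 4 * (1 + norm p + norm \<omega>) ^ 10
          * (N * (gauss_weight \<theta> p)\<^sup>2 * exp (2 * \<theta> * (s * (1 + norm p + norm \<omega>))\<^sup>2)) * exp (Mdev s p \<omega>)"
      using main unfolding eq[symmetric] unfolding Lg_def g2_def g1_def W_def P_def[symmetric]
      by (simp only: p \<omega> snd_conv)
  qed
qed

end

section \<open>Cancellation of the coefficient of s^2\<close>

lemma pd_sum_dir:
  assumes "f differentiable (at z)" "finite I"
  shows "pd (\<Sum>i\<in>I. c i *\<^sub>R b i) f z = (\<Sum>i\<in>I. c i * pd (b i) f z)"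
proof -
  have lin: "linear (\<lambda>v. pd v f z)"
    using pd_has_derivative[OF assms(1)] has_derivative_bounded_linear bounded_linear.linear by blast
  show ?thesis
    using linear_sum[OF lin, of "\<lambda>i. c i *\<^sub>R b i" I] by (simp add: linear_cmul[OF lin])
qed

lemma pd_sum_fun:
  assumes "\<And>i. i \<in> I \<Longrightarrow> f i differentiable (at z)"
  shows "pd v (\<lambda>z. \<Sum>i\<in>I. c i * f i z) z = (\<Sum>i\<in>I. c i * pd v (f i) z)"
  by (rule pd_eqI) (intro has_derivative_sum has_derivative_mult_right pd_has_derivative assms)

lemma snd_direction_expand:
  fixes \<xi> :: "'b::euclidean_space"
  shows "(0 :: 'a::euclidean_space, \<xi>) = (\<Sum>i\<in>Basis. (\<xi> \<bullet> i) *\<^sub>R (0, i))"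
  by (simp add: prod_eq_iff fst_sum snd_sum euclidean_representation)

context kinetic
begin

text \<open>With covariance 2 \<gamma> / \<beta>, the second derivative term gives \<gamma> /
  \<beta> times the v-Laplacian, and the product with \<open>e1\<close> gives - (\<beta> / (2
  \<gamma>)) (2 \<gamma> / \<beta>) U \<bullet> grad_v g. Together with the transport term this is L
  g, which is subtracted.\<close>

lemma leading_term_integral:
  fixes g :: "'n phase \<Rightarrow> real" and p
  assumes g: "Ck (Suc (Suc k)) g"
  defines "F \<omega> \<equiv> pd (snd p, 0) g p + pd (0, snd \<omega>) (pd (0, snd \<omega>) g) p / 2 - L_op V \<gamma> \<beta> g p
    + pd (0, snd \<omega>) g p * e1 p \<omega>"
  shows "integrable lborel (\<lambda>\<omega>. Gam \<gamma> \<beta> \<omega> * F \<omega>)" and "(\<integral>\<omega>. Gam \<gamma> \<beta> \<omega> * F \<omega> \<partial>lborel) = 0"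
proof -
  let ?B = "Basis :: (real^'n) set"
  have d: "g differentiable (at z)" for z using g by (rule Ck_SucD)
  have d1: "pd u g differentiable (at z)" for u z using Ck_pd[OF g] by (rule Ck_SucD)
  define U where "U = U_field V \<gamma> p"
  define H where "H i j = pd (0, i) (pd (0, j) g) p" for i j :: "real^'n"
  define D where "D i = pd (0, i) g p" for i :: "real^'n"
  have D: "pd (0, \<xi>) g z = (\<Sum>i\<in>?B. (\<xi> \<bullet> i) * pd (0, i) g z)" for \<xi> :: "real^'n" and z
    unfolding snd_direction_expand[of \<xi>] by (rule pd_sum_dir[OF d finite_Basis])
  have "pd (0, \<xi>) g = (\<lambda>z. \<Sum>i\<in>?B. (\<xi> \<bullet> i) * pd (0, i) g z)" for \<xi> :: "real^'n"
    using D by blast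
  then have "pd (0, \<xi>) (pd (0, \<xi>) g) p = pd (0, \<xi>) (\<lambda>z. \<Sum>j\<in>?B. (\<xi> \<bullet> j) * pd (0, j) g z) p" for \<xi> :: "real^'n"
    by (rule arg_cong)
  also have "pd (0, \<xi>) (\<lambda>z. \<Sum>j\<in>?B. (\<xi> \<bullet> j) * pd (0, j) g z) p = (\<Sum>j\<in>?B. (\<xi> \<bullet> j) * pd (0, \<xi>) (pd (0, j) g) p)" for \<xi>
    by (rule pd_sum_fun) (rule d1)
  also have "(\<Sum>j\<in>?B. (\<xi> \<bullet> j) * pd (0, \<xi>) (pd (0, j) g) p)
      = (\<Sum>j\<in>?B. (\<xi> \<bullet> j) * (\<Sum>i\<in>?B. (\<xi> \<bullet> i) * H i j))" for \<xi>
    unfolding snd_direction_expand[of \<xi>] H_def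
    by (intro sum.cong refl arg_cong2[where f = times] pd_sum_dir[OF d1 finite_Basis])
  also have "(\<Sum>j\<in>?B. (\<xi> \<bullet> j) * (\<Sum>i\<in>?B. (\<xi> \<bullet> i) * H i j)) = (\<Sum>i\<in>?B. \<Sum>j\<in>?B. (\<xi> \<bullet> i) * (\<xi> \<bullet> j) * H i j)" for \<xi>
    by (subst sum.swap) (simp add: sum_distrib_left mult_ac)
  finally have H: "pd (0, \<xi>) (pd (0, \<xi>) g) p = (\<Sum>i\<in>?B. \<Sum>j\<in>?B. (\<xi> \<bullet> i) * (\<xi> \<bullet> j) * H i j)" for \<xi> .
  have e: "e1 p \<omega> = (\<Sum>j\<in>?B. - (\<beta> / (2 * \<gamma>)) * ((U \<bullet> j) * (snd \<omega> \<bullet> j)))" for \<omega>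
    unfolding e1_def U_def by (subst euclidean_inner) (simp only: sum_distrib_left)
  have De: "pd (0, snd \<omega>) g p * e1 p \<omega>
      = (\<Sum>i\<in>?B. \<Sum>j\<in>?B. (snd \<omega> \<bullet> i) * (snd \<omega> \<bullet> j) * (- (\<beta> / (2 * \<gamma>)) * D i * (U \<bullet> j)))" for \<omega>
    unfolding D[of "snd \<omega>" p] e sum_product D_def by (intro sum.cong refl) (simp only: mult_ac)
  define a where "a i j = H i j / 2 - \<beta> / (2 * \<gamma>) * D i * (U \<bullet> j)" for i j
  define c where "c = pd (snd p, 0) g p - L_op V \<gamma> \<beta> g p"
  have sum2: "(\<Sum>i\<in>?B. \<Sum>j\<in>?B. X i j * Y i j) / 2 + (\<Sum>i\<in>?B. \<Sum>j\<in>?B. X i j * (- b * Z i * T j))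
     = (\<Sum>i\<in>?B. \<Sum>j\<in>?B. X i j * (Y i j / 2 - b * Z i * T j))" for X Y :: "real^'n \<Rightarrow> real^'n \<Rightarrow> real" and b Z T
    by (simp add: sum_divide_distrib right_diff_distrib sum_subtractf sum_negf)
  have "pd (0, snd \<omega>) (pd (0, snd \<omega>) g) p / 2 + pd (0, snd \<omega>) g p * e1 p \<omega>
      = (\<Sum>i\<in>?B. \<Sum>j\<in>?B. (snd \<omega> \<bullet> i) * (snd \<omega> \<bullet> j) * a i j)" for \<omega>
    unfolding H De a_def by (rule sum2)
  moreover have "F \<omega> = (pd (0, snd \<omega>) (pd (0, snd \<omega>) g) p / 2 + pd (0, snd \<omega>) g p * e1 p \<omega>) + c" for \<omega>
    unfolding F_def c_def by simp
  ultimately have F: "F \<omega> = (\<Sum>i\<in>?B. \<Sum>j\<in>?B. (snd \<omega> \<bullet> i) * (snd \<omega> \<bullet> j) * a i j) + c" for \<omega> by simp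
  note quad = integral_Gam_quadratic[OF gamma_pos beta_pos, of a c]
  show "integrable lborel (\<lambda>\<omega>. Gam \<gamma> \<beta> \<omega> * F \<omega>)" unfolding F by (rule quad(1))
  have UD: "pd (0, U) g p = (\<Sum>i\<in>?B. D i * (U \<bullet> i))" unfolding D[of U p] D_def by (simp only: mult.commute)
  have "(\<Sum>i\<in>?B. a i i) = (\<Sum>i\<in>?B. H i i) / 2 - \<beta> / (2 * \<gamma>) * (\<Sum>i\<in>?B. D i * (U \<bullet> i))"
    unfolding a_def by (simp add: sum_subtractf sum_divide_distrib sum_distrib_left mult.assoc)
  then have "2 * \<gamma> / \<beta> * (\<Sum>i\<in>?B. a i i) = \<gamma> / \<beta> * (\<Sum>i\<in>?B. H i i) - pd (0, U) g p"
    unfolding UD using gamma_pos beta_pos by (simp add: field_simps)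
  moreover have "c = pd (0, U) g p - \<gamma> / \<beta> * (\<Sum>i\<in>?B. H i i)"
    unfolding c_def L_op_eq[OF g] H_def U_def by simp
  ultimately have "2 * \<gamma> / \<beta> * (\<Sum>i\<in>?B. a i i) + c = 0" by simp
  then show "(\<integral>\<omega>. Gam \<gamma> \<beta> \<omega> * F \<omega> \<partial>lborel) = 0" unfolding F quad(2) by simp
qed

section \<open>Measurability, and the local error relative to the normaliser\<close>

lemma psi_measurable [measurable]: "\<Psi> \<in> borel_measurable borel"
proof -
  have "continuous_on UNIV V" using V_Ck by (rule Ck_continuous)
  then have c1: "continuous_on UNIV (\<lambda>z :: 'n phase. V (fst z))"
    by (rule continuous_on_compose2) (auto intro!: continuous_intros)
  have "continuous_on UNIV (grad V)"
    using continuous_on_grad[of 2 V] V_Ck by simp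
  then have c2: "continuous_on UNIV (\<lambda>z :: 'n phase. grad V (fst z))"
    by (rule continuous_on_compose2) (auto intro!: continuous_intros)
  have "continuous_on UNIV (\<lambda>z. exp (- (l * V (fst z) + \<beta> / \<gamma> * (snd z \<bullet> grad V (fst z)) + \<beta> / 2 * (norm (snd z))\<^sup>2) / 2))"
    using c1 c2 by (intro continuous_intros) auto
  moreover have "\<Psi> = (\<lambda>z. exp (- (l * V (fst z) + \<beta> / \<gamma> * (snd z \<bullet> grad V (fst z)) + \<beta> / 2 * (norm (snd z))\<^sup>2) / 2))"
    by (rule ext) (simp add: psi_def phi_ki_def case_prod_beta')
  ultimately show ?thesis by (metis borel_measurable_continuous_onI)
qed

lemma psi_pos: "\<Psi> z > 0"
  by (simp add: psi_def)

lemma exp_Edev_measurable [measurable]: "(\<lambda>\<omega>. exp (Edev s p \<omega>)) \<in> borel_measurable borel"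
proof -
  have "exp (Edev s p \<omega>) = \<Psi> (shift s p \<omega>) / \<Psi> p" for \<omega>
    using psi_shift psi_pos[of p] by (simp add: field_simps)
  then show ?thesis by simp
qed

lemma integral_Gam_le:
  fixes F :: "'n phase \<Rightarrow> real"
  assumes a: "a < \<beta> / (6 * \<gamma>)" and F[measurable]: "F \<in> borel_measurable borel"
    and le: "\<And>\<omega>. \<bar>F \<omega>\<bar> \<le> K * exp (a * (norm \<omega>)\<^sup>2)"
  shows "\<bar>\<integral>\<omega>. Gam \<gamma> \<beta> \<omega> * F \<omega> \<partial>lborel\<bar> \<le> K * (\<integral>\<omega>. Gam \<gamma> \<beta> (\<omega> :: 'n phase) * exp (a * (norm \<omega>)\<^sup>2) \<partial>lborel)"
proof -
  have "norm (\<integral>\<omega>. Gam \<gamma> \<beta> \<omega> * F \<omega> \<partial>lborel) \<le> (\<integral>\<omega>. K * (Gam \<gamma> \<beta> (\<omega> :: 'n phase) * exp (a * (norm \<omega>)\<^sup>2)) \<partial>lborel)"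
  proof (rule order_trans[OF integral_norm_bound integral_mono[OF integrable_norm]])
    show "integrable lborel (\<lambda>\<omega>. Gam \<gamma> \<beta> \<omega> * F \<omega>)"
      by (rule integrable_Gam_bound[OF gamma_pos beta_pos a F le])
    show "integrable lborel (\<lambda>\<omega>::'n phase. K * (Gam \<gamma> \<beta> \<omega> * exp (a * (norm \<omega>)\<^sup>2)))"
      by (intro integrable_mult_right integrable_Gam_exp[OF gamma_pos beta_pos a])
    fix \<omega> :: "'n phase"
    have "norm (Gam \<gamma> \<beta> \<omega> * F \<omega>) = Gam \<gamma> \<beta> \<omega> * \<bar>F \<omega>\<bar>"
      using Gam_pos[OF gamma_pos beta_pos, of \<omega>] by (simp add: abs_mult)
    also have "\<dots> \<le> Gam \<gamma> \<beta> \<omega> * (K * exp (a * (norm \<omega>)\<^sup>2))"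
      by (intro mult_left_mono le less_imp_le Gam_pos gamma_pos beta_pos)
    finally show "norm (Gam \<gamma> \<beta> \<omega> * F \<omega>) \<le> K * (Gam \<gamma> \<beta> \<omega> * exp (a * (norm \<omega>)\<^sup>2))" by (simp add: mult_ac)
  qed
  then show ?thesis by (simp only: real_norm_def integral_mult_right_zero)
qed

text \<open>The exponents are chosen so that all Gaussian factors in the initial point produced by
  the estimates are absorbed by the factor \<open>gauss_weight \<theta>'\<close> of the large weight.\<close>

lemma local_error:
  assumes \<theta>: "0 < \<theta>" and \<theta>': "0 < \<theta>'"
  obtains h0 C where "0 < h0" "C > 0"
    and "\<And>h p. 0 < h \<Longrightarrow> h \<le> h0 \<Longrightarrow>
      integrable lborel (\<lambda>z. G_kernel \<gamma> \<beta> h z p * \<Psi> z) \<and> 0 < G_op \<gamma> \<beta> h \<Psi> p"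
    and "\<And>h p g N. 0 < h \<Longrightarrow> h \<le> h0 \<Longrightarrow> N \<ge> 0 \<Longrightarrow> g \<in> borel_measurable borel \<Longrightarrow>
      (\<And>z. \<bar>g z\<bar> \<le> N * gauss_weight \<theta> z) \<Longrightarrow>
      integrable lborel (\<lambda>z. G_kernel \<gamma> \<beta> h z p * (g z * \<Psi> z)) \<and>
      \<bar>G_op \<gamma> \<beta> h (\<lambda>z. g z * \<Psi> z) p\<bar> \<le> C * N * big_weight \<theta> \<theta>' 0 p * G_op \<gamma> \<beta> h \<Psi> p"
    and "\<And>h p g N. 0 < h \<Longrightarrow> h \<le> h0 \<Longrightarrow> N \<ge> 0 \<Longrightarrow> Ck 4 g \<Longrightarrow>
      Ck_wnorm 4 (gauss_weight \<theta>) g \<le> ennreal N \<Longrightarrow>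
      \<bar>G_op \<gamma> \<beta> h (\<lambda>z. g z * \<Psi> z) p - (g p + h * L_op V \<gamma> \<beta> g p) * G_op \<gamma> \<beta> h \<Psi> p\<bar>
        \<le> C * h\<^sup>2 * N * big_weight \<theta> \<theta>' 0 p * G_op \<gamma> \<beta> h \<Psi> p"
proof -
  define k0 where "k0 = \<beta> / (6 * \<gamma>)"
  have k0: "k0 > 0" using gamma_pos beta_pos by (simp add: k0_def)
  \<comment> \<open>The budget: in \<omega> the estimates reach rate 4 \<epsilon>, integrable
    against \<open>Gam\<close> because 8 \<epsilon> \<le> \<open>k0\<close>. In p they reach 4
    \<epsilon>, and division by the normaliser adds one more; the 10 comes from 5 \<epsilon> (1 +
    |p|)^2 \<le> 10 \<epsilon> (1 + |p|^2).\<close>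
  define \<epsilon> where "\<epsilon> = min (\<theta>' / 10) (k0 / 8)"
  have \<epsilon>: "\<epsilon> > 0" "10 * \<epsilon> \<le> \<theta>'" "8 * \<epsilon> \<le> k0" using \<theta>' k0 by (auto simp: \<epsilon>_def)
  obtain s1 where s1: "0 < s1" "s1 \<le> 1"
    and Msmall: "\<And>s p \<omega>. 0 < s \<Longrightarrow> s \<le> s1 \<Longrightarrow> Mdev s p \<omega> \<le> \<epsilon> * (1 + norm p)\<^sup>2 + \<epsilon> * (norm \<omega>)\<^sup>2"
    using Mdev_small[OF \<epsilon>(1)] by blast
  \<comment> \<open>The second entry limits the Gaussian factor of the displaced weight to one unit
    of \<epsilon>, using s^2 \<le> \<open>s0\<close>.\<close>
  define s0 where "s0 = min s1 (\<epsilon> / (4 * \<theta>))"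
  have s0: "0 < s0" "s0 \<le> s1" "4 * \<theta> * s0 \<le> \<epsilon>"
    using s1 \<epsilon>(1) \<theta> by (auto simp: s0_def min_def field_simps)
  obtain C1 where C1: "C1 > 0"
    and sym: "\<And>s p \<omega> g N \<theta>. 0 < s \<Longrightarrow> s \<le> 1 \<Longrightarrow> N \<ge> 0 \<Longrightarrow> \<theta> \<ge> 0 \<Longrightarrow> Ck 4 g \<Longrightarrow>
      Ck_wnorm 4 (gauss_weight \<theta>) g \<le> ennreal N \<Longrightarrow>
      \<bar>((g (shift s p \<omega>) - g p - s\<^sup>2 * L_op V \<gamma> \<beta> g p) * exp (Edev s p \<omega>)
         + (g (shift s p (- \<omega>)) - g p - s\<^sup>2 * L_op V \<gamma> \<beta> g p) * exp (Edev s p (- \<omega>))) / 2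
       - s\<^sup>2 * (pd (snd p, 0) g p + pd (0, snd \<omega>) (pd (0, snd \<omega>) g) p / 2 - L_op V \<gamma> \<beta> g p
          + pd (0, snd \<omega>) g p * e1 p \<omega>)\<bar>
      \<le> C1 * s ^ 4 * (1 + norm p + norm \<omega>) ^ 10
          * (N * (gauss_weight \<theta> p)\<^sup>2 * exp (2 * \<theta> * (s * (1 + norm p + norm \<omega>))\<^sup>2)) * exp (Mdev s p \<omega>)"
    by (rule symmetrized_integrand_bound) blast
  note Gpos = Gam_pos[OF gamma_pos beta_pos]
  have k: "4 * \<epsilon> < \<beta> / (6 * \<gamma>)" "2 * \<epsilon> < \<beta> / (6 * \<gamma>)" "\<epsilon> < \<beta> / (6 * \<gamma>)" "- \<epsilon> < \<beta> / (6 * \<gamma>)"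
    using \<epsilon> k0 unfolding k0_def[symmetric] by linarith+
  \<comment> \<open>\<open>d0\<close> enters the lower bound of the normaliser; \<open>J\<close> and
    \<open>J2\<close> bound numerators with and without the polynomial factor.\<close>
  define d0 where "d0 = (\<integral>\<omega>. Gam \<gamma> \<beta> (\<omega> :: 'n phase) * exp (- \<epsilon> * (norm \<omega>)\<^sup>2) \<partial>lborel)"
  define J where "J = (\<integral>\<omega>. Gam \<gamma> \<beta> (\<omega> :: 'n phase) * exp (4 * \<epsilon> * (norm \<omega>)\<^sup>2) \<partial>lborel)"
  define J2 where "J2 = (\<integral>\<omega>. Gam \<gamma> \<beta> (\<omega> :: 'n phase) * exp (2 * \<epsilon> * (norm \<omega>)\<^sup>2) \<partial>lborel)"
  have int_e: "integrable lborel (\<lambda>\<omega>::'n phase. Gam \<gamma> \<beta> \<omega> * exp (a * (norm \<omega>)\<^sup>2))" if "a < \<beta> / (6 * \<gamma>)" for a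
    by (rule integrable_Gam_exp[OF gamma_pos beta_pos that])
  have d0: "d0 > 0" "J > 0" "J2 > 0"
    unfolding d0_def J_def J2_def
    by (intro lborel_integral_pos int_e k mult_pos_pos Gpos exp_gt_zero)+
  define C10 where "C10 = (5 / \<epsilon>) ^ 5"
  have C10: "C10 > 0" using \<epsilon> by (simp add: C10_def)
  define Ca where "Ca = J2 / d0"
  define Cb where "Cb = C1 * C10 * J / d0"
  define C where "C = Ca + Cb"
  have Cab: "Ca > 0" "Cb > 0" using d0 C1 C10 by (simp_all add: Ca_def Cb_def)
  then have Cpos: "Ca > 0" "Cb > 0" "C > 0" by (simp_all add: C_def)
  \<comment> \<open>The normaliser G_h \<psi> / \<psi>, as \<open>Gpsi\<close> shows. The two-sided
    bound on the exponent yields both its integrability and its lower bound.\<close>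
  define Z where "Z s p = (\<integral>\<omega>. Gam \<gamma> \<beta> \<omega> * exp (Edev s p \<omega>) \<partial>lborel)" for s p
  have Z: "integrable lborel (\<lambda>\<omega>. Gam \<gamma> \<beta> \<omega> * exp (Edev s p \<omega>))"
    "exp (- (\<epsilon> * (1 + norm p)\<^sup>2)) * d0 \<le> Z s p" if s: "0 < s" "s \<le> s0" for s p
  proof -
    have M: "\<bar>Edev s p \<omega>\<bar> \<le> \<epsilon> * (1 + norm p)\<^sup>2 + \<epsilon> * (norm \<omega>)\<^sup>2" for \<omega>
      using abs_Edev_le[of s p \<omega>] Msmall[of s p \<omega>] s s0 by linarith
    show int: "integrable lborel (\<lambda>\<omega>. Gam \<gamma> \<beta> \<omega> * exp (Edev s p \<omega>))"
    proof (rule integrable_Gam_bound[OF gamma_pos beta_pos k(3)])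
      fix \<omega>
      show "\<bar>exp (Edev s p \<omega>)\<bar> \<le> exp (\<epsilon> * (1 + norm p)\<^sup>2) * exp (\<epsilon> * (norm \<omega>)\<^sup>2)"
        unfolding exp_add[symmetric] abs_exp_cancel exp_le_cancel_iff using M[of \<omega>] by linarith
    qed measurable
    have "exp (- (\<epsilon> * (1 + norm p)\<^sup>2)) * d0
        = (\<integral>\<omega>. exp (- (\<epsilon> * (1 + norm p)\<^sup>2)) * (Gam \<gamma> \<beta> (\<omega> :: 'n phase) * exp (- \<epsilon> * (norm \<omega>)\<^sup>2)) \<partial>lborel)"
      by (simp only: d0_def integral_mult_right_zero)
    also have "\<dots> \<le> Z s p"
      unfolding Z_def
    proof (intro integral_mono integrable_mult_right int_e k int)
      fix \<omega> :: "'n phase"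
      have "exp (- (\<epsilon> * (1 + norm p)\<^sup>2)) * exp (- \<epsilon> * (norm \<omega>)\<^sup>2) \<le> exp (Edev s p \<omega>)"
        unfolding exp_add[symmetric] exp_le_cancel_iff mult_minus_left using M[of \<omega>] by linarith
      from mult_left_mono[OF this less_imp_le[OF Gpos[of \<omega>]]]
      show "exp (- (\<epsilon> * (1 + norm p)\<^sup>2)) * (Gam \<gamma> \<beta> \<omega> * exp (- \<epsilon> * (norm \<omega>)\<^sup>2))
          \<le> Gam \<gamma> \<beta> \<omega> * exp (Edev s p \<omega>)"
        by (simp only: mult_ac)
    qed
    finally show "exp (- (\<epsilon> * (1 + norm p)\<^sup>2)) * d0 \<le> Z s p" .
  qed
  have Zpos: "Z s p > 0" if "0 < s" "s \<le> s0" for s p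
    using Z(2)[OF that, of p] d0 by (meson exp_gt_zero less_le_trans mult_pos_pos)
  have Gpsi: "integrable lborel (\<lambda>z. G_kernel \<gamma> \<beta> (s\<^sup>2) z p * \<Psi> z)" "G_op \<gamma> \<beta> (s\<^sup>2) \<Psi> p = \<Psi> p * Z s p"
    if s: "0 < s" "s \<le> s0" for s p
  proof -
    have eq: "Gam \<gamma> \<beta> \<omega> * \<Psi> (shift s p \<omega>) = \<Psi> p * (Gam \<gamma> \<beta> \<omega> * exp (Edev s p \<omega>))" for \<omega>
      by (simp add: psi_shift)
    show "integrable lborel (\<lambda>z. G_kernel \<gamma> \<beta> (s\<^sup>2) z p * \<Psi> z)"
      unfolding G_op_rescaled(1)[OF s(1) psi_measurable] eq by (intro integrable_mult_right Z s)
    show "G_op \<gamma> \<beta> (s\<^sup>2) \<Psi> p = \<Psi> p * Z s p"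
      unfolding G_op_rescaled(2)[OF s(1) psi_measurable] eq Z_def by (rule integral_mult_right_zero)
  qed
  have near: "gauss_weight \<theta> (shift s p \<omega>) \<le> (gauss_weight \<theta> p)\<^sup>2 * exp (2 * \<theta> * (s * (1 + norm p + norm \<omega>))\<^sup>2)"
    "2 * \<theta> * (s * (1 + norm p + norm \<omega>))\<^sup>2 \<le> \<epsilon> * (1 + norm p)\<^sup>2 + \<epsilon> * (norm \<omega>)\<^sup>2"
    if s: "0 < s" "s \<le> s0" for s p \<omega>
  proof -
    have s1': "s \<le> 1" using s s0 s1 by linarith
    show "gauss_weight \<theta> (shift s p \<omega>) \<le> (gauss_weight \<theta> p)\<^sup>2 * exp (2 * \<theta> * (s * (1 + norm p + norm \<omega>))\<^sup>2)"
      by (rule gauss_weight_near[OF less_imp_le[OF \<theta>] norm_shift_diff[OF s(1) s1']])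
    have "s\<^sup>2 \<le> s0"
      using s s1' by (simp add: power2_eq_square) (meson mult_left_le_one_le less_imp_le order_trans)
    then have "2 * \<theta> * (s\<^sup>2 * (1 + norm p + norm \<omega>)\<^sup>2) \<le> 2 * \<theta> * (s0 * (2 * (1 + norm p)\<^sup>2 + 2 * (norm \<omega>)\<^sup>2))"
      using \<theta> s0 by (intro mult_left_mono mult_mono square_add_le) auto
    also have "\<dots> = (4 * \<theta> * s0) * ((1 + norm p)\<^sup>2 + (norm \<omega>)\<^sup>2)" by (simp add: algebra_simps)
    also have "\<dots> \<le> \<epsilon> * ((1 + norm p)\<^sup>2 + (norm \<omega>)\<^sup>2)" by (intro mult_right_mono s0) auto
    finally show "2 * \<theta> * (s * (1 + norm p + norm \<omega>))\<^sup>2 \<le> \<epsilon> * (1 + norm p)\<^sup>2 + \<epsilon> * (norm \<omega>)\<^sup>2"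
      by (simp only: power_mult_distrib distrib_left[of \<epsilon>])
  qed
  have big: "exp (5 * \<epsilon> * (1 + norm p)\<^sup>2) \<le> gauss_weight \<theta>' p" for p :: "'n phase"
  proof -
    have "5 * \<epsilon> * (1 + norm p)\<^sup>2 \<le> 5 * \<epsilon> * (2 * 1\<^sup>2 + 2 * (norm p)\<^sup>2)"
      using \<epsilon> by (intro mult_left_mono square_add_le) auto
    also have "\<dots> = 10 * \<epsilon> * (1 + (norm p)\<^sup>2)" by (simp add: algebra_simps)
    also have "\<dots> \<le> \<theta>' * (1 + (norm p)\<^sup>2)" using \<epsilon> by (intro mult_right_mono) auto
    finally show ?thesis by (simp add: gauss_weight_eq)
  qed
  \<comment> \<open>A numerator is traded for a multiple of \<open>Z\<close>: exp(4 \<epsilon> (1 +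
    |p|)^2) splits into exp(5 \<epsilon> (1 + |p|)^2), which the weight takes, and exp(- \<epsilon>
    (1 + |p|)^2), which is at most \<open>Z\<close> / \<open>d0\<close>.\<close>
  have absorb: "K * exp (a * \<epsilon> * (1 + norm p)\<^sup>2) * j \<le> (j / d0) * K * gauss_weight \<theta>' p * Z s p"
    if s: "0 < s" "s \<le> s0" and "K \<ge> 0" "j > 0" "a \<le> 4" for K a j s p
  proof -
    have "exp (a * \<epsilon> * (1 + norm p)\<^sup>2) \<le> exp (4 * \<epsilon> * (1 + norm p)\<^sup>2)"
      using that(5) \<epsilon>(1) by (simp add: mult_right_mono)
    also have "\<dots> = exp (5 * \<epsilon> * (1 + norm p)\<^sup>2) * exp (- (\<epsilon> * (1 + norm p)\<^sup>2))"
      by (simp flip: exp_add)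
    also have "\<dots> \<le> gauss_weight \<theta>' p * (Z s p / d0)"
      using big[of p] Z(2)[OF s, of p] d0 by (intro mult_mono) (auto simp: field_simps gauss_weight_eq)
    finally have "K * j * exp (a * \<epsilon> * (1 + norm p)\<^sup>2) \<le> K * j * (gauss_weight \<theta>' p * (Z s p / d0))"
      using that by (intro mult_left_mono) auto
    then show ?thesis by (simp add: mult_ac)
  qed
  \<comment> \<open>The estimate without cancellation: one \<epsilon> from the displaced weight and
    one from the ratio of \<psi>. It provides the absolute integrability needed here and for Fubini
    in the duality.\<close>
  have boundB: "integrable lborel (\<lambda>\<omega>. Gam \<gamma> \<beta> \<omega> * (g (shift s p \<omega>) * exp (Edev s p \<omega>)))"
    "\<bar>\<integral>\<omega>. Gam \<gamma> \<beta> \<omega> * (g (shift s p \<omega>) * exp (Edev s p \<omega>)) \<partial>lborel\<bar> \<le> Ca * N * big_weight \<theta> \<theta>' 0 p * Z s p"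
    if s: "0 < s" "s \<le> s0" and N: "N \<ge> 0" and gm[measurable]: "g \<in> borel_measurable borel"
      and g: "\<And>z. \<bar>g z\<bar> \<le> N * gauss_weight \<theta> z" for s p g N
  proof -
    define K where "K = N * (gauss_weight \<theta> p)\<^sup>2"
    have K: "K \<ge> 0" using N by (simp add: K_def)
    have le: "\<bar>g (shift s p \<omega>) * exp (Edev s p \<omega>)\<bar> \<le> K * exp (2 * \<epsilon> * (1 + norm p)\<^sup>2) * exp (2 * \<epsilon> * (norm \<omega>)\<^sup>2)" for \<omega>
    proof -
      let ?E = "\<epsilon> * (1 + norm p)\<^sup>2 + \<epsilon> * (norm \<omega>)\<^sup>2"
      have "\<bar>g (shift s p \<omega>)\<bar> \<le> N * gauss_weight \<theta> (shift s p \<omega>)" by (rule g)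
      also have "\<dots> \<le> N * ((gauss_weight \<theta> p)\<^sup>2 * exp ?E)"
      proof (rule mult_left_mono[OF _ N])
        have "exp (2 * \<theta> * (s * (1 + norm p + norm \<omega>))\<^sup>2) \<le> exp ?E"
          using near(2)[OF s, of p \<omega>] by (simp only: exp_le_cancel_iff)
        then have "(gauss_weight \<theta> p)\<^sup>2 * exp (2 * \<theta> * (s * (1 + norm p + norm \<omega>))\<^sup>2)
            \<le> (gauss_weight \<theta> p)\<^sup>2 * exp ?E"
          by (rule mult_left_mono) simp
        then show "gauss_weight \<theta> (shift s p \<omega>) \<le> (gauss_weight \<theta> p)\<^sup>2 * exp ?E"
          using near(1)[OF s, of p \<omega>] by linarith
      qed
      finally have 1: "\<bar>g (shift s p \<omega>)\<bar> \<le> K * exp ?E" by (simp add: K_def mult.assoc)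
      have "Edev s p \<omega> \<le> ?E"
        using abs_Edev_le[of s p \<omega>] Msmall[of s p \<omega>] s s0 by linarith
      then have "\<bar>g (shift s p \<omega>)\<bar> * exp (Edev s p \<omega>) \<le> K * exp ?E * exp ?E"
        using 1 K by (intro mult_mono) auto
      also have "\<dots> = K * exp (2 * \<epsilon> * (1 + norm p)\<^sup>2) * exp (2 * \<epsilon> * (norm \<omega>)\<^sup>2)"
        unfolding mult.assoc exp_add[symmetric] by (simp add: algebra_simps)
      finally show ?thesis by (simp only: abs_mult abs_exp_cancel)
    qed
    have meas: "(\<lambda>\<omega>. g (shift s p \<omega>) * exp (Edev s p \<omega>)) \<in> borel_measurable borel" by measurable
    show "integrable lborel (\<lambda>\<omega>. Gam \<gamma> \<beta> \<omega> * (g (shift s p \<omega>) * exp (Edev s p \<omega>)))"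
      by (rule integrable_Gam_bound[OF gamma_pos beta_pos k(2) meas le])
    have "\<bar>\<integral>\<omega>. Gam \<gamma> \<beta> \<omega> * (g (shift s p \<omega>) * exp (Edev s p \<omega>)) \<partial>lborel\<bar>
      \<le> K * exp (2 * \<epsilon> * (1 + norm p)\<^sup>2) * J2"
      unfolding J2_def by (rule integral_Gam_le[OF k(2) meas le])
    also have "\<dots> \<le> Ca * K * gauss_weight \<theta>' p * Z s p"
      unfolding Ca_def by (rule absorb[OF s K d0(3)]) simp
    finally show "\<bar>\<integral>\<omega>. Gam \<gamma> \<beta> \<omega> * (g (shift s p \<omega>) * exp (Edev s p \<omega>)) \<partial>lborel\<bar>
      \<le> Ca * N * big_weight \<theta> \<theta>' 0 p * Z s p"
      by (simp add: K_def big_weight_0 mult.assoc)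
  qed
  have Gg: "integrable lborel (\<lambda>z. G_kernel \<gamma> \<beta> (s\<^sup>2) z p * (g z * \<Psi> z))
        \<longleftrightarrow> integrable lborel (\<lambda>\<omega>. Gam \<gamma> \<beta> \<omega> * (g (shift s p \<omega>) * exp (Edev s p \<omega>)))"
    "G_op \<gamma> \<beta> (s\<^sup>2) (\<lambda>z. g z * \<Psi> z) p = \<Psi> p * (\<integral>\<omega>. Gam \<gamma> \<beta> \<omega> * (g (shift s p \<omega>) * exp (Edev s p \<omega>)) \<partial>lborel)"
    if s: "0 < s" and gm[measurable]: "g \<in> borel_measurable borel" for s p g
  proof -
    have eq: "Gam \<gamma> \<beta> \<omega> * (g (shift s p \<omega>) * \<Psi> (shift s p \<omega>))
        = \<Psi> p * (Gam \<gamma> \<beta> \<omega> * (g (shift s p \<omega>) * exp (Edev s p \<omega>)))" for \<omega>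
      by (simp add: psi_shift)
    have m: "(\<lambda>z. g z * \<Psi> z) \<in> borel_measurable borel" by measurable
    show "integrable lborel (\<lambda>z. G_kernel \<gamma> \<beta> (s\<^sup>2) z p * (g z * \<Psi> z))
        \<longleftrightarrow> integrable lborel (\<lambda>\<omega>. Gam \<gamma> \<beta> \<omega> * (g (shift s p \<omega>) * exp (Edev s p \<omega>)))"
      unfolding G_op_rescaled(1)[OF s m] eq using psi_pos[of p] by simp
    show "G_op \<gamma> \<beta> (s\<^sup>2) (\<lambda>z. g z * \<Psi> z) p = \<Psi> p * (\<integral>\<omega>. Gam \<gamma> \<beta> \<omega> * (g (shift s p \<omega>) * exp (Edev s p \<omega>)) \<partial>lborel)"
      unfolding G_op_rescaled(2)[OF s m] eq by (rule integral_mult_right_zero)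
  qed
  have sqrt_h: "0 < sqrt h" "sqrt h \<le> s0" "(sqrt h)\<^sup>2 = h" if "0 < h" "h \<le> s0\<^sup>2" for h
    using that s0(1) by (auto simp: real_le_lsqrt real_sqrt_le_iff[of h "s0\<^sup>2", simplified])
  show thesis
  proof (rule that[of "s0\<^sup>2" C])
    show "0 < s0\<^sup>2" "C > 0" using s0 Cpos by auto
    fix h :: real and p :: "'n phase" assume h: "0 < h" "h \<le> s0\<^sup>2"
    note s = sqrt_h[OF h]
    show "integrable lborel (\<lambda>z. G_kernel \<gamma> \<beta> h z p * \<Psi> z) \<and> 0 < G_op \<gamma> \<beta> h \<Psi> p"
      using Gpsi[OF s(1,2), of p] Zpos[OF s(1,2), of p] psi_pos[of p] by (simp add: s(3))
  next
    fix h :: real and p :: "'n phase" and g :: "'n phase \<Rightarrow> real" and N :: real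
    assume h: "0 < h" "h \<le> s0\<^sup>2" and N: "N \<ge> 0" and gm: "g \<in> borel_measurable borel"
      and g: "\<And>z. \<bar>g z\<bar> \<le> N * gauss_weight \<theta> z"
    note s = sqrt_h[OF h]
    note B = boundB[OF s(1,2) N gm g, of p]
    let ?I = "\<integral>\<omega>. Gam \<gamma> \<beta> \<omega> * (g (shift (sqrt h) p \<omega>) * exp (Edev (sqrt h) p \<omega>)) \<partial>lborel"
    have "Ca * N * big_weight \<theta> \<theta>' 0 p * Z (sqrt h) p \<le> C * N * big_weight \<theta> \<theta>' 0 p * Z (sqrt h) p"
      using Cpos N Zpos[OF s(1,2), of p]
      by (intro mult_right_mono) (auto simp: C_def big_weight_0 gauss_weight_eq)
    with B(2) have "\<bar>?I\<bar> \<le> C * N * big_weight \<theta> \<theta>' 0 p * Z (sqrt h) p" by linarith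
    then have "\<Psi> p * \<bar>?I\<bar> \<le> \<Psi> p * (C * N * big_weight \<theta> \<theta>' 0 p * Z (sqrt h) p)"
      using psi_pos[of p] by simp
    moreover have "\<bar>\<Psi> p * ?I\<bar> = \<Psi> p * \<bar>?I\<bar>"
      using psi_pos[of p] by (simp only: abs_mult abs_of_pos)
    ultimately show "integrable lborel (\<lambda>z. G_kernel \<gamma> \<beta> h z p * (g z * \<Psi> z)) \<and>
      \<bar>G_op \<gamma> \<beta> h (\<lambda>z. g z * \<Psi> z) p\<bar> \<le> C * N * big_weight \<theta> \<theta>' 0 p * G_op \<gamma> \<beta> h \<Psi> p"
      using B(1) Gg[OF s(1) gm, of p] Gpsi(2)[OF s(1,2), of p] unfolding s(3) by (simp only: mult_ac) 
  next
    fix h :: real and p :: "'n phase" and g :: "'n phase \<Rightarrow> real" and N :: real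
    assume h: "0 < h" "h \<le> s0\<^sup>2" and N: "N \<ge> 0" and g: "Ck 4 g"
      and gN: "Ck_wnorm 4 (gauss_weight \<theta>) g \<le> ennreal N"
    note sh = sqrt_h[OF h]
    define s where "s = sqrt h"
    note s = sh(1,2)[folded s_def] and sh2 = sh(3)[folded s_def]
    have s1': "s \<le> 1" using s s0 s1 by linarith
    have gm[measurable]: "g \<in> borel_measurable borel"
      using Ck_continuous[OF g] by (rule borel_measurable_continuous_onI)
    have Wpos: "\<And>z. gauss_weight \<theta> z > 0" by (simp add: gauss_weight_eq)
    have gW: "\<bar>g z\<bar> \<le> N * gauss_weight \<theta> z" for z
      using Ck_weighted_derivative_bound[OF g gN Wpos N, of "[]" z] by simp
    \<comment> \<open>Subtracting this first-order approximation inside the integral turns the local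
      error, divided by \<psi> at p, into the integral of \<open>F\<close> against
      \<open>Gam\<close>.\<close>
    define c where "c = g p + s\<^sup>2 * L_op V \<gamma> \<beta> g p"
    define F where "F \<omega> = (g (shift s p \<omega>) - g p - s\<^sup>2 * L_op V \<gamma> \<beta> g p) * exp (Edev s p \<omega>)" for \<omega>
    define F0 where "F0 \<omega> = pd (snd p, 0) g p + pd (0, snd \<omega>) (pd (0, snd \<omega>) g) p / 2 - L_op V \<gamma> \<beta> g p
          + pd (0, snd \<omega>) g p * e1 p \<omega>" for \<omega>
    note gI = boundB(1)[OF s N gm gW, of p] and ZI = Z(1)[OF s, of p]
    have Feq: "Gam \<gamma> \<beta> \<omega> * F \<omega> = Gam \<gamma> \<beta> \<omega> * (g (shift s p \<omega>) * exp (Edev s p \<omega>))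
        - c * (Gam \<gamma> \<beta> \<omega> * exp (Edev s p \<omega>))" for \<omega>
      by (simp add: F_def c_def algebra_simps)
    have Fm[measurable]: "F \<in> borel_measurable borel" unfolding F_def[abs_def] by measurable
    have FI: "integrable lborel (\<lambda>\<omega>. Gam \<gamma> \<beta> \<omega> * F \<omega>)"
      unfolding Feq by (intro Bochner_Integration.integrable_diff integrable_mult_right gI ZI)
    have FI': "(\<integral>\<omega>. Gam \<gamma> \<beta> \<omega> * F \<omega> \<partial>lborel)
        = (\<integral>\<omega>. Gam \<gamma> \<beta> \<omega> * (g (shift s p \<omega>) * exp (Edev s p \<omega>)) \<partial>lborel) - c * Z s p"
      unfolding Feq Z_def
      by (subst Bochner_Integration.integral_diff) (auto intro!: integrable_mult_right gI ZI)
    note symI = integral_Gam_symmetrize[OF gamma_pos beta_pos Fm FI]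
    have g2: "Ck (Suc (Suc 2)) g" using g by simp
    note lead = leading_term_integral[OF g2, of p, folded F0_def]
    have leadI: "integrable lborel (\<lambda>\<omega>. s\<^sup>2 * (Gam \<gamma> \<beta> \<omega> * F0 \<omega>))"
      by (intro integrable_mult_right lead)
    \<comment> \<open>Symmetrisation and the vanishing leading integral give \<open>S\<close> the
      same integral as \<open>F\<close>, but \<open>S\<close> is of order s^4 pointwise.\<close>
    define S where "S \<omega> = (F \<omega> + F (- \<omega>)) / 2 - s\<^sup>2 * F0 \<omega>" for \<omega>
    have SI: "(\<lambda>\<omega>. Gam \<gamma> \<beta> \<omega> * S \<omega>) = (\<lambda>\<omega>. Gam \<gamma> \<beta> \<omega> * ((F \<omega> + F (- \<omega>)) / 2) - s\<^sup>2 * (Gam \<gamma> \<beta> \<omega> * F0 \<omega>))"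
      by (rule ext) (simp add: S_def right_diff_distrib)
    have Sint: "integrable lborel (\<lambda>\<omega>. Gam \<gamma> \<beta> \<omega> * S \<omega>)"
      unfolding SI by (intro Bochner_Integration.integrable_diff integrable_mult_right symI lead)
    have SF: "(\<integral>\<omega>. Gam \<gamma> \<beta> \<omega> * S \<omega> \<partial>lborel) = (\<integral>\<omega>. Gam \<gamma> \<beta> \<omega> * F \<omega> \<partial>lborel)"
      unfolding SI symI(2)
      by (subst Bochner_Integration.integral_diff[OF symI(1) leadI]) (simp add: integral_mult_right_zero[of lborel "s\<^sup>2"] lead(2))
    define K where "K = C1 * C10 * s ^ 4 * (N * (gauss_weight \<theta> p)\<^sup>2)"
    have K: "K \<ge> 0" using C1 C10 N s by (simp add: K_def)
    have Sle: "\<bar>S \<omega>\<bar> \<le> K * exp (4 * \<epsilon> * (1 + norm p)\<^sup>2) * exp (4 * \<epsilon> * (norm \<omega>)\<^sup>2)" for \<omega>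
    proof -
      define E where "E = \<epsilon> * (1 + norm p)\<^sup>2 + \<epsilon> * (norm \<omega>)\<^sup>2"
      define P where "P = 1 + norm p + norm \<omega>"
      have "\<bar>S \<omega>\<bar> \<le> C1 * s ^ 4 * P ^ 10
          * (N * (gauss_weight \<theta> p)\<^sup>2 * exp (2 * \<theta> * (s * P)\<^sup>2)) * exp (Mdev s p \<omega>)"
        using sym[OF s(1) s1' N less_imp_le[OF \<theta>] g gN, of p \<omega>] unfolding S_def F_def F0_def P_def .
      \<comment> \<open>The count behind the rate 4 \<epsilon>: P^10 costs 2 E, the displaced weight
        one E and the ratio of \<psi> one E.\<close>
      also have "\<dots> \<le> C1 * s ^ 4 * (C10 * exp (2 * E))
          * (N * (gauss_weight \<theta> p)\<^sup>2 * exp E) * exp E"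
      proof (intro mult_mono mult_left_mono)
        have "\<epsilon> * P\<^sup>2 \<le> \<epsilon> * (2 * (1 + norm p)\<^sup>2 + 2 * (norm \<omega>)\<^sup>2)"
          unfolding P_def using \<epsilon> by (intro mult_left_mono square_add_le) auto
        also have "\<dots> = 2 * E" by (simp add: E_def algebra_simps)
        finally have "C10 * exp (\<epsilon> * P\<^sup>2) \<le> C10 * exp (2 * E)" using C10 by simp
        then show "P ^ 10 \<le> C10 * exp (2 * E)"
          using power10_le_exp[OF \<epsilon>(1), of P] unfolding C10_def by linarith
        show "exp (2 * \<theta> * (s * P)\<^sup>2) \<le> exp E" using near(2)[OF s, of p \<omega>] by (simp add: P_def E_def)
        show "exp (Mdev s p \<omega>) \<le> exp E" using Msmall[of s p \<omega>] s s0 by (simp add: E_def)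
      qed (use C1 C10 N s in \<open>auto simp: P_def\<close>)
      also have "\<dots> = K * (exp (2 * E) * exp E * exp E)" by (simp add: K_def)
      also have "exp (2 * E) * exp E * exp E = exp (4 * \<epsilon> * (1 + norm p)\<^sup>2) * exp (4 * \<epsilon> * (norm \<omega>)\<^sup>2)"
        unfolding exp_add[symmetric] by (simp add: E_def algebra_simps)
      finally show ?thesis by (simp only: mult.assoc)
    qed
    \<comment> \<open>Measurability of \<open>S\<close> is recovered from its integrable product
      with the positive \<open>Gam\<close>; this avoids a direct treatment of the directional
      derivatives as functions of \<omega>.\<close>
    have "(\<lambda>\<omega>. Gam \<gamma> \<beta> \<omega> * S \<omega> / Gam \<gamma> \<beta> \<omega>) \<in> borel_measurable borel"
      using borel_measurable_integrable[OF Sint] by measurable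
    moreover have "Gam \<gamma> \<beta> \<omega> * S \<omega> / Gam \<gamma> \<beta> \<omega> = S \<omega>" for \<omega> using Gpos[of \<omega>] by simp
    ultimately have Sm: "S \<in> borel_measurable borel" by simp
    have "\<bar>\<integral>\<omega>. Gam \<gamma> \<beta> \<omega> * S \<omega> \<partial>lborel\<bar> \<le> K * exp (4 * \<epsilon> * (1 + norm p)\<^sup>2) * J"
      unfolding J_def by (rule integral_Gam_le[OF k(1) Sm Sle])
    also have "\<dots> \<le> (J / d0) * K * gauss_weight \<theta>' p * Z s p"
      by (rule absorb[OF s K d0(2)]) simp
    also have "\<dots> = Cb * (s\<^sup>2)\<^sup>2 * N * big_weight \<theta> \<theta>' 0 p * Z s p"
      by (simp add: Cb_def K_def big_weight_0 flip: power_mult)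
    also have "\<dots> \<le> C * (s\<^sup>2)\<^sup>2 * N * big_weight \<theta> \<theta>' 0 p * Z s p"
      using Cpos N Zpos[OF s, of p]
      by (intro mult_right_mono) (auto simp: C_def big_weight_0 gauss_weight_eq)
    finally have fin: "\<bar>(\<integral>\<omega>. Gam \<gamma> \<beta> \<omega> * (g (shift s p \<omega>) * exp (Edev s p \<omega>)) \<partial>lborel) - c * Z s p\<bar>
        \<le> C * (s\<^sup>2)\<^sup>2 * N * big_weight \<theta> \<theta>' 0 p * Z s p"
      unfolding SF FI' .
    let ?I = "\<integral>\<omega>. Gam \<gamma> \<beta> \<omega> * (g (shift s p \<omega>) * exp (Edev s p \<omega>)) \<partial>lborel"
    have eq: "G_op \<gamma> \<beta> (s\<^sup>2) (\<lambda>z. g z * \<Psi> z) p - c * G_op \<gamma> \<beta> (s\<^sup>2) \<Psi> p = \<Psi> p * (?I - c * Z s p)"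
      unfolding Gg(2)[OF s(1) gm] Gpsi(2)[OF s] by (simp add: right_diff_distrib)
    have "\<bar>\<Psi> p * (?I - c * Z s p)\<bar> \<le> \<Psi> p * (C * (s\<^sup>2)\<^sup>2 * N * big_weight \<theta> \<theta>' 0 p * Z s p)"
      using mult_left_mono[OF fin less_imp_le[OF psi_pos[of p]]] psi_pos[of p] by (simp only: abs_mult abs_of_pos)
    also have "\<dots> = C * (s\<^sup>2)\<^sup>2 * N * big_weight \<theta> \<theta>' 0 p * G_op \<gamma> \<beta> (s\<^sup>2) \<Psi> p"
      unfolding Gpsi(2)[OF s] by (simp only: mult_ac)
    finally show "\<bar>G_op \<gamma> \<beta> h (\<lambda>z. g z * \<Psi> z) p - (g p + h * L_op V \<gamma> \<beta> g p) * G_op \<gamma> \<beta> h \<Psi> p\<bar>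
        \<le> C * h\<^sup>2 * N * big_weight \<theta> \<theta>' 0 p * G_op \<gamma> \<beta> h \<Psi> p"
      unfolding eq[symmetric] unfolding c_def sh2 .
  qed
qed

end

subsection \<open>Duality for the one-step operator\<close>

context kinetic
begin

lemma G_kernel_pos: "h > 0 \<Longrightarrow> G_kernel \<gamma> \<beta> h z p > 0"
  using gamma_pos beta_pos by (simp add: G_kernel_def case_prod_beta')

lemma G_op_measurable:
  fixes F :: "'n phase \<Rightarrow> real"
  assumes [measurable]: "F \<in> borel_measurable borel"
  shows "G_op \<gamma> \<beta> h F \<in> borel_measurable borel"
proof -
  have K: "(\<lambda>(z, p). G_kernel \<gamma> \<beta> h z p) \<in> borel_measurable (borel \<Otimes>\<^sub>M (borel :: 'n phase measure))"
    unfolding borel_prod by (rule G_kernel_measurable)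
  have "(\<lambda>(p, z). G_kernel \<gamma> \<beta> h z p) \<in> borel_measurable ((borel :: 'n phase measure) \<Otimes>\<^sub>M borel)"
    using measurable_compose[OF measurable_Pair[OF measurable_snd measurable_fst] K]
    by (simp add: case_prod_beta')
  then have "(\<lambda>(p, z). G_kernel \<gamma> \<beta> h z p * F z) \<in> borel_measurable ((borel :: 'n phase measure) \<Otimes>\<^sub>M lborel)"
    unfolding case_prod_beta' by measurable
  from lborel.borel_measurable_lebesgue_integral[OF this]
  show ?thesis unfolding G_op_def[abs_def] by simp
qed

lemma K_op_measurable:
  fixes \<rho> :: "'n phase \<Rightarrow> real"
  assumes [measurable]: "\<rho> \<in> borel_measurable borel"
  shows "K_op V \<gamma> \<beta> l h \<rho> \<in> borel_measurable borel"
proof -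
  have [measurable]: "G_op \<gamma> \<beta> h \<Psi> \<in> borel_measurable borel" by (rule G_op_measurable) measurable
  have "(\<lambda>(z, p). G_kernel \<gamma> \<beta> h z p) \<in> borel_measurable (borel \<Otimes>\<^sub>M (borel :: 'n phase measure))"
    unfolding borel_prod by (rule G_kernel_measurable)
  then have "(\<lambda>(z, p). G_kernel \<gamma> \<beta> h z p * (\<rho> p / G_op \<gamma> \<beta> h \<Psi> p)) \<in> borel_measurable (borel \<Otimes>\<^sub>M lborel)"
    unfolding case_prod_beta' by measurable
  from lborel.borel_measurable_lebesgue_integral[OF this]
  have "(\<lambda>z. \<Psi> z * (\<integral>p. G_kernel \<gamma> \<beta> h z p * (\<rho> p / G_op \<gamma> \<beta> h \<Psi> p) \<partial>lborel)) \<in> borel_measurable borel"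
    by measurable
  then show ?thesis by (simp add: K_op_def[abs_def])
qed

lemma K_op_nonneg:
  fixes \<rho> :: "'n phase \<Rightarrow> real"
  assumes "h > 0" "\<And>p. \<rho> p \<ge> 0" "\<And>p. G_op \<gamma> \<beta> h \<Psi> p > 0"
  shows "K_op V \<gamma> \<beta> l h \<rho> z \<ge> 0"
  unfolding K_op_def
  by (intro mult_nonneg_nonneg Bochner_Integration.integral_nonneg divide_nonneg_pos assms
      less_imp_le[OF psi_pos] less_imp_le[OF G_kernel_pos])

text \<open>Fubini, with the absolute inner integral dominated by C times the integrable \<omega>
  \<rho>. The premise \<open>gI\<close> is stated separately because \<open>G_op\<close> is a
  Bochner integral: a divergent one would have the value 0, and \<open>gB\<close> could then hold
  for that reason alone.\<close>

lemma K_op_duality: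
  fixes \<rho> g \<omega> :: "'n phase \<Rightarrow> real"
  assumes h: "h > 0" and Gpos: "\<And>p. G_op \<gamma> \<beta> h \<Psi> p > 0"
    and \<rho>[measurable]: "\<rho> \<in> borel_measurable borel" and \<rho>0: "\<And>p. \<rho> p \<ge> 0"
    and int: "integrable lborel (\<lambda>p. \<omega> p * \<rho> p)"
    and g[measurable]: "g \<in> borel_measurable borel"
    and gI: "\<And>p. integrable lborel (\<lambda>z. G_kernel \<gamma> \<beta> h z p * (\<bar>g z\<bar> * \<Psi> z))"
    and gB: "\<And>p. \<bar>G_op \<gamma> \<beta> h (\<lambda>z. \<bar>g z\<bar> * \<Psi> z) p\<bar> \<le> C * \<omega> p * G_op \<gamma> \<beta> h \<Psi> p"
  shows "(\<integral>z. g z * K_op V \<gamma> \<beta> l h \<rho> z \<partial>lborel)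
    = (\<integral>p. (G_op \<gamma> \<beta> h (\<lambda>z. g z * \<Psi> z) p / G_op \<gamma> \<beta> h \<Psi> p) * \<rho> p \<partial>lborel)"
proof -
  have G_op_psi [measurable]: "G_op \<gamma> \<beta> h \<Psi> \<in> borel_measurable borel" by (rule G_op_measurable) measurable
  define \<Phi> where "\<Phi> p z = g z * \<Psi> z * (G_kernel \<gamma> \<beta> h z p * (\<rho> p / G_op \<gamma> \<beta> h \<Psi> p))" for p z
  have "(\<lambda>(z, p). G_kernel \<gamma> \<beta> h z p) \<in> borel_measurable (borel \<Otimes>\<^sub>M (borel :: 'n phase measure))"
    unfolding borel_prod by (rule G_kernel_measurable)
  from measurable_compose[OF measurable_Pair[OF measurable_snd measurable_fst] this]
  have [measurable]: "(\<lambda>x. G_kernel \<gamma> \<beta> h (snd x) (fst x)) \<in> borel_measurable ((borel :: 'n phase measure) \<Otimes>\<^sub>M borel)"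
    by simp
  have "(\<lambda>x. \<Phi> (fst x) (snd x)) \<in> borel_measurable ((borel :: 'n phase measure) \<Otimes>\<^sub>M borel)"
    unfolding \<Phi>_def by measurable
  then have meas: "(\<lambda>x. \<Phi> (fst x) (snd x)) \<in> borel_measurable (lborel \<Otimes>\<^sub>M (lborel :: 'n phase measure))"
    by (simp cong: measurable_cong_sets)
  have eq: "norm (\<Phi> p z) = (\<rho> p / G_op \<gamma> \<beta> h \<Psi> p) * (G_kernel \<gamma> \<beta> h z p * (\<bar>g z\<bar> * \<Psi> z))" for p z
    using psi_pos[of z] G_kernel_pos[OF h, of z p] \<rho>0[of p] Gpos[of p]
    by (simp add: \<Phi>_def abs_mult)
  have norm_int: "(\<integral>z. norm (\<Phi> p z) \<partial>lborel) = (\<rho> p / G_op \<gamma> \<beta> h \<Psi> p) * G_op \<gamma> \<beta> h (\<lambda>z. \<bar>g z\<bar> * \<Psi> z) p" for p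
    unfolding eq integral_mult_right_zero G_op_def by (rule refl)
  have 1: "integrable lborel (\<lambda>p. \<integral>z. norm (\<Phi> p z) \<partial>lborel)"
  proof (rule Bochner_Integration.integrable_bound)
    show "integrable lborel (\<lambda>p. C * (\<omega> p * \<rho> p))" by (intro integrable_mult_right int)
    have [measurable]: "G_op \<gamma> \<beta> h (\<lambda>z. \<bar>g z\<bar> * \<Psi> z) \<in> borel_measurable borel"
      by (rule G_op_measurable) measurable
    show "(\<lambda>p. \<integral>z. norm (\<Phi> p z) \<partial>lborel) \<in> borel_measurable lborel"
      unfolding norm_int by measurable
    have "norm (\<integral>z. norm (\<Phi> p z) \<partial>lborel) \<le> norm (C * (\<omega> p * \<rho> p))" for p
    proof -
      have "norm (\<integral>z. norm (\<Phi> p z) \<partial>lborel) = (\<rho> p / G_op \<gamma> \<beta> h \<Psi> p) * \<bar>G_op \<gamma> \<beta> h (\<lambda>z. \<bar>g z\<bar> * \<Psi> z) p\<bar>"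
        unfolding norm_int using \<rho>0[of p] Gpos[of p] by (simp add: abs_mult)
      also have "\<dots> \<le> (\<rho> p / G_op \<gamma> \<beta> h \<Psi> p) * (C * \<omega> p * G_op \<gamma> \<beta> h \<Psi> p)"
        using \<rho>0[of p] Gpos[of p] by (intro mult_left_mono gB) auto
      also have "\<dots> = C * (\<omega> p * \<rho> p)" using Gpos[of p] by (simp add: mult_ac)
      finally show ?thesis by simp
    qed
    then show "AE p in lborel. norm (\<integral>z. norm (\<Phi> p z) \<partial>lborel) \<le> norm (C * (\<omega> p * \<rho> p))" by simp
  qed
  have "integrable lborel (\<lambda>z. norm (\<Phi> p z))" for p
    unfolding eq by (intro integrable_mult_right gI)
  moreover have "\<Phi> p \<in> borel_measurable lborel" for p unfolding \<Phi>_def by measurable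
  ultimately have 2: "integrable lborel (\<Phi> p)" for p
    using integrable_norm_iff[of "\<Phi> p" lborel] by blast
  have fub: "integrable (lborel \<Otimes>\<^sub>M lborel) (case_prod \<Phi>)"
    using lborel_pair.Fubini_integrable[of "\<lambda>x. \<Phi> (fst x) (snd x)"] meas 1 2
    by (simp add: case_prod_beta')
  have "(\<integral>z. g z * K_op V \<gamma> \<beta> l h \<rho> z \<partial>lborel) = (\<integral>z. (\<integral>p. \<Phi> p z \<partial>lborel) \<partial>lborel)"
    unfolding \<Phi>_def K_op_def integral_mult_right_zero by (simp only: mult.assoc)
  also have "\<dots> = (\<integral>p. (\<integral>z. \<Phi> p z \<partial>lborel) \<partial>lborel)"
    by (rule lborel_pair.Fubini_integral[OF fub])
  also have "\<dots> = (\<integral>p. (G_op \<gamma> \<beta> h (\<lambda>z. g z * \<Psi> z) p / G_op \<gamma> \<beta> h \<Psi> p) * \<rho> p \<partial>lborel)"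
  proof (intro Bochner_Integration.integral_cong refl)
    fix p
    have "\<Phi> p z = (\<rho> p / G_op \<gamma> \<beta> h \<Psi> p) * (G_kernel \<gamma> \<beta> h z p * (g z * \<Psi> z))" for z
      by (simp add: \<Phi>_def)
    then have "(\<integral>z. \<Phi> p z \<partial>lborel) = (\<rho> p / G_op \<gamma> \<beta> h \<Psi> p) * G_op \<gamma> \<beta> h (\<lambda>z. g z * \<Psi> z) p"
      by (simp only: integral_mult_right_zero G_op_def)
    then show "(\<integral>z. \<Phi> p z \<partial>lborel) = (G_op \<gamma> \<beta> h (\<lambda>z. g z * \<Psi> z) p / G_op \<gamma> \<beta> h \<Psi> p) * \<rho> p" by simp
  qed
  finally show ?thesis .
qed

end

subsection \<open>From local to global error\<close>

text \<open>The second derivative is bounded but not assumed continuous, so mean value inequalities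
  replace the integral remainder: |d x - d t| \<le> M h on the step, and this bound controls the
  linearisation of f. The factor 1/2 is lost.\<close>

lemma second_order_time_Taylor:
  fixes f d :: "real \<Rightarrow> real"
  assumes diff: "\<And>t. t \<in> {0..T} \<Longrightarrow> f differentiable (at t within {0..T})"
    and d: "\<And>t. t \<in> {0..T} \<Longrightarrow> d t = vector_derivative f (at t within {0..T})"
    and diff2: "\<And>t. t \<in> {0..T} \<Longrightarrow> d differentiable (at t within {0..T})"
    and M: "\<And>t. t \<in> {0..T} \<Longrightarrow> \<bar>vector_derivative d (at t within {0..T})\<bar> \<le> M"
    and t: "0 \<le> t" "0 < h" "t + h \<le> T"
  shows "\<bar>f (t + h) - f t - h * d t\<bar> \<le> M * h\<^sup>2"
proof -
  let ?S = "{t..t + h}"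
  have sub: "?S \<subseteq> {0..T}" using t by auto
  have fd: "(f has_vector_derivative d x) (at x within ?S)" if "x \<in> ?S" for x
  proof -
    have x: "x \<in> {0..T}" using that sub by blast
    have "(f has_vector_derivative d x) (at x within {0..T})"
      using diff[OF x] unfolding d[OF x] vector_derivative_works .
    then show ?thesis using sub by (rule has_vector_derivative_within_subset)
  qed
  have dd: "(d has_real_derivative vector_derivative d (at x within {0..T})) (at x within ?S)" if "x \<in> ?S" for x
  proof -
    have x: "x \<in> {0..T}" using that sub by blast
    have "(d has_vector_derivative vector_derivative d (at x within {0..T})) (at x within {0..T})"
      using diff2[OF x] unfolding vector_derivative_works .
    then show ?thesis
      using sub has_vector_derivative_within_subset
      unfolding has_real_derivative_iff_has_vector_derivative by blast
  qed
  have M0: "M \<ge> 0" using M[of t] t by fastforce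
  have dx: "norm (d x - d t) \<le> M * h" if x: "x \<in> ?S" for x
  proof -
    have "norm (d x - d t) \<le> M * norm (x - t)"
    proof (rule field_differentiable_bound[of ?S d "\<lambda>x. vector_derivative d (at x within {0..T})"])
      show "norm (vector_derivative d (at z within {0..T})) \<le> M" if "z \<in> ?S" for z
        using M[of z] that sub by auto
    qed (use x t dd in auto)
    also have "\<dots> \<le> M * h" using x M0 by (intro mult_left_mono) auto
    finally show ?thesis .
  qed
  have "norm (f (t + h) - f t - (t + h - t) *\<^sub>R d t) \<le> norm (t + h - t) * (M * h)"
    by (rule vector_differentiable_bound_linearization[of ?S f d])
      (use fd dx t in \<open>auto simp: closed_segment_eq_real_ivl\<close>)
  then show ?thesis using t by (simp add: power2_eq_square mult_ac)
qed

lemma wnorm_le_imp: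
  assumes "wnorm \<omega> g \<le> ennreal N" "N \<ge> 0" "\<omega> z > 0"
  shows "\<bar>g z\<bar> \<le> N * \<omega> z"
proof -
  have "ennreal (\<bar>g z\<bar> / \<omega> z) \<le> ennreal N"
    using assms(1) unfolding wnorm_def by (rule order_trans[OF SUP_upper[OF UNIV_I]])
  then have "\<bar>g z\<bar> / \<omega> z \<le> N" using assms(2) by (simp add: ennreal_le_iff)
  then show ?thesis using assms(3) by (simp add: field_simps)
qed

lemma moment_bound:
  assumes [measurable]: "\<rho> \<in> borel_measurable borel" "\<omega> \<in> borel_measurable borel"
    and pos: "\<And>z. 0 \<le> \<rho> z" "\<And>z. 0 \<le> \<omega> z"
    and M: "moment \<omega> \<rho> \<le> ennreal M" "M \<ge> 0"
  shows "integrable lborel (\<lambda>z. \<omega> z * \<rho> z)" "(\<integral>z. \<omega> z * \<rho> z \<partial>lborel) \<le> M"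
proof -
  have fin: "(\<integral>\<^sup>+ z. ennreal (\<omega> z * \<rho> z) \<partial>lborel) < \<infinity>"
    using M(1) unfolding moment_def by (rule order.strict_trans1) simp
  show i: "integrable lborel (\<lambda>z. \<omega> z * \<rho> z)"
    by (rule integrableI_nonneg) (use fin pos in auto)
  have "ennreal (\<integral>z. \<omega> z * \<rho> z \<partial>lborel) \<le> ennreal M"
    using M(1) pos unfolding moment_def by (subst (asm) nn_integral_eq_integral[OF i]) auto
  then show "(\<integral>z. \<omega> z * \<rho> z \<partial>lborel) \<le> M" using M(2) by (simp add: ennreal_le_iff)
qed

lemma gauss_weight_pos: "gauss_weight \<theta> z > 0"
  by (simp add: gauss_weight_eq)

text \<open>Lets functions of growth W be integrated against densities whose moments are controlled
  only for the large weight.\<close>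

lemma gauss_weight_le_big_weight:
  assumes "0 \<le> \<theta>" "0 \<le> \<theta>'"
  shows "gauss_weight \<theta> z \<le> big_weight \<theta> \<theta>' 0 z"
proof -
  have "1 \<le> gauss_weight \<theta> z" "1 \<le> gauss_weight \<theta>' z" using assms by (simp_all add: gauss_weight_eq)
  then have "gauss_weight \<theta> z * 1 * 1 \<le> gauss_weight \<theta> z * gauss_weight \<theta> z * gauss_weight \<theta>' z"
    by (intro mult_mono) auto
  then show ?thesis by (simp add: big_weight_0 power2_eq_square)
qed

lemma big_weight_measurable [measurable]:
  "big_weight \<theta> \<theta>' 0 \<in> borel_measurable (borel :: 'n::finite phase measure)"
proof -
  have "big_weight \<theta> \<theta>' 0 = (\<lambda>z :: 'n phase. (exp (\<theta> * (1 + (norm z)\<^sup>2)))\<^sup>2 * exp (\<theta>' * (1 + (norm z)\<^sup>2)))"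
    by (rule ext) (simp add: big_weight_0 gauss_weight_eq)
  then show ?thesis by simp
qed

context kinetic
begin

text \<open>Intended for g the backward solution at some time and v the one a step h later. Duality
  replaces the scheme by the quotient \<open>Q\<close>, and both \<open>Q\<close> and v are compared
  with g + h L g: a is the cost in phase space, b the cost in time.\<close>

lemma one_step_error:
  fixes \<rho> g v \<omega> :: "'n phase \<Rightarrow> real"
  assumes h: "h > 0" and Gpos: "\<And>p. G_op \<gamma> \<beta> h \<Psi> p > 0"
    and \<rho>[measurable]: "\<rho> \<in> borel_measurable borel" and \<rho>0: "\<And>p. \<rho> p \<ge> 0"
    and int: "integrable lborel (\<lambda>p. \<omega> p * \<rho> p)"
    and g[measurable]: "g \<in> borel_measurable borel" and v[measurable]: "v \<in> borel_measurable borel"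
    and gI: "\<And>p. integrable lborel (\<lambda>z. G_kernel \<gamma> \<beta> h z p * (\<bar>g z\<bar> * \<Psi> z))"
    and gB: "\<And>p. \<bar>G_op \<gamma> \<beta> h (\<lambda>z. \<bar>g z\<bar> * \<Psi> z) p\<bar> \<le> C * \<omega> p * G_op \<gamma> \<beta> h \<Psi> p"
    and vB: "\<And>p. \<bar>v p\<bar> \<le> C' * \<omega> p"
    and err: "\<And>p. \<bar>G_op \<gamma> \<beta> h (\<lambda>z. g z * \<Psi> z) p - (g p + h * L_op V \<gamma> \<beta> g p) * G_op \<gamma> \<beta> h \<Psi> p\<bar>
        \<le> a * \<omega> p * G_op \<gamma> \<beta> h \<Psi> p"
    and time: "\<And>p. \<bar>v p - g p - h * L_op V \<gamma> \<beta> g p\<bar> \<le> b * \<omega> p"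
  shows "\<bar>(\<integral>z. g z * K_op V \<gamma> \<beta> l h \<rho> z \<partial>lborel) - (\<integral>z. v z * \<rho> z \<partial>lborel)\<bar>
    \<le> (a + b) * (\<integral>z. \<omega> z * \<rho> z \<partial>lborel)"
proof -
  define Q where "Q p = G_op \<gamma> \<beta> h (\<lambda>z. g z * \<Psi> z) p / G_op \<gamma> \<beta> h \<Psi> p" for p
  have G_op_psi [measurable]: "G_op \<gamma> \<beta> h \<Psi> \<in> borel_measurable borel" by (rule G_op_measurable) measurable
  have G_op_g [measurable]: "G_op \<gamma> \<beta> h (\<lambda>z. g z * \<Psi> z) \<in> borel_measurable borel"
    by (rule G_op_measurable) measurable
  have Qm [measurable]: "Q \<in> borel_measurable borel" unfolding Q_def by measurable
  have "\<bar>G_op \<gamma> \<beta> h (\<lambda>z. g z * \<Psi> z) p\<bar> \<le> C * \<omega> p * G_op \<gamma> \<beta> h \<Psi> p" for p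
  proof -
    \<comment> \<open>The premise concerns |g|, as Fubini requires; positivity of kernel and \<psi>
      transfers it to g.\<close>
    have "\<bar>G_op \<gamma> \<beta> h (\<lambda>z. g z * \<Psi> z) p\<bar> \<le> (\<integral>z. \<bar>G_kernel \<gamma> \<beta> h z p * (g z * \<Psi> z)\<bar> \<partial>lborel)"
      unfolding G_op_def by (rule integral_abs_bound)
    also have "\<dots> = G_op \<gamma> \<beta> h (\<lambda>z. \<bar>g z\<bar> * \<Psi> z) p"
      unfolding G_op_def
      by (intro Bochner_Integration.integral_cong refl)
        (simp add: abs_mult abs_of_pos[OF G_kernel_pos[OF h]] abs_of_pos[OF psi_pos])
    finally show ?thesis using gB[of p] by linarith
  qed
  then have QB: "\<bar>Q p\<bar> \<le> C * \<omega> p" for p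
    using Gpos[of p] by (simp add: Q_def field_simps)
  have i: "integrable lborel (\<lambda>p. F p * \<rho> p)"
    if [measurable]: "F \<in> borel_measurable borel" and F: "\<And>p. \<bar>F p\<bar> \<le> c * \<omega> p" for F c
  proof (rule Bochner_Integration.integrable_bound)
    show "integrable lborel (\<lambda>p. c * (\<omega> p * \<rho> p))" by (intro integrable_mult_right int)
    have "\<bar>F p * \<rho> p\<bar> \<le> \<bar>c * (\<omega> p * \<rho> p)\<bar>" for p
    proof -
      have "\<bar>F p * \<rho> p\<bar> = \<bar>F p\<bar> * \<rho> p" using \<rho>0[of p] by (simp add: abs_mult)
      also have "\<dots> \<le> c * \<omega> p * \<rho> p" by (rule mult_right_mono[OF F \<rho>0])
      also have "\<dots> \<le> \<bar>c * (\<omega> p * \<rho> p)\<bar>" using abs_ge_self[of "c * (\<omega> p * \<rho> p)"] by (simp only: mult.assoc)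
      finally show ?thesis .
    qed
    then show "AE p in lborel. norm (F p * \<rho> p) \<le> norm (c * (\<omega> p * \<rho> p))" by simp
  qed measurable
  have iQ: "integrable lborel (\<lambda>p. Q p * \<rho> p)" by (rule i[OF Qm QB])
  have iv: "integrable lborel (\<lambda>p. v p * \<rho> p)" by (rule i[OF v vB])
  have "(\<integral>z. g z * K_op V \<gamma> \<beta> l h \<rho> z \<partial>lborel) - (\<integral>z. v z * \<rho> z \<partial>lborel)
      = (\<integral>p. Q p * \<rho> p - v p * \<rho> p \<partial>lborel)"
    unfolding K_op_duality[OF h Gpos \<rho> \<rho>0 int g gI gB] Q_def[symmetric]
    by (rule Bochner_Integration.integral_diff[OF iQ iv, symmetric])
  also have "norm \<dots> \<le> (\<integral>p. (a + b) * (\<omega> p * \<rho> p) \<partial>lborel)"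
  proof (rule Bochner_Integration.integral_norm_bound_integral)
    show "integrable lborel (\<lambda>p. Q p * \<rho> p - v p * \<rho> p)" by (intro Bochner_Integration.integrable_diff iQ iv)
    show "integrable lborel (\<lambda>p. (a + b) * (\<omega> p * \<rho> p))" by (intro integrable_mult_right int)
    fix p
    have "Q p - (g p + h * L_op V \<gamma> \<beta> g p)
       = (G_op \<gamma> \<beta> h (\<lambda>z. g z * \<Psi> z) p - (g p + h * L_op V \<gamma> \<beta> g p) * G_op \<gamma> \<beta> h \<Psi> p) / G_op \<gamma> \<beta> h \<Psi> p"
      using Gpos[of p] by (simp add: Q_def diff_divide_distrib)
    then have "\<bar>Q p - (g p + h * L_op V \<gamma> \<beta> g p)\<bar> \<le> a * \<omega> p"
      using err[of p] Gpos[of p] by (simp add: abs_divide pos_divide_le_eq)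
    with time[of p] have "\<bar>Q p - v p\<bar> \<le> (a + b) * \<omega> p" by (simp add: distrib_right)
    then have "\<bar>Q p - v p\<bar> * \<rho> p \<le> (a + b) * \<omega> p * \<rho> p" using \<rho>0[of p] by (rule mult_right_mono)
    then show "norm (Q p * \<rho> p - v p * \<rho> p) \<le> (a + b) * (\<omega> p * \<rho> p)"
      using \<rho>0[of p] by (simp add: abs_mult mult.assoc flip: left_diff_distrib)
  qed
  finally show ?thesis by (simp only: real_norm_def integral_mult_right_zero)
qed

end

theorem theorem2p7:
  fixes V :: "real^'n \<Rightarrow> real" and \<gamma> \<beta> l \<theta> \<theta>' :: real
  assumes "\<gamma> > 0" and "\<beta> > 0" and "l > 0" and "0 < \<theta>" and "\<theta> < \<theta>'"
    and "admissible_potential V"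
  shows "\<exists>h\<^sub>0>0. \<exists>m::nat.
    (\<forall>h\<in>{0<..h\<^sub>0}. \<forall>p :: 'n phase.
        integrable lborel (\<lambda>z. G_kernel \<gamma> \<beta> h z p * psi V \<gamma> \<beta> l z)
        \<and> 0 < G_op \<gamma> \<beta> h (psi V \<gamma> \<beta> l) p) \<and>
    (\<forall>(\<rho>\<^sub>0 :: 'n phase \<Rightarrow> real) (T :: real) (\<rho> :: real \<Rightarrow> 'n phase \<Rightarrow> real)
        (u :: ('n phase \<Rightarrow> real) \<Rightarrow> real \<Rightarrow> 'n phase \<Rightarrow> real) (h\<^sub>T :: real) (M\<^sub>T :: real).
      prob_density \<rho>\<^sub>0 \<longrightarrow>
      moment (big_weight \<theta> \<theta>' m) \<rho>\<^sub>0 < \<infinity> \<longrightarrow>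
      T > 0 \<longrightarrow>
      kFP_solution V \<gamma> \<beta> T \<rho>\<^sub>0 \<rho> \<longrightarrow>
      (\<exists>C\<^sub>1>0. \<forall>f\<in>Ck_weighted 4 (gauss_weight \<theta>).
          backward_solution V \<gamma> \<beta> T f (u f) \<and>
          time_differentiable T (time_deriv T (u f)) \<and>
          (\<forall>t\<in>{0..T}. u f t \<in> Ck_weighted 4 (gauss_weight \<theta>)) \<and>
          (SUP t\<in>{0..T}. Ck_wnorm 4 (gauss_weight \<theta>) (u f t))
          + (SUP t\<in>{0..T}. wnorm (big_weight \<theta> \<theta>' m) (time_deriv T (time_deriv T (u f)) t))
          \<le> ennreal C\<^sub>1 * Ck_wnorm 4 (gauss_weight \<theta>) f) \<longrightarrow>
      (\<forall>f\<in>Ck_weighted 4 (gauss_weight \<theta>). \<forall>t\<in>{0..T}.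
          (\<integral>z. f z * \<rho> t z \<partial>lborel) = (\<integral>z. u f t z * \<rho>\<^sub>0 z \<partial>lborel)) \<longrightarrow>
      h\<^sub>T \<in> {0<..min h\<^sub>0 1} \<longrightarrow>
      M\<^sub>T > 0 \<longrightarrow>
      (SUP t\<in>{0..T}. moment (big_weight \<theta> \<theta>' m) (\<rho> t))
      + (SUP h\<in>{0<..h\<^sub>T}. SUP k\<in>{k::nat. real k * h \<le> T}.
            moment (big_weight \<theta> \<theta>' m) ((K_op V \<gamma> \<beta> l h ^^ k) \<rho>\<^sub>0))
      \<le> ennreal M\<^sub>T \<longrightarrow>
      (\<exists>C\<^sub>T>0. \<forall>f\<in>Ck_weighted 4 (gauss_weight \<theta>). \<forall>h\<in>{0<..h\<^sub>T}. \<forall>n::nat.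
          real n * h \<le> T \<longrightarrow>
          ennreal \<bar>(\<integral>z. f z * (K_op V \<gamma> \<beta> l h ^^ n) \<rho>\<^sub>0 z \<partial>lborel)
                   - (\<integral>z. f z * \<rho> (real n * h) z \<partial>lborel)\<bar>
          \<le> ennreal (C\<^sub>T * h) * Ck_wnorm 4 (gauss_weight \<theta>) f))"
proof -
  interpret kinetic V \<gamma> \<beta> l using assms by unfold_locales auto
  have \<theta>': "0 < \<theta>'" using assms by linarith
  obtain h0 C where h0: "0 < h0" and C: "C > 0"
    and psi_int: "\<And>h (p :: 'n phase). 0 < h \<Longrightarrow> h \<le> h0 \<Longrightarrow>
      integrable lborel (\<lambda>z. G_kernel \<gamma> \<beta> h z p * \<Psi> z) \<and> 0 < G_op \<gamma> \<beta> h \<Psi> p"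
    and bound: "\<And>h p g N. 0 < h \<Longrightarrow> h \<le> h0 \<Longrightarrow> N \<ge> 0 \<Longrightarrow> g \<in> borel_measurable borel \<Longrightarrow>
      (\<And>z. \<bar>g z\<bar> \<le> N * gauss_weight \<theta> z) \<Longrightarrow>
      integrable lborel (\<lambda>z. G_kernel \<gamma> \<beta> h z p * (g z * \<Psi> z)) \<and>
      \<bar>G_op \<gamma> \<beta> h (\<lambda>z. g z * \<Psi> z) p\<bar> \<le> C * N * big_weight \<theta> \<theta>' 0 p * G_op \<gamma> \<beta> h \<Psi> p"
    and consistency: "\<And>h p g N. 0 < h \<Longrightarrow> h \<le> h0 \<Longrightarrow> N \<ge> 0 \<Longrightarrow> Ck 4 g \<Longrightarrow>
      Ck_wnorm 4 (gauss_weight \<theta>) g \<le> ennreal N \<Longrightarrow>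
      \<bar>G_op \<gamma> \<beta> h (\<lambda>z. g z * \<Psi> z) p - (g p + h * L_op V \<gamma> \<beta> g p) * G_op \<gamma> \<beta> h \<Psi> p\<bar>
        \<le> C * h\<^sup>2 * N * big_weight \<theta> \<theta>' 0 p * G_op \<gamma> \<beta> h \<Psi> p"
    using local_error[OF assms(4) \<theta>'] by blast
  define \<omega> :: "'n phase \<Rightarrow> real" where "\<omega> = big_weight \<theta> \<theta>' 0"
  have \<omega>m [measurable]: "\<omega> \<in> borel_measurable borel" unfolding \<omega>_def by measurable
  have \<omega>pos: "\<omega> z > 0" for z
    using gauss_weight_le_big_weight[of \<theta> \<theta>' z] gauss_weight_pos[of \<theta> z] assms(4) \<theta>'
    unfolding \<omega>_def by linarith
  show ?thesis
  proof (rule exI[of _ h0], intro conjI, rule h0, rule exI[of _ 0], intro conjI allI impI ballI)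
    fix h :: real and p :: "'n phase" assume "h \<in> {0<..h0}"
    then show "integrable lborel (\<lambda>z. G_kernel \<gamma> \<beta> h z p * \<Psi> z)" "0 < G_op \<gamma> \<beta> h \<Psi> p"
      using psi_int[of h p] by auto
  next
    fix \<rho>\<^sub>0 :: "'n phase \<Rightarrow> real" and T :: real and \<rho> :: "real \<Rightarrow> 'n phase \<Rightarrow> real"
      and u :: "('n phase \<Rightarrow> real) \<Rightarrow> real \<Rightarrow> 'n phase \<Rightarrow> real" and h\<^sub>T M\<^sub>T :: real
    assume \<rho>0: "prob_density \<rho>\<^sub>0" and T: "T > 0"
      and i: "\<exists>C\<^sub>1>0. \<forall>f\<in>Ck_weighted 4 (gauss_weight \<theta>).
          backward_solution V \<gamma> \<beta> T f (u f) \<and>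
          time_differentiable T (time_deriv T (u f)) \<and>
          (\<forall>t\<in>{0..T}. u f t \<in> Ck_weighted 4 (gauss_weight \<theta>)) \<and>
          (SUP t\<in>{0..T}. Ck_wnorm 4 (gauss_weight \<theta>) (u f t))
          + (SUP t\<in>{0..T}. wnorm (big_weight \<theta> \<theta>' 0) (time_deriv T (time_deriv T (u f)) t))
          \<le> ennreal C\<^sub>1 * Ck_wnorm 4 (gauss_weight \<theta>) f"
      and ii: "\<forall>f\<in>Ck_weighted 4 (gauss_weight \<theta>). \<forall>t\<in>{0..T}.
          (\<integral>z. f z * \<rho> t z \<partial>lborel) = (\<integral>z. u f t z * \<rho>\<^sub>0 z \<partial>lborel)"
      and hT: "h\<^sub>T \<in> {0<..min h0 1}" and MT: "M\<^sub>T > 0"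
      and iii: "(SUP t\<in>{0..T}. moment (big_weight \<theta> \<theta>' 0) (\<rho> t))
      + (SUP h\<in>{0<..h\<^sub>T}. SUP k\<in>{k::nat. real k * h \<le> T}.
            moment (big_weight \<theta> \<theta>' 0) ((K_op V \<gamma> \<beta> l h ^^ k) \<rho>\<^sub>0))
      \<le> ennreal M\<^sub>T"
    obtain C\<^sub>1 where C1: "C\<^sub>1 > 0"
      and bsol: "\<And>f. f \<in> Ck_weighted 4 (gauss_weight \<theta>) \<Longrightarrow> backward_solution V \<gamma> \<beta> T f (u f)"
      and td2: "\<And>f. f \<in> Ck_weighted 4 (gauss_weight \<theta>) \<Longrightarrow> time_differentiable T (time_deriv T (u f))"
      and uC: "\<And>f t. f \<in> Ck_weighted 4 (gauss_weight \<theta>) \<Longrightarrow> t \<in> {0..T} \<Longrightarrow> u f t \<in> Ck_weighted 4 (gauss_weight \<theta>)"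
      and norms: "\<And>f. f \<in> Ck_weighted 4 (gauss_weight \<theta>) \<Longrightarrow>
          (SUP t\<in>{0..T}. Ck_wnorm 4 (gauss_weight \<theta>) (u f t))
          + (SUP t\<in>{0..T}. wnorm \<omega> (time_deriv T (time_deriv T (u f)) t))
          \<le> ennreal C\<^sub>1 * Ck_wnorm 4 (gauss_weight \<theta>) f"
      using i unfolding \<omega>_def by blast
    \<comment> \<open>Each of the n steps costs (C + 1) h^2 N M_T, with C from the spatial and 1
      from the temporal error, and n h \<le> T converts n h^2 into T h. The bound in (i) contributes
      the factor \<open>C\<^sub>1\<close>.\<close>
    define C\<^sub>T where "C\<^sub>T = T * (C + 1) * C\<^sub>1 * M\<^sub>T"
    have CT: "C\<^sub>T > 0" unfolding C\<^sub>T_def using T C C1 MT by (intro mult_pos_pos) auto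
    show "\<exists>C\<^sub>T>0. \<forall>f\<in>Ck_weighted 4 (gauss_weight \<theta>). \<forall>h\<in>{0<..h\<^sub>T}. \<forall>n::nat.
          real n * h \<le> T \<longrightarrow>
          ennreal \<bar>(\<integral>z. f z * (K_op V \<gamma> \<beta> l h ^^ n) \<rho>\<^sub>0 z \<partial>lborel)
                   - (\<integral>z. f z * \<rho> (real n * h) z \<partial>lborel)\<bar>
          \<le> ennreal (C\<^sub>T * h) * Ck_wnorm 4 (gauss_weight \<theta>) f"
    proof (intro exI conjI ballI allI impI)
      show "C\<^sub>T > 0" by (rule CT)
      fix f :: "'n phase \<Rightarrow> real" and h :: real and n :: nat
      assume f: "f \<in> Ck_weighted 4 (gauss_weight \<theta>)" and hh: "h \<in> {0<..h\<^sub>T}" and nT: "real n * h \<le> T"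
      have h: "0 < h" "h \<le> h0" using hh hT by auto
      have Gpos: "G_op \<gamma> \<beta> h \<Psi> p > 0" for p :: "'n phase" using psi_int[OF h] by blast
      \<comment> \<open>The norm is finite for f in the weighted space, so the estimates run over
        the reals and return to [0, \<infinity>] only at the end.\<close>
      define N0 where "N0 = enn2real (Ck_wnorm 4 (gauss_weight \<theta>) f)"
      have N0: "Ck_wnorm 4 (gauss_weight \<theta>) f = ennreal N0" "N0 \<ge> 0"
        using f by (auto simp: N0_def Ck_weighted_def)
      define N where "N = C\<^sub>1 * N0"
      have N: "N \<ge> 0" using C1 N0 by (simp add: N_def)
      have both: "(SUP t\<in>{0..T}. Ck_wnorm 4 (gauss_weight \<theta>) (u f t))
          + (SUP t\<in>{0..T}. wnorm \<omega> (time_deriv T (time_deriv T (u f)) t)) \<le> ennreal N"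
        using norms[OF f] C1 N0 by (simp add: N_def ennreal_mult)
      have uN: "Ck_wnorm 4 (gauss_weight \<theta>) (u f t) \<le> ennreal N" if "t \<in> {0..T}" for t
        by (rule order_trans[OF SUP_upper[OF that] order_trans[OF _ both]]) simp
      have ttN: "wnorm \<omega> (time_deriv T (time_deriv T (u f)) t) \<le> ennreal N" if "t \<in> {0..T}" for t
        by (rule order_trans[OF SUP_upper[OF that] order_trans[OF _ both]]) simp
      have u4: "Ck 4 (u f t)" if "t \<in> {0..T}" for t
        using uC[OF f that] by (simp add: Ck_weighted_def)
      have um: "u f t \<in> borel_measurable borel" if "t \<in> {0..T}" for t
        using Ck_continuous[OF u4[OF that]] by (rule borel_measurable_continuous_onI)
      have uW: "\<bar>u f t z\<bar> \<le> N * gauss_weight \<theta> z" if "t \<in> {0..T}" for t z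
        using Ck_weighted_derivative_bound[OF u4[OF that] uN[OF that] gauss_weight_pos N, of "[]" z] by simp
      define r where "r k = (K_op V \<gamma> \<beta> l h ^^ k) \<rho>\<^sub>0" for k
      \<comment> \<open>The moment bounds in (iii) become Bochner integral bounds only for
        measurable nonnegative iterates; both properties pass along the recursion.\<close>
      have r0: "r k \<in> borel_measurable borel \<and> (\<forall>z. r k z \<ge> 0)" for k
      proof (induction k)
        case 0
        show ?case using \<rho>0 borel_measurable_integrable[of lborel \<rho>\<^sub>0] by (auto simp: r_def prob_density_def)
      next
        case (Suc k)
        have "r (Suc k) = K_op V \<gamma> \<beta> l h (r k)" by (simp add: r_def)
        then show ?case
          using Suc.IH K_op_measurable[of "r k"] K_op_nonneg[OF h(1) _ Gpos, of "r k"] by (simp only:) blast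
      qed
      have mom: "moment \<omega> (r k) \<le> ennreal M\<^sub>T" if k: "real k * h \<le> T" for k
      proof -
        have "moment \<omega> (r k) \<le> (SUP k\<in>{k::nat. real k * h \<le> T}. moment \<omega> ((K_op V \<gamma> \<beta> l h ^^ k) \<rho>\<^sub>0))"
          unfolding r_def by (rule SUP_upper) (use k in simp)
        also have "\<dots> \<le> (SUP h\<in>{0<..h\<^sub>T}. SUP k\<in>{k::nat. real k * h \<le> T}. moment \<omega> ((K_op V \<gamma> \<beta> l h ^^ k) \<rho>\<^sub>0))"
          by (rule SUP_upper[OF hh])
        also have "\<dots> \<le> ennreal M\<^sub>T"
          by (rule order_trans[OF _ iii[folded \<omega>_def]]) simp
        finally show ?thesis .
      qed
      have mb: "integrable lborel (\<lambda>z. \<omega> z * r k z)" "(\<integral>z. \<omega> z * r k z \<partial>lborel) \<le> M\<^sub>T"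
        if "real k * h \<le> T" for k
        using moment_bound[OF _ \<omega>m _ less_imp_le[OF \<omega>pos] mom[OF that] less_imp_le[OF MT]] r0[of k] by blast+
      \<comment> \<open>The telescoping quantity: k steps of the scheme paired with the exact
        backward solution over the remaining time. \<open>S n\<close> is the numerical value and, by
        (ii), \<open>S 0\<close> the exact one. The truncated subtraction is harmless, as only k
        \<le> n occurs.\<close>
      define S where "S k = (\<integral>z. u f (real (n - k) * h) z * r k z \<partial>lborel)" for k
      have step: "\<bar>S (Suc k) - S k\<bar> \<le> (C + 1) * h\<^sup>2 * N * M\<^sub>T" if k: "k < n" for k
      proof -
        define t where "t = real (n - Suc k) * h"
        have nk: "n - k = Suc (n - Suc k)" using k by simp
        have th: "real (n - k) * h = t + h" unfolding nk t_def by (simp add: distrib_right)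
        have t: "0 \<le> t" "t + h \<le> T"
        proof -
          show "0 \<le> t" using h by (simp add: t_def)
          have "real (n - k) * h \<le> real n * h" using h by (intro mult_right_mono) auto
          then show "t + h \<le> T" using nT th by linarith
        qed
        have tin: "t \<in> {0..T}" "t + h \<in> {0..T}" using t h by auto
        have kT: "real k * h \<le> T"
        proof -
          have "real k * h \<le> real n * h" using k h by (intro mult_right_mono) auto
          then show ?thesis using nT by linarith
        qed
        have time: "\<bar>u f (t + h) p - u f t p - h * L_op V \<gamma> \<beta> (u f t) p\<bar> \<le> (h\<^sup>2 * N) * \<omega> p" for p
        proof -
          have "\<bar>u f (t + h) p - u f t p - h * time_deriv T (u f) t p\<bar> \<le> (N * \<omega> p) * h\<^sup>2"
          proof (rule second_order_time_Taylor[of T "\<lambda>s. u f s p" "\<lambda>s. time_deriv T (u f) s p"])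
            show "(\<lambda>s. u f s p) differentiable (at s within {0..T})" if "s \<in> {0..T}" for s
              using bsol[OF f] that unfolding backward_solution_def time_differentiable_def by blast
            show "(\<lambda>s. time_deriv T (u f) s p) differentiable (at s within {0..T})" if "s \<in> {0..T}" for s
              using td2[OF f] that unfolding time_differentiable_def by blast
            show "\<bar>vector_derivative (\<lambda>s. time_deriv T (u f) s p) (at s within {0..T})\<bar> \<le> N * \<omega> p"
              if "s \<in> {0..T}" for s
              using wnorm_le_imp[OF ttN[OF that] N \<omega>pos] by (simp add: time_deriv_def)
          qed (use t h in \<open>auto simp: time_deriv_def\<close>)
          \<comment> \<open>Here the backward equation enters: the first-order term in time is h L
            u, the same term that the kernel expansion produces.\<close>
          moreover have "time_deriv T (u f) t p = L_op V \<gamma> \<beta> (u f t) p"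
            using bsol[OF f] tin unfolding backward_solution_def by blast
          ultimately show ?thesis by (simp add: mult_ac)
        qed
        have abs_m: "(\<lambda>z. \<bar>u f t z\<bar>) \<in> borel_measurable borel" using um[OF tin(1)] by measurable
        have B: "integrable lborel (\<lambda>z. G_kernel \<gamma> \<beta> h z p * (\<bar>u f t z\<bar> * \<Psi> z))"
          "\<bar>G_op \<gamma> \<beta> h (\<lambda>z. \<bar>u f t z\<bar> * \<Psi> z) p\<bar> \<le> (C * N) * \<omega> p * G_op \<gamma> \<beta> h \<Psi> p" for p
          using bound[OF h N abs_m, of p] uW[OF tin(1)] by (simp_all add: \<omega>_def)
        have vB: "\<bar>u f (t + h) p\<bar> \<le> N * \<omega> p" for p
        proof -
          have "gauss_weight \<theta> p \<le> \<omega> p"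
            unfolding \<omega>_def using assms(4) \<theta>' by (intro gauss_weight_le_big_weight) auto
          then have "N * gauss_weight \<theta> p \<le> N * \<omega> p" using N by (rule mult_left_mono)
          then show ?thesis using uW[OF tin(2), of p] by linarith
        qed
        have "\<bar>(\<integral>z. u f t z * K_op V \<gamma> \<beta> l h (r k) z \<partial>lborel) - (\<integral>z. u f (t + h) z * r k z \<partial>lborel)\<bar>
            \<le> (C * h\<^sup>2 * N + h\<^sup>2 * N) * (\<integral>z. \<omega> z * r k z \<partial>lborel)"
          by (rule one_step_error[OF h(1) Gpos _ _ mb(1)[OF kT] um[OF tin(1)] um[OF tin(2)] B vB
                consistency[OF h N u4[OF tin(1)] uN[OF tin(1)], folded \<omega>_def] time])
            (use r0[of k] in auto)
        also have "\<dots> \<le> (C * h\<^sup>2 * N + h\<^sup>2 * N) * M\<^sub>T"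
          using C N by (intro mult_left_mono mb(2)[OF kT]) auto
        also have "\<dots> = (C + 1) * h\<^sup>2 * N * M\<^sub>T" by (simp add: distrib_right)
        finally show ?thesis
          by (simp add: S_def th t_def[symmetric] r_def)
      qed
      have "\<bar>S k - S 0\<bar> \<le> real k * ((C + 1) * h\<^sup>2 * N * M\<^sub>T)" if "k \<le> n" for k
        using that
      proof (induction k)
        case (Suc k)
        have "\<bar>S (Suc k) - S 0\<bar> \<le> \<bar>S (Suc k) - S k\<bar> + \<bar>S k - S 0\<bar>" by linarith
        also have "\<dots> \<le> (C + 1) * h\<^sup>2 * N * M\<^sub>T + real k * ((C + 1) * h\<^sup>2 * N * M\<^sub>T)"
          using Suc step[of k] by (intro add_mono) auto
        finally show ?case by (simp add: distrib_right)
      qed simp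
      from this[of n] have "\<bar>S n - S 0\<bar> \<le> (real n * h) * ((C + 1) * h * N * M\<^sub>T)"
        by (simp add: power2_eq_square mult_ac)
      also have "\<dots> \<le> T * ((C + 1) * h * N * M\<^sub>T)"
        using nT C h N MT by (intro mult_right_mono) auto
      also have "\<dots> = (C\<^sub>T * h) * N0" by (simp add: C\<^sub>T_def N_def mult_ac)
      finally have main: "\<bar>S n - S 0\<bar> \<le> (C\<^sub>T * h) * N0" .
      have "u f 0 = f" using bsol[OF f] unfolding backward_solution_def by blast
      then have Sn: "S n = (\<integral>z. f z * (K_op V \<gamma> \<beta> l h ^^ n) \<rho>\<^sub>0 z \<partial>lborel)" by (simp add: S_def r_def)
      have "real n * h \<in> {0..T}" using nT h by simp
      then have S0: "S 0 = (\<integral>z. f z * \<rho> (real n * h) z \<partial>lborel)" using ii f by (simp add: S_def r_def)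
      show "ennreal \<bar>(\<integral>z. f z * (K_op V \<gamma> \<beta> l h ^^ n) \<rho>\<^sub>0 z \<partial>lborel)
                   - (\<integral>z. f z * \<rho> (real n * h) z \<partial>lborel)\<bar>
          \<le> ennreal (C\<^sub>T * h) * Ck_wnorm 4 (gauss_weight \<theta>) f"
        unfolding N0(1) Sn[symmetric] S0[symmetric]
        using main CT h N0(2) by (simp add: ennreal_leI flip: ennreal_mult)
    qed
  qed
qed

end
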